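(* Let $\widetilde T=\{(z_1,z_2,z_3)\in\mathbb{C}^3 \mid |z_1|=|z_2|=1,\ z_1z_2z_3=1\}$, which is a $2$-torus. Then $\widetilde T$ is totally real and polynomially convex in $\mathbb{C}^3$. Moreover, for every Hölder exponent $\alpha$ with $0\le\alpha<1$ there exists a $C^\alpha$-small perturbation of $\widetilde T$ that is totally real and neither polynomially nor rationally convex. That is, for every such $\alpha$ there exist a tubular neighbourhood $U$ of $\widetilde T$ in $\mathbb{C}^3$, a smooth submersion $\pi:U\to\widetilde T$ with $\pi|_{\widetilde T}=\mathrm{id}_{\widetilde T}$, and a sequence of smooth submanifolds $\widetilde T_j\subset U$, $j\in\mathbb{N}$, such that each $\widetilde T_j$ is totally real, not polynomially convex and not rationally convex, $\pi|_{\widetilde T_j}:\widetilde T_j\to\widetilde T$ is a diffeomorphism for every $j$, and $\widetilde T_j$ converges to $\widetilde T$ in the $C^\alpha$-topology as $j\to\infty$.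
   Context: Smooth means $C^\infty$. A smooth submanifold of $\mathbb{C}^n$ is called totally real if it is not tangent to any complex line, i.e. none of its (real) tangent spaces contains a complex line (a one-dimensional complex subspace of $\mathbb{C}^n$). A compact set $K\subset\mathbb{C}^n$ is polynomially convex if for every $z\in\mathbb{C}^n\setminus K$ there is a complex polynomial $P$ on $\mathbb{C}^n$ with $|P(z)|>\max_K|P|$. It is rationally convex if for every $z\in\mathbb{C}^n\setminus K$ there is a complex polynomial $P$ on $\mathbb{C}^n$ with $P(z)\notin P(K)$ (equivalently, $K$ equals its rationally convex hull). Definition ($C^\alpha$-small perturbation). A smooth submanifold $M\subset\mathbb{C}^n$ admits a $C^\alpha$-small perturbation with a certain property if there exist (i) a submersion $\pi:U_M\to M$ from a tubular neighbourhood $U_M$ of $M$ onto $M$, and (ii) a sequence of smooth submanifolds $M_j\subset U_M$, $j\in\mathbb{N}$, each having that property, such that $M_j$ converge to $M$ in the $C^\alpha$-topology as $j\to\infty$ and $\pi:M_j\to M$ is a diffeomorphism for all $j$. In other words, a neighbourhood of $M$ in $\mathbb{C}^n$ can be identified with a neighbourhood of the zero section in the normal bundle of $M$ so that all the $M_j$ correspond to graphs of $C^\alpha$-small sections of that bundle. For compact $M$, the $C^\alpha$-convergence means that the maps $\sigma_j=(\pi|_{M_j})^{-1}:M\to\mathbb{C}^n$ converge to the inclusion $M\hookrightarrow\mathbb{C}^n$ in the Hölder norm $C^\alpha(M,\mathbb{C}^n)$ (the uniform norm if $\alpha=0$). *)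

theory Defs
  imports "HOL-Analysis.Analysis"
begin

section \<open>Smooth maps and smooth submanifolds of Euclidean spaces\<close>

text \<open>Class \<open>C\<^sup>k\<close> on an open set; \<open>S\<close> is meant to be open, so that the
  (two-sided) derivatives at points of \<open>S\<close> only depend on \<open>f\<close> on \<open>S\<close>.\<close>

primrec Ck_on ::
  "nat \<Rightarrow> 'a::euclidean_space set \<Rightarrow> ('a \<Rightarrow> 'b::euclidean_space) \<Rightarrow> bool" where
  "Ck_on 0 S f \<longleftrightarrow> continuous_on S f"
| "Ck_on (Suc k) S f \<longleftrightarrow>
     (\<forall>x\<in>S. f differentiable (at x)) \<and> (\<forall>v. Ck_on k S (\<lambda>x. frechet_derivative f (at x) v))"

text \<open>Smoothness on an arbitrary subset: local existence of smooth extensions to open sets.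
  On a submanifold this is the intrinsic notion, on an open set it is \<open>C\<^sup>\<infinity>\<close>.\<close>

definition smooth_on ::
  "'a::euclidean_space set \<Rightarrow> ('a \<Rightarrow> 'b::euclidean_space) \<Rightarrow> bool" where
  "smooth_on S f \<longleftrightarrow>
     (\<forall>x\<in>S. \<exists>U g. open U \<and> x \<in> U \<and> (\<forall>k. Ck_on k U g) \<and> (\<forall>y\<in>S \<inter> U. g y = f y))"

definition diffeomorphism ::
  "'a::euclidean_space set \<Rightarrow> 'b::euclidean_space set \<Rightarrow> ('a \<Rightarrow> 'b) \<Rightarrow> bool" where
  "diffeomorphism S T f \<longleftrightarrow> bij_betw f S T \<and> smooth_on S f \<and> smooth_on T (the_inv_into S f)"

text \<open>Embedded submanifolds without boundary, by slice charts.\<close>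

definition smooth_submanifold :: "nat \<Rightarrow> 'a::euclidean_space set \<Rightarrow> bool" where
  "smooth_submanifold k M \<longleftrightarrow>
     (\<forall>p\<in>M. \<exists>(U::'a set) (V::'a set) L \<phi>.
        open U \<and> p \<in> U \<and> open V \<and> diffeomorphism U V \<phi> \<and>
        subspace L \<and> dim L = k \<and> \<phi> ` (U \<inter> M) = V \<inter> L)"

text \<open>Tangent vectors are the velocities of smooth curves in \<open>M\<close>.\<close>

definition tangent_space :: "'a::euclidean_space set \<Rightarrow> 'a \<Rightarrow> 'a set" where
  "tangent_space M p =
     {v. \<exists>(\<gamma>::real \<Rightarrow> 'a) e. e > 0 \<and> smooth_on {-e<..<e} \<gamma> \<and> \<gamma> ` {-e<..<e} \<subseteq> M \<and>
           \<gamma> 0 = p \<and> (\<gamma> has_vector_derivative v) (at 0)}"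

text \<open>A submersion from the open set \<open>U\<close> of the ambient space onto the submanifold \<open>M\<close>.\<close>

definition smooth_submersion ::
  "'a::euclidean_space set \<Rightarrow> 'a set \<Rightarrow> ('a \<Rightarrow> 'a) \<Rightarrow> bool" where
  "smooth_submersion U M \<pi> \<longleftrightarrow>
     smooth_on U \<pi> \<and> \<pi> ` U = M \<and>
     (\<forall>x\<in>U. range (frechet_derivative \<pi> (at x)) = tangent_space M (\<pi> x))"

definition normal_bundle :: "'a::euclidean_space set \<Rightarrow> ('a \<times> 'a) set" where
  "normal_bundle M = {(p, v). p \<in> M \<and> (\<forall>w\<in>tangent_space M p. v \<bullet> w = 0)}"

text \<open>An open neighbourhood of \<open>M\<close> that is identified, by a diffeomorphism that is the identity
  on \<open>M\<close>, with a fibrewise convex open neighbourhood of the zero section in the normal bundle.\<close>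

definition tubular_neighbourhood :: "'a::euclidean_space set \<Rightarrow> 'a set \<Rightarrow> bool" where
  "tubular_neighbourhood M U \<longleftrightarrow>
     open U \<and>
     (\<exists>W \<Phi>. openin (top_of_set (normal_bundle M)) W \<and>
            (\<forall>p\<in>M. (p, 0) \<in> W \<and> convex {v. (p, v) \<in> W}) \<and>
            diffeomorphism W U \<Phi> \<and> (\<forall>p\<in>M. \<Phi> (p, 0) = p))"


section \<open>Small perturbations in Hoelder norm\<close>

text \<open>Extended-valued, so that no boundedness assumption is hidden in the suprema.
  Points of \<open>M\<close> are compared by the ambient distance, which for a compact submanifold
  gives the same topology as the geodesic distance.\<close>

definition hoelder_norm ::
  "real \<Rightarrow> 'a::euclidean_space set \<Rightarrow> ('a \<Rightarrow> 'b::euclidean_space) \<Rightarrow> ennreal" where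
  "hoelder_norm \<alpha> M f =
     (SUP p\<in>M. ennreal (norm (f p))) +
     (if \<alpha> = 0 then 0
      else (SUP p\<in>M. SUP q\<in>M - {p}. ennreal (norm (f p - f q) / dist p q powr \<alpha>)))"

text \<open>For compact \<open>M\<close>. The map \<open>the_inv_into (N j) \<pi>\<close> is the section \<open>(\<pi>|N j)\<^sup>-\<^sup>1\<close> of \<open>\<pi>\<close> over \<open>M\<close>
  with image \<open>N j\<close>; it has to converge to the inclusion of \<open>M\<close>.\<close>

definition admits_small_perturbation ::
  "real \<Rightarrow> 'a::euclidean_space set \<Rightarrow> ('a set \<Rightarrow> bool) \<Rightarrow> bool" where
  "admits_small_perturbation \<alpha> M Q \<longleftrightarrow>
     (\<exists>U \<pi> (N :: nat \<Rightarrow> 'a set).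
        tubular_neighbourhood M U \<and>
        smooth_submersion U M \<pi> \<and> (\<forall>p\<in>M. \<pi> p = p) \<and>
        (\<forall>j. (\<exists>k. smooth_submanifold k (N j)) \<and> N j \<subseteq> U \<and> Q (N j) \<and>
             diffeomorphism (N j) M \<pi>) \<and>
        (\<lambda>j. hoelder_norm \<alpha> M (\<lambda>p. the_inv_into (N j) \<pi> p - p)) \<longlonglongrightarrow> 0)"


section \<open>Totally real sets, polynomial and rational convexity\<close>

definition complex_line :: "(complex ^ 'n) set \<Rightarrow> bool" where
  "complex_line L \<longleftrightarrow> vec.subspace L \<and> vec.dim L = 1"

definition totally_real :: "(complex ^ 'n) set \<Rightarrow> bool" where
  "totally_real M \<longleftrightarrow> (\<forall>p\<in>M. \<not> (\<exists>L. complex_line L \<and> L \<subseteq> tangent_space M p))"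

definition complex_polynomial :: "(complex ^ 'n \<Rightarrow> complex) \<Rightarrow> bool" where
  "complex_polynomial P \<longleftrightarrow>
     (\<exists>(A :: ('n \<Rightarrow> nat) set) c. finite A \<and>
        P = (\<lambda>z. \<Sum>a\<in>A. c a * (\<Prod>i\<in>UNIV. (z $ i) ^ a i)))"

text \<open>The next two notions are used for compact \<open>K\<close> only; there the inner condition says
  that the maximum of \<open>|P|\<close> over \<open>K\<close> is smaller than \<open>|P z|\<close>.\<close>

definition polynomially_convex :: "(complex ^ 'n) set \<Rightarrow> bool" where
  "polynomially_convex K \<longleftrightarrow>
     (\<forall>z. z \<notin> K \<longrightarrow> (\<exists>P. complex_polynomial P \<and> (\<forall>w\<in>K. cmod (P w) < cmod (P z))))"

definition rationally_convex :: "(complex ^ 'n) set \<Rightarrow> bool" where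
  "rationally_convex K \<longleftrightarrow>
     (\<forall>z. z \<notin> K \<longrightarrow> (\<exists>P. complex_polynomial P \<and> P z \<notin> P ` K))"

definition T_tilde :: "(complex ^ 3) set" where
  "T_tilde = {z. cmod (z $ 1) = 1 \<and> cmod (z $ 2) = 1 \<and> z $ 1 * z $ 2 * z $ 3 = 1}"

end

theory Submission
  imports Defs "HOL-Complex_Analysis.Residue_Theorem"
begin

text \<open>In the coordinates \<open>z\<^sub>1 = exp (\<i> w\<^sub>1)\<close>, \<open>z\<^sub>2 = exp (\<i> w\<^sub>2)\<close>, \<open>z\<^sub>3 = exp (- \<i> (w\<^sub>1 + w\<^sub>2)) + w\<^sub>3\<close>
  the torus is the real plane \<open>w = (x, y, 0)\<close>. Near the origin replace that plane by
  \<open>w = (x + \<i> c y, y - \<i> c x, \<epsilon> c)\<close>, where \<open>c = b ((x\<^sup>2 + y\<^sup>2) / \<epsilon>\<^sup>2)\<close> for a fixed bump function \<open>b\<close>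
  that takes the value \<open>1\<close> at \<open>1\<close> only, with nonzero derivative there. The change is of size \<open>\<epsilon>\<close> with
  bounded first derivatives, hence small in \<open>C\<^sup>\<alpha>\<close> for every \<open>\<alpha> < 1\<close>. The circle \<open>x\<^sup>2 + y\<^sup>2 = \<epsilon>\<^sup>2\<close> goes
  to the boundary of the holomorphic disc \<open>w = (\<omega>, - \<i> \<omega>, \<epsilon>)\<close>, \<open>\<bar>\<omega>\<bar> \<le> \<epsilon>\<close>, and it is contractible in
  the perturbed torus. So a polynomial without zeros on the torus has winding number \<open>0\<close> along this
  circle and, by the argument principle, no zero on the disc: the centre of the disc lies in the
  rationally convex hull. At a complex tangency the real function \<open>\<epsilon> c\<close> has differential \<open>0\<close>; with
  \<open>dc = 0\<close> the first two coordinates exclude a tangency unless \<open>c = 1\<close>, and there \<open>dc \<noteq> 0\<close>.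

  Maps depending only on the arguments of \<open>z\<^sub>1\<close>, \<open>z\<^sub>2\<close> commute with the radial retraction, so the
  perturbation is a diffeomorphism of the tube \<open>z\<^sub>1 \<noteq> 0\<close>, \<open>z\<^sub>2 \<noteq> 0\<close> over the torus.\<close>

section \<open>Calculus of smooth maps\<close>

text \<open>Derivatives at points of an open set depend only on the values in it, so the two
  functions may differ outside \<open>S\<close>.\<close>

lemma Ck_on_cong:
  assumes "open S" "\<And>x. x \<in> S \<Longrightarrow> f x = g x" "Ck_on k S f"
  shows "Ck_on k S g"
  using assms(2,3)
proof (induction k arbitrary: f g)
  case 0
  then show ?case by (auto intro: continuous_on_eq)
next
  case (Suc k)
  have D: "(g has_derivative frechet_derivative f (at x)) (at x)" if "x \<in> S" for x
  proof (rule has_derivative_transform_within_open[OF _ \<open>open S\<close> that])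
    show "(f has_derivative frechet_derivative f (at x)) (at x)"
      using Suc.prems(2) that by (simp add: frechet_derivative_works)
  qed (use Suc.prems(1) in auto)
  have "Ck_on k S (\<lambda>x. frechet_derivative g (at x) v)" for v
  proof (rule Suc.IH)
    show "Ck_on k S (\<lambda>x. frechet_derivative f (at x) v)"
      using Suc.prems(2) by simp
    show "frechet_derivative f (at x) v = frechet_derivative g (at x) v" if "x \<in> S" for x
      by (rule arg_cong[where f = "\<lambda>h. h v", OF frechet_derivative_at[OF D[OF that]]])
  qed
  then show ?case using D by (auto simp: differentiable_def)
qed

text \<open>By uniqueness of the derivative any explicit \<open>f'\<close> may stand for
  \<open>frechet_derivative\<close> in the recursion on the order.\<close>

lemma Ck_on_SucI:
  assumes "open S" "\<And>x. x \<in> S \<Longrightarrow> (f has_derivative f' x) (at x)"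
    and "\<And>v. Ck_on k S (\<lambda>x. f' x v)"
  shows "Ck_on (Suc k) S f"
proof -
  have "Ck_on k S (\<lambda>x. frechet_derivative f (at x) v)" for v
    by (rule Ck_on_cong[OF assms(1) _ assms(3)[of v]])
      (rule arg_cong[where f = "\<lambda>h. h v", OF frechet_derivative_at[OF assms(2)]])
  then show ?thesis using assms(2) by (auto simp: differentiable_def)
qed

lemma Ck_on_SucD:
  assumes "Ck_on (Suc k) S f" "x \<in> S"
  shows "(f has_derivative frechet_derivative f (at x)) (at x)"
  using assms by (simp add: frechet_derivative_works)

lemma Ck_on_SucD': "Ck_on (Suc k) S f \<Longrightarrow> Ck_on k S (\<lambda>x. frechet_derivative f (at x) v)"
  by simp

lemma Ck_on_imp_continuous_on: "Ck_on k S f \<Longrightarrow> continuous_on S f"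
  by (cases k) (auto intro!: continuous_at_imp_continuous_on differentiable_imp_continuous_within)

lemma Ck_on_Suc_imp: "Ck_on (Suc k) S f \<Longrightarrow> Ck_on k S f"
proof (induction k arbitrary: f)
  case 0
  then show ?case using Ck_on_imp_continuous_on[of "Suc 0" S f] by simp
next
  case (Suc k)
  have D: "\<forall>x\<in>S. f differentiable at x"
    and C: "\<forall>v. Ck_on (Suc k) S (\<lambda>x. frechet_derivative f (at x) v)"
    using Suc.prems by (auto simp only: Ck_on.simps(2)[of "Suc k"])
  show ?case
    unfolding Ck_on.simps(2)[of k] using D Suc.IH[OF spec[OF C]] by blast
qed

lemma Ck_on_subset: "Ck_on k S f \<Longrightarrow> T \<subseteq> S \<Longrightarrow> Ck_on k T f"
  by (induction k arbitrary: f) (auto intro: continuous_on_subset)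

lemma Ck_on_const: "open S \<Longrightarrow> Ck_on k S (\<lambda>x. c)"
proof (induction k arbitrary: c)
  case (Suc k)
  show ?case by (rule Ck_on_SucI[where f' = "\<lambda>_ _. 0"]) (use Suc in auto)
qed simp

lemma Ck_on_bounded_linear:
  assumes "open S" "bounded_linear f"
  shows "Ck_on k S f"
proof (cases k)
  case 0
  then show ?thesis using assms by (simp add: linear_continuous_on)
next
  case (Suc n)
  show ?thesis unfolding Suc
    by (rule Ck_on_SucI[where f' = "\<lambda>_. f"])
      (use assms Ck_on_const in \<open>auto intro: bounded_linear_imp_has_derivative\<close>)
qed

lemma Ck_on_linear_compose:
  assumes "open S" "bounded_linear L" "Ck_on k S f"
  shows "Ck_on k S (\<lambda>x. L (f x))"
  using assms(3)
proof (induction k arbitrary: f)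
  case 0
  then show ?case by (simp add: bounded_linear.continuous_on[OF assms(2)])
next
  case (Suc k)
  show ?case
    by (rule Ck_on_SucI[OF assms(1)
          bounded_linear.has_derivative[OF assms(2) Ck_on_SucD[OF Suc.prems]]
          Suc.IH[OF Ck_on_SucD'[OF Suc.prems]]])
qed

lemma Ck_on_add:
  assumes "open S" "Ck_on k S f" "Ck_on k S g"
  shows "Ck_on k S (\<lambda>x. f x + g x)"
  using assms(2,3)
proof (induction k arbitrary: f g)
  case 0
  then show ?case by (simp add: continuous_on_add)
next
  case (Suc k)
  show ?case
    by (rule Ck_on_SucI[OF assms(1)
          has_derivative_add[OF Ck_on_SucD[OF Suc.prems(1)] Ck_on_SucD[OF Suc.prems(2)]]
          Suc.IH[OF Ck_on_SucD'[OF Suc.prems(1)] Ck_on_SucD'[OF Suc.prems(2)]]])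
qed

lemma Ck_on_sum:
  assumes "open S" "\<And>i. i \<in> I \<Longrightarrow> Ck_on k S (f i)"
  shows "Ck_on k S (\<lambda>x. \<Sum>i\<in>I. f i x)"
  using assms(2) by (induction I rule: infinite_finite_induct) (simp_all add: Ck_on_const Ck_on_add assms(1))

text \<open>By the Leibniz rule a directional derivative is a sum of two products of the same kind.
  In each, one factor is undifferentiated and is brought down to order \<open>k\<close> by
  \<open>Ck_on_Suc_imp\<close>.\<close>

lemma Ck_on_bilinear:
  assumes "open S" "bounded_bilinear p" "Ck_on k S f" "Ck_on k S g"
  shows "Ck_on k S (\<lambda>x. p (f x) (g x))"
  using assms(3,4)
proof (induction k arbitrary: f g)
  case 0
  then show ?case by (simp add: bounded_bilinear.continuous_on[OF assms(2)])
next
  case (Suc k)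
  have "Ck_on k S (\<lambda>x. p (f x) (frechet_derivative g (at x) v) + p (frechet_derivative f (at x) v) (g x))" for v
    by (intro Ck_on_add Suc.IH Ck_on_SucD'[OF Suc.prems(1)] Ck_on_SucD'[OF Suc.prems(2)]
        Ck_on_Suc_imp[OF Suc.prems(1)] Ck_on_Suc_imp[OF Suc.prems(2)] assms(1))
  note * = this
  show ?case
    by (rule Ck_on_SucI[OF assms(1) bounded_bilinear.FDERIV[OF assms(2)
          Ck_on_SucD[OF Suc.prems(1)] Ck_on_SucD[OF Suc.prems(2)]] *])
qed

text \<open>Expanding the inner derivative in the standard basis keeps the induction on \<open>k\<close> within
  scalar products of functions of class \<open>C\<^sup>k\<close>.\<close>

lemma Ck_on_compose:
  fixes f :: "'a::euclidean_space \<Rightarrow> 'b::euclidean_space" and g :: "'b \<Rightarrow> 'c::euclidean_space"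
  assumes "open S" "open T" "f ` S \<subseteq> T" "Ck_on k S f" "Ck_on k T g"
  shows "Ck_on k S (\<lambda>x. g (f x))"
  using assms(4,5)
proof (induction k arbitrary: g)
  case 0
  then show ?case using assms(3) continuous_on_compose2[of T g S f] by simp
next
  case (Suc k)
  let ?f' = "\<lambda>x. frechet_derivative f (at x)" and ?g' = "\<lambda>x. frechet_derivative g (at x)"
  have g': "linear (?g' (f x))" if "x \<in> S" for x
    using Ck_on_SucD[OF Suc.prems(2), of "f x"] that assms(3) has_derivative_linear by blast
  have D: "((\<lambda>x. g (f x)) has_derivative (\<lambda>v. \<Sum>b\<in>Basis. (?f' x v \<bullet> b) *\<^sub>R ?g' (f x) b)) (at x)"
    if "x \<in> S" for x
  proof -
    have "((\<lambda>x. g (f x)) has_derivative (\<lambda>v. ?g' (f x) (?f' x v))) (at x)"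
      using has_derivative_compose[OF Ck_on_SucD[OF Suc.prems(1) that]
        Ck_on_SucD[OF Suc.prems(2), of "f x"]] that assms(3) by blast
    moreover have "?g' (f x) (?f' x v) = (\<Sum>b\<in>Basis. (?f' x v \<bullet> b) *\<^sub>R ?g' (f x) b)" for v
      using arg_cong[OF euclidean_representation[of "?f' x v"], of "?g' (f x)"]
      by (simp only: linear_sum[OF g'[OF that]] linear_cmul[OF g'[OF that]])
    ultimately show ?thesis by (simp only:)
  qed
  have *: "Ck_on k S (\<lambda>x. \<Sum>b\<in>Basis. (?f' x v \<bullet> b) *\<^sub>R ?g' (f x) b)" for v
  proof (intro Ck_on_sum Ck_on_bilinear[OF _ bounded_bilinear_scaleR] assms(1))
    show "Ck_on k S (\<lambda>x. ?f' x v \<bullet> b)" for b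
      by (intro Ck_on_linear_compose[OF assms(1) bounded_linear_inner_left] Ck_on_SucD'[OF Suc.prems(1)])
    show "Ck_on k S (\<lambda>x. ?g' (f x) b)" for b
      by (rule Suc.IH[OF Ck_on_Suc_imp[OF Suc.prems(1)] Ck_on_SucD'[OF Suc.prems(2)]])
  qed
  show ?case by (rule Ck_on_SucI[OF assms(1) D *])
qed

text \<open>The real derivative in direction \<open>v\<close> is \<open>deriv f x * v\<close>, again
  holomorphic in \<open>x\<close>, so the induction stays within holomorphic functions.\<close>

lemma Ck_on_holomorphic:
  assumes "open S" "f holomorphic_on S"
  shows "Ck_on k S f"
  using assms(2)
proof (induction k arbitrary: f)
  case 0
  then show ?case by (simp add: holomorphic_on_imp_continuous_on)
next
  case (Suc k)
  show ?case
  proof (rule Ck_on_SucI[OF assms(1)])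
    show "(f has_derivative (\<lambda>h. deriv f x * h)) (at x)" if "x \<in> S" for x
      using holomorphic_derivI[OF Suc.prems assms(1) that] by (simp add: has_field_derivative_def)
    show "Ck_on k S (\<lambda>x. deriv f x * v)" for v
      by (intro Suc.IH holomorphic_intros holomorphic_deriv Suc.prems assms(1))
  qed
qed

lemma Ck_on_local:
  assumes "\<And>x. x \<in> S \<Longrightarrow> \<exists>V. open V \<and> x \<in> V \<and> Ck_on k V f"
  shows "Ck_on k S f"
  using assms
proof (induction k arbitrary: f)
  case 0
  then have "isCont f x" if "x \<in> S" for x
    using that continuous_on_eq_continuous_at by fastforce
  then show ?case by (simp add: continuous_at_imp_continuous_on)
next
  case (Suc k)
  then have "f differentiable at x" if "x \<in> S" for x using that by force
  moreover have "Ck_on k S (\<lambda>x. frechet_derivative f (at x) v)" for v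
  proof (rule Suc.IH)
    fix x assume "x \<in> S"
    then obtain V where "open V" "x \<in> V" "Ck_on (Suc k) V f" using Suc.prems by blast
    then show "\<exists>V. open V \<and> x \<in> V \<and> Ck_on k V (\<lambda>x. frechet_derivative f (at x) v)"
      by (intro exI[of _ V]) simp
  qed
  ultimately show ?case by simp
qed

section \<open>Smoothness on arbitrary subsets\<close>

lemma smooth_onI:
  assumes "\<And>x. x \<in> S \<Longrightarrow> \<exists>U. open U \<and> x \<in> U \<and> smooth_on U f"
  shows "smooth_on S f"
  unfolding smooth_on_def
proof
  fix x assume "x \<in> S"
  then obtain U where U: "open U" "x \<in> U" "smooth_on U f" using assms by blast
  then obtain V g where V: "open V" "x \<in> V" "\<forall>k. Ck_on k V g" "\<forall>y\<in>U \<inter> V. g y = f y"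
    unfolding smooth_on_def by blast
  then show "\<exists>U g. open U \<and> x \<in> U \<and> (\<forall>k. Ck_on k U g) \<and> (\<forall>y\<in>S \<inter> U. g y = f y)"
    using U Ck_on_subset[of _ V g "U \<inter> V"] by (intro exI[of _ "U \<inter> V"] exI[of _ g]) auto
qed

lemma smooth_on_openI: "open S \<Longrightarrow> (\<And>k. Ck_on k S f) \<Longrightarrow> smooth_on S f"
  unfolding smooth_on_def by blast

text \<open>Near a point of an open set the local extension coincides with \<open>f\<close>, so
  \<open>f\<close> itself inherits its order; \<open>Ck_on_local\<close> passes to the whole
  set.\<close>

lemma smooth_on_open_iff:
  assumes "open S"
  shows "smooth_on S f \<longleftrightarrow> (\<forall>k. Ck_on k S f)"
proof
  assume f: "smooth_on S f"
  show "\<forall>k. Ck_on k S f"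
  proof (intro allI Ck_on_local)
    fix k x assume "x \<in> S"
    then obtain U g where U: "open U" "x \<in> U" "\<forall>k. Ck_on k U g" "\<forall>y\<in>S \<inter> U. g y = f y"
      using f unfolding smooth_on_def by blast
    then have "Ck_on k (S \<inter> U) f"
      by (intro Ck_on_cong[of "S \<inter> U" g f] Ck_on_subset[of _ U g "S \<inter> U"]) (auto intro: assms)
    then show "\<exists>V. open V \<and> x \<in> V \<and> Ck_on k V f"
      using U assms \<open>x \<in> S\<close> by blast
  qed
qed (use assms smooth_on_openI in blast)

lemma smooth_on_subset:
  assumes "smooth_on S f" "T \<subseteq> S"
  shows "smooth_on T f"
  unfolding smooth_on_def
proof
  fix x assume "x \<in> T"
  then have "x \<in> S" using assms(2) by blast
  then obtain U g where U: "open U" "x \<in> U" "\<forall>k. Ck_on k U g" "\<forall>y\<in>S \<inter> U. g y = f y"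
    using assms(1)[unfolded smooth_on_def] by blast
  have "\<forall>y\<in>T \<inter> U. g y = f y" using U(4) assms(2) by blast
  with U(1-3) show "\<exists>U g. open U \<and> x \<in> U \<and> (\<forall>k. Ck_on k U g) \<and> (\<forall>y\<in>T \<inter> U. g y = f y)"
    by blast
qed

lemma smooth_on_cong:
  assumes "smooth_on S f" "\<And>x. x \<in> S \<Longrightarrow> f x = g x"
  shows "smooth_on S g"
  unfolding smooth_on_def
proof
  fix x assume "x \<in> S"
  then obtain U h where U: "open U" "x \<in> U" "\<forall>k. Ck_on k U h" "\<forall>y\<in>S \<inter> U. h y = f y"
    using assms(1) unfolding smooth_on_def by blast
  have "\<forall>y\<in>S \<inter> U. h y = g y"
  proof
    fix y assume "y \<in> S \<inter> U"
    then have y: "h y = f y" "y \<in> S" using U(4) by blast+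
    show "h y = g y" by (rule trans[OF y(1) assms(2)[OF y(2)]])
  qed
  with U(1-3) show "\<exists>U h. open U \<and> x \<in> U \<and> (\<forall>k. Ck_on k U h) \<and> (\<forall>y\<in>S \<inter> U. h y = g y)"
    by blast
qed

lemma smooth_on_imp_continuous_on:
  assumes "smooth_on S f"
  shows "continuous_on S f"
  unfolding continuous_on_eq_continuous_within
proof
  fix x assume "x \<in> S"
  then obtain U g where U: "open U" "x \<in> U" "\<forall>k. Ck_on k U g" "\<forall>y\<in>S \<inter> U. g y = f y"
    using assms unfolding smooth_on_def by blast
  then have "continuous (at x within S \<inter> U) g"
    using Ck_on_imp_continuous_on continuous_on_subset[of U g "S \<inter> U"]
      continuous_on_eq_continuous_within \<open>x \<in> S\<close> by blast
  then have "continuous (at x within S \<inter> U) f"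
    using U \<open>x \<in> S\<close> by (auto simp: continuous_within_topological)
  moreover have "at x within S \<inter> U = at x within S"
    using at_within_nhd[OF \<open>x \<in> U\<close> \<open>open U\<close>, of "S \<inter> U" S] by auto
  ultimately show "continuous (at x within S) f" by (simp add: continuous_within)
qed

lemma smooth_on_differentiable:
  assumes "smooth_on S f" "open S" "x \<in> S"
  shows "(f has_derivative frechet_derivative f (at x)) (at x)"
  using Ck_on_SucD[of 0 S f x] assms smooth_on_open_iff by blast

lemma smooth_on_compose:
  assumes f: "smooth_on S f" and g: "smooth_on T g" and "f ` S \<subseteq> T"
  shows "smooth_on S (\<lambda>x. g (f x))"
  unfolding smooth_on_def
proof
  fix x assume x: "x \<in> S"
  then have fx: "f x \<in> T" using \<open>f ` S \<subseteq> T\<close> by blast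
  obtain U f' where U: "open U" "x \<in> U" "\<forall>k. Ck_on k U f'" "\<forall>y\<in>S \<inter> U. f' y = f y"
    using bspec[OF f[unfolded smooth_on_def] x] by blast
  obtain V g' where V: "open V" "f x \<in> V" "\<forall>k. Ck_on k V g'" "\<forall>y\<in>T \<inter> V. g' y = g y"
    using bspec[OF g[unfolded smooth_on_def] fx] by blast
  let ?O = "U \<inter> f' -` V"
  \<comment> \<open>The composed extensions make sense on \<open>?O\<close>, the part of
    \<open>U\<close> that \<open>f'\<close> sends into \<open>V\<close>; continuity of
    \<open>f'\<close> makes it open.\<close>
  have "open ?O"
    by (rule continuous_open_preimage[OF Ck_on_imp_continuous_on[OF spec[OF U(3)]] U(1) V(1)])
  moreover have "\<forall>k. Ck_on k ?O (\<lambda>x. g' (f' x))"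
    by (intro allI Ck_on_compose[OF \<open>open ?O\<close> V(1) _ Ck_on_subset[OF spec[OF U(3)]] spec[OF V(3)]]) blast+
  moreover have "f' x = f x" using U x by blast
  then have "x \<in> ?O" using U V by simp
  moreover have "\<forall>y\<in>S \<inter> ?O. g' (f' y) = g (f y)"
  proof
    fix y assume y: "y \<in> S \<inter> ?O"
    then have e: "f' y = f y" using U(4) by blast
    then have "f y \<in> T \<inter> V" using y \<open>f ` S \<subseteq> T\<close> by auto
    then show "g' (f' y) = g (f y)" using V(4) e by simp
  qed
  ultimately show "\<exists>U g'. open U \<and> x \<in> U \<and> (\<forall>k. Ck_on k U g') \<and> (\<forall>y\<in>S \<inter> U. g' y = g (f y))"
    by (intro exI[of _ ?O] exI[of _ "\<lambda>x. g' (f' x)"]) (intro conjI)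
qed

lemma smooth_on_const: "smooth_on S (\<lambda>x. c)"
  by (rule smooth_on_subset[OF smooth_on_openI[OF open_UNIV Ck_on_const[OF open_UNIV]] subset_UNIV])

lemma smooth_on_bounded_linear: "bounded_linear f \<Longrightarrow> smooth_on S f"
  by (rule smooth_on_subset[OF smooth_on_openI[OF open_UNIV Ck_on_bounded_linear[OF open_UNIV]] subset_UNIV])

lemma smooth_on_linear_compose:
  assumes "bounded_linear L" "smooth_on S f"
  shows "smooth_on S (\<lambda>x. L (f x))"
  by (rule smooth_on_compose[OF assms(2) smooth_on_bounded_linear[OF assms(1), of UNIV]]) auto

lemma smooth_on_bilinear:
  assumes p: "bounded_bilinear p" and f: "smooth_on S f" and g: "smooth_on S g"
  shows "smooth_on S (\<lambda>x. p (f x) (g x))"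
  unfolding smooth_on_def
proof
  fix x assume x: "x \<in> S"
  obtain U f' where U: "open U" "x \<in> U" "\<forall>k. Ck_on k U f'" "\<forall>y\<in>S \<inter> U. f' y = f y"
    using f x unfolding smooth_on_def by blast
  obtain V g' where V: "open V" "x \<in> V" "\<forall>k. Ck_on k V g'" "\<forall>y\<in>S \<inter> V. g' y = g y"
    using g x unfolding smooth_on_def by blast
  have "\<forall>k. Ck_on k (U \<inter> V) (\<lambda>x. p (f' x) (g' x))"
    by (intro allI Ck_on_bilinear[OF open_Int[OF U(1) V(1)] p
          Ck_on_subset[OF spec[OF U(3)]] Ck_on_subset[OF spec[OF V(3)]]]) blast+
  moreover have "\<forall>y\<in>S \<inter> (U \<inter> V). p (f' y) (g' y) = p (f y) (g y)"
    using U(4) V(4) by simp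
  ultimately show "\<exists>U h. open U \<and> x \<in> U \<and> (\<forall>k. Ck_on k U h) \<and> (\<forall>y\<in>S \<inter> U. h y = p (f y) (g y))"
    using U(1,2) V(1,2)
    by (intro exI[of _ "U \<inter> V"] exI[of _ "\<lambda>x. p (f' x) (g' x)"] conjI open_Int IntI) assumption+
qed

lemma smooth_on_add:
  assumes "smooth_on S f" "smooth_on S g"
  shows "smooth_on S (\<lambda>x. f x + g x)"
  unfolding smooth_on_def
proof
  fix x assume x: "x \<in> S"
  obtain U f' where U: "open U" "x \<in> U" "\<forall>k. Ck_on k U f'" "\<forall>y\<in>S \<inter> U. f' y = f y"
    using assms(1) x unfolding smooth_on_def by blast
  obtain V g' where V: "open V" "x \<in> V" "\<forall>k. Ck_on k V g'" "\<forall>y\<in>S \<inter> V. g' y = g y"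
    using assms(2) x unfolding smooth_on_def by blast
  have "\<forall>k. Ck_on k (U \<inter> V) (\<lambda>x. f' x + g' x)"
    by (intro allI Ck_on_add[OF open_Int[OF U(1) V(1)]
          Ck_on_subset[OF spec[OF U(3)]] Ck_on_subset[OF spec[OF V(3)]]]) blast+
  moreover have "\<forall>y\<in>S \<inter> (U \<inter> V). f' y + g' y = f y + g y"
    using U(4) V(4) by simp
  ultimately show "\<exists>U h. open U \<and> x \<in> U \<and> (\<forall>k. Ck_on k U h) \<and> (\<forall>y\<in>S \<inter> U. h y = f y + g y)"
    using U(1,2) V(1,2)
    by (intro exI[of _ "U \<inter> V"] exI[of _ "\<lambda>x. f' x + g' x"] conjI open_Int IntI) assumption+
qed

lemma smooth_on_uminus: "smooth_on S f \<Longrightarrow> smooth_on S (\<lambda>x. - f x)"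
  by (intro smooth_on_linear_compose[OF bounded_linear_minus[OF bounded_linear_ident]])

lemma smooth_on_diff: "smooth_on S f \<Longrightarrow> smooth_on S g \<Longrightarrow> smooth_on S (\<lambda>x. f x - g x)"
  using smooth_on_add[OF _ smooth_on_uminus, of S f g] by simp

lemma smooth_on_mult:
  fixes f g :: "'a::euclidean_space \<Rightarrow> 'b::{euclidean_space, real_normed_algebra}"
  shows "smooth_on S f \<Longrightarrow> smooth_on S g \<Longrightarrow> smooth_on S (\<lambda>x. f x * g x)"
  by (rule smooth_on_bilinear[OF bounded_bilinear_mult])

lemma smooth_on_Pair:
  assumes "smooth_on S f" "smooth_on S g"
  shows "smooth_on S (\<lambda>x. (f x, g x))"
proof -
  have L: "bounded_linear (\<lambda>x. (x, 0))" and R: "bounded_linear (\<lambda>x. (0, x))"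
    by (rule bounded_linear_Pair bounded_linear_ident bounded_linear_zero)+
  have "smooth_on S (\<lambda>x. (f x, 0) + (0, g x))"
    by (intro smooth_on_add smooth_on_linear_compose[OF L] smooth_on_linear_compose[OF R] assms)
  then show ?thesis by simp
qed

lemma smooth_on_holomorphic_compose:
  assumes "g holomorphic_on T" "open T" "smooth_on S f" "f ` S \<subseteq> T"
  shows "smooth_on S (\<lambda>x. g (f x))"
  by (rule smooth_on_compose[OF assms(3)
        smooth_on_openI[OF assms(2) Ck_on_holomorphic[OF assms(2,1)]] assms(4)])

section \<open>Smooth maps into complex three-space and elementary functions\<close>

lemma vec3_eq_iff: "(v::'a::zero^3) = w \<longleftrightarrow> v $ 1 = w $ 1 \<and> v $ 2 = w $ 2 \<and> v $ 3 = w $ 3"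
  by (simp add: vec_eq_iff forall_3)

lemma vector_3_eq_axis:
  "vector [a, b, c] = axis 1 a + axis 2 b + (axis 3 c :: 'a::monoid_add ^ 3)"
  by (simp add: vec3_eq_iff axis_def)

lemma bounded_linear_axis: "bounded_linear (axis i :: 'a::euclidean_space \<Rightarrow> 'a ^ 'n)"
  by (rule linear_conv_bounded_linear[THEN iffD1], rule linearI) (auto simp: vec_eq_iff axis_def)

lemma smooth_on_vector_3:
  assumes "smooth_on S f" "smooth_on S g" "smooth_on S h"
  shows "smooth_on S (\<lambda>x. vector [f x, g x, h x] :: complex ^ 3)"
  unfolding vector_3_eq_axis
  by (intro smooth_on_add assms smooth_on_linear_compose[OF bounded_linear_axis])

lemma smooth_on_exp:
  fixes f :: "'a::euclidean_space \<Rightarrow> complex"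
  shows "smooth_on S f \<Longrightarrow> smooth_on S (\<lambda>x. exp (f x))"
  by (rule smooth_on_holomorphic_compose[of exp UNIV]) (auto intro!: holomorphic_intros)

lemma smooth_on_inverse:
  fixes f :: "'a::euclidean_space \<Rightarrow> complex"
  shows "smooth_on S f \<Longrightarrow> (\<And>x. x \<in> S \<Longrightarrow> f x \<noteq> 0) \<Longrightarrow> smooth_on S (\<lambda>x. inverse (f x))"
  by (rule smooth_on_holomorphic_compose[of inverse "- {0}"]) (auto intro!: holomorphic_intros)

lemma smooth_on_Ln:
  fixes f :: "'a::euclidean_space \<Rightarrow> complex"
  assumes "smooth_on S f" "\<And>x. x \<in> S \<Longrightarrow> f x \<notin> \<real>\<^sub>\<le>\<^sub>0"
  shows "smooth_on S (\<lambda>x. Ln (f x))"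
  by (rule smooth_on_holomorphic_compose[of Ln "- \<real>\<^sub>\<le>\<^sub>0"])
     (use assms in \<open>auto intro!: holomorphic_intros\<close>)

lemmas smooth_on_ident = smooth_on_bounded_linear[OF bounded_linear_ident]
lemmas smooth_on_Re = smooth_on_linear_compose[OF bounded_linear_Re]
lemmas smooth_on_Im = smooth_on_linear_compose[OF bounded_linear_Im]
lemmas smooth_on_cnj = smooth_on_linear_compose[OF bounded_linear_cnj]
lemmas smooth_on_of_real = smooth_on_linear_compose[OF bounded_linear_of_real]
lemmas smooth_on_fst = smooth_on_linear_compose[OF bounded_linear_fst]
lemmas smooth_on_snd = smooth_on_linear_compose[OF bounded_linear_snd]
lemmas smooth_on_vec_nth = smooth_on_linear_compose[OF bounded_linear_vec_nth]

text \<open>The modulus is \<open>csqrt (f x * cnj (f x))\<close>, and where \<open>f\<close> has no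
  zero the radicand is a positive real, in the domain of holomorphy of \<open>csqrt\<close>.\<close>

lemma smooth_on_cmod:
  fixes f :: "'a::euclidean_space \<Rightarrow> complex"
  assumes "smooth_on S f" "\<And>x. x \<in> S \<Longrightarrow> f x \<noteq> 0"
  shows "smooth_on S (\<lambda>x. cmod (f x))"
proof -
  have *: "csqrt (f x * cnj (f x)) = of_real (cmod (f x))" for x
    by (simp add: complex_norm_square[symmetric] flip: of_real_power)
  have "f x * cnj (f x) \<notin> \<real>\<^sub>\<le>\<^sub>0" if "x \<in> S" for x
    using assms(2)[OF that] by (simp add: complex_norm_square[symmetric] flip: of_real_power)
  then have "smooth_on S (\<lambda>x. Re (csqrt (f x * cnj (f x))))"
    by (intro smooth_on_Re smooth_on_holomorphic_compose[of csqrt "- \<real>\<^sub>\<le>\<^sub>0"]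
        smooth_on_mult smooth_on_cnj assms(1)) (auto intro!: holomorphic_intros)
  then show ?thesis unfolding * by simp
qed

named_theorems smooth_intros
lemmas [smooth_intros] = smooth_on_const smooth_on_ident smooth_on_Re smooth_on_Im smooth_on_cnj
  smooth_on_of_real smooth_on_fst smooth_on_snd smooth_on_vec_nth smooth_on_add smooth_on_diff
  smooth_on_uminus smooth_on_mult smooth_on_Pair smooth_on_exp smooth_on_inverse smooth_on_Ln
  smooth_on_cmod smooth_on_vector_3

section \<open>A bump function\<close>

text \<open>The whole family in \<open>n\<close> is introduced because the derivative of a member is
  a linear combination of two others; this closes the induction on the order of
  differentiability.\<close>

definition flat_exp :: "nat \<Rightarrow> real \<Rightarrow> real" where
  "flat_exp n t = (if t \<le> 0 then 0 else exp (- inverse t) * inverse t ^ n)"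

lemma power_le_fact_exp:
  fixes u :: real
  assumes "u \<ge> 0"
  shows "u ^ n \<le> fact n * exp u"
proof -
  have s: "(\<lambda>m. u ^ m /\<^sub>R fact m) sums exp u" by (rule exp_converges)
  have "u ^ n /\<^sub>R fact n \<le> exp u"
    using sum_le_suminf[OF sums_summable[OF s], of "{n}"] sums_unique[OF s] assms by simp
  then show ?thesis by (simp add: field_simps)
qed

text \<open>With \<open>u = inverse t\<close>, the exponential beats every power of
  \<open>u\<close>: decay at 0 is faster than any \<open>t ^ m\<close>.\<close>

lemma flat_exp_le:
  assumes "t > 0"
  shows "flat_exp n t \<le> fact (n + m) * t ^ m"
proof -
  have "inverse t ^ n * inverse t ^ m \<le> fact (n + m) * exp (inverse t)"
    using power_le_fact_exp[of "inverse t" "n + m"] assms by (simp add: power_add)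
  then have "exp (- inverse t) * (inverse t ^ n * inverse t ^ m) \<le> exp (- inverse t) * (fact (n + m) * exp (inverse t))"
    by (intro mult_left_mono) auto
  also have "\<dots> = fact (n + m)" by (simp add: exp_minus)
  finally have "exp (- inverse t) * inverse t ^ n * inverse t ^ m * t ^ m \<le> fact (n + m) * t ^ m"
    using assms by (intro mult_right_mono) (simp_all add: mult.assoc)
  moreover have "inverse t ^ m * t ^ m = 1" using assms by (simp flip: power_mult_distrib)
  ultimately show ?thesis using assms by (simp add: flat_exp_def mult.assoc)
qed

lemma flat_exp_nonneg: "flat_exp n t \<ge> 0"
  by (simp add: flat_exp_def)

lemma flat_exp_has_derivative:
  "(flat_exp n has_real_derivative flat_exp (n + 2) t - real n * flat_exp (n + 1) t) (at t)"
proof (cases t "0::real" rule: linorder_cases)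
  case less
  have "((\<lambda>_. 0) has_real_derivative 0) (at t)" by simp
  then have "(flat_exp n has_real_derivative 0) (at t)"
    by (rule has_field_derivative_transform_within_open[of _ _ _ "{..<0}"])
      (use less in \<open>auto simp: flat_exp_def\<close>)
  then show ?thesis using less by (simp add: flat_exp_def)
next
  case equal
  \<comment> \<open>Quadratic decay, from \<open>flat_exp_le\<close> with \<open>m = 2\<close>,
    leaves a factor \<open>h\<close> in the difference quotient.\<close>
  have "((\<lambda>h. (flat_exp n (0 + h) - flat_exp n 0) / h) \<longlongrightarrow> 0) (at 0)"
  proof (rule Lim_null_comparison)
    have "norm ((flat_exp n (0 + h) - flat_exp n 0) / h) \<le> fact (n + 2) * \<bar>h\<bar>" if "h \<noteq> 0" for h
    proof (cases "h > 0")
      case True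
      then show ?thesis
        using flat_exp_le[of h n 2] flat_exp_nonneg[of n h]
        by (simp add: flat_exp_def[of n 0] field_simps power2_eq_square)
    next
      case False
      then have "flat_exp n h = 0" by (simp add: flat_exp_def)
      then show ?thesis by (simp add: flat_exp_def)
    qed
    then show "\<forall>\<^sub>F h in at 0. norm ((flat_exp n (0 + h) - flat_exp n 0) / h) \<le> fact (n + 2) * \<bar>h\<bar>"
      by (auto simp: eventually_at_filter)
    show "((\<lambda>h. fact (n + 2) * \<bar>h\<bar>) \<longlongrightarrow> 0) (at (0::real))"
      by (auto intro!: tendsto_eq_intros)
  qed
  then show ?thesis using equal by (simp add: DERIV_def flat_exp_def)
next
  case greater
  have "((\<lambda>t. inverse t ^ n) has_real_derivative - (real n * inverse t ^ (n + 1))) (at t)"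
  proof (cases n)
    case (Suc m)
    show ?thesis unfolding Suc
      by (rule DERIV_cong[OF DERIV_power_Suc[OF DERIV_inverse]]) (use greater in \<open>auto simp: algebra_simps\<close>)
  qed simp
  moreover have "((\<lambda>t. exp (- inverse t)) has_real_derivative exp (- inverse t) * (inverse t * inverse t)) (at t)"
    using greater by (auto intro!: derivative_eq_intros)
  ultimately have "((\<lambda>t. exp (- inverse t) * inverse t ^ n) has_real_derivative
      flat_exp (n + 2) t - real n * flat_exp (n + 1) t) (at t)"
    using greater
    by (intro DERIV_cong[OF DERIV_mult]) (auto simp: flat_exp_def algebra_simps)
  then show ?thesis
    by (rule has_field_derivative_transform_within_open[of _ _ _ "{0<..}"])
      (use greater in \<open>auto simp: flat_exp_def\<close>)
qed

lemma Ck_on_flat_exp: "Ck_on k UNIV (flat_exp n)"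
proof (induction k arbitrary: n)
  case 0
  then show ?case
    using DERIV_isCont[OF flat_exp_has_derivative]
    by (simp add: continuous_at_imp_continuous_on)
next
  case (Suc k)
  show ?case
  proof (rule Ck_on_SucI)
    show "(flat_exp n has_derivative (\<lambda>v. (flat_exp (n + 2) t - real n * flat_exp (n + 1) t) * v)) (at t)" for t
      using flat_exp_has_derivative by (simp add: has_field_derivative_def)
    have "Ck_on k UNIV (\<lambda>t. v * flat_exp (n + 2) t + (- real n * v) * flat_exp (n + 1) t)" for v
      by (intro Ck_on_add Ck_on_linear_compose[OF _ bounded_linear_mult_right] Suc.IH open_UNIV)
    moreover have "v * flat_exp (n + 2) t + (- real n * v) * flat_exp (n + 1) t
        = (flat_exp (n + 2) t - real n * flat_exp (n + 1) t) * v" for v t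
      by (simp add: algebra_simps)
    ultimately show "Ck_on k UNIV (\<lambda>t. (flat_exp (n + 2) t - real n * flat_exp (n + 1) t) * v)" for v
      by (simp only:)
  qed simp
qed

text \<open>The factor \<open>exp (1 / 3)\<close> normalises the value at \<open>s = 1\<close> to 1.
  The argument will be a squared radius, so the support is the disc of radius 2.\<close>

definition bump :: "real \<Rightarrow> real" where
  "bump s = exp (1 / 3) * flat_exp 0 (4 - s)"

definition bump' :: "real \<Rightarrow> real" where
  "bump' s = - (exp (1 / 3) * flat_exp 2 (4 - s))"

lemma smooth_on_bump [smooth_intros]:
  assumes "smooth_on S f"
  shows "smooth_on S (\<lambda>x. bump (f x))"
proof -
  have "smooth_on UNIV (flat_exp 0)" by (intro smooth_on_openI Ck_on_flat_exp open_UNIV)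
  then have "smooth_on S (\<lambda>x. flat_exp 0 (4 - f x))"
    by (rule smooth_on_compose[rotated]) (auto intro!: smooth_intros assms)
  then show ?thesis
    unfolding bump_def by (intro smooth_intros)
qed

lemma bump_has_derivative: "(bump has_real_derivative bump' s) (at s)"
proof -
  have "((\<lambda>s. flat_exp 0 (4 - s)) has_real_derivative flat_exp 2 (4 - s) * (0 - 1)) (at s)"
    using flat_exp_has_derivative[of 0 "4 - s"]
    by (intro DERIV_chain2[of "flat_exp 0"] derivative_intros) (simp_all add: numeral_2_eq_2)
  then show ?thesis
    unfolding bump_def[abs_def] bump'_def by (auto intro!: derivative_eq_intros)
qed

lemma bump_eq_0: "s \<ge> 4 \<Longrightarrow> bump s = 0"
  by (simp add: bump_def flat_exp_def)

lemma bump'_eq_0: "s \<ge> 4 \<Longrightarrow> bump' s = 0"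
  by (simp add: bump'_def flat_exp_def)

lemma bump'_1: "bump' 1 \<noteq> 0"
  by (simp add: bump'_def flat_exp_def)

lemma bump_nonneg: "bump s \<ge> 0"
  by (simp add: bump_def flat_exp_nonneg)

lemma bump_eq_1_iff: "bump s = 1 \<longleftrightarrow> s = 1"
proof (cases "s \<ge> 4")
  case False
  have "bump s = 1 \<longleftrightarrow> exp (1 / 3 - inverse (4 - s)) = 1"
    using False by (simp add: bump_def flat_exp_def exp_diff exp_minus field_simps)
  also have "\<dots> \<longleftrightarrow> s = 1" using False by (auto simp: field_simps)
  finally show ?thesis .
qed (use bump_eq_0 in auto)

lemma exp_third_le: "exp (1 / 3 :: real) \<le> 2"
  using exp_bound_half[of "1/3::real"] by simp

lemma bump_le: "bump s \<le> 2"
proof -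
  have "flat_exp 0 (4 - s) \<le> 1" by (simp add: flat_exp_def)
  then show ?thesis unfolding bump_def
    using exp_third_le mult_mono[of "exp (1/3)" 2 "flat_exp 0 (4 - s)" 1] flat_exp_nonneg by simp
qed

text \<open>Mean value estimate. The constant is \<open>2 * 2\<close>: one factor bounds
  \<open>exp (1 / 3)\<close>, the other is the factorial of 2 from \<open>flat_exp_le\<close> with
  \<open>m = 0\<close>.\<close>

lemma bump_lipschitz: "\<bar>bump s - bump t\<bar> \<le> 4 * \<bar>s - t\<bar>"
proof -
  have "\<bar>bump' r\<bar> \<le> 4" for r
  proof -
    have "flat_exp 2 (4 - r) \<le> 2"
      using flat_exp_le[of "4 - r" 2 0] by (cases "4 - r > 0") (auto simp: flat_exp_def fact_2)
    then show ?thesis unfolding bump'_def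
      using exp_third_le mult_mono[of "exp (1/3)" 2 "flat_exp 2 (4 - r)" 2] flat_exp_nonneg[of 2 "4 - r"]
      by (simp add: abs_mult)
  qed
  then show ?thesis
    using field_differentiable_bound[of UNIV bump bump' 4 s t] bump_has_derivative by simp
qed

section \<open>Holomorphic functions with null-homotopic boundary values\<close>

text \<open>On the circle the winding number of \<open>f\<close> about \<open>0\<close> vanishes, because \<open>h\<close> contracts the
  image loop; by the argument principle it also counts the zeros of \<open>f\<close> in the disc.\<close>

lemma holomorphic_nonzero_if_boundary_extends:
  assumes f: "f holomorphic_on UNIV" and h: "continuous_on (cball 0 1) h"
    and h0: "\<And>z. z \<in> cball 0 1 \<Longrightarrow> h z \<noteq> (0::complex)"
    and eq: "\<And>z. z \<in> sphere 0 1 \<Longrightarrow> f z = h z"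
  shows "f 0 \<noteq> 0"
proof
  assume "f 0 = 0"
  have f1: "f z \<noteq> 0" if "cmod z = 1" for z using that eq[of z] h0[of z] by auto
  have nc: "\<not> f constant_on UNIV"
  proof
    assume "f constant_on UNIV"
    then have "f 1 = f 0" by (auto simp: constant_on_def)
    then show False using f1[of 1] \<open>f 0 = 0\<close> by simp
  qed
  \<comment> \<open>Radius 2 leaves room around the unit circle: the argument principle is applied
    in \<open>ball 0 2\<close>, whose zeros all lie in this finite set.\<close>
  define Z where "Z = {z \<in> cball 0 2. f z = 0}"
  have "finite Z" unfolding Z_def
    by (rule holomorphic_compact_finite_zeros[OF f]) (use nc in auto)
  let ?c = "circlepath 0 1"
  have img: "path_image ?c = sphere 0 1" by simp
  have Z1: "path_image ?c \<inter> Z = {}" using f1 by (auto simp: Z_def)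
  \<comment> \<open>The circle shrinks along radii to the centre inside the disc; \<open>h\<close>
    carries this homotopy into the punctured plane.\<close>
  have "homotopic_loops (cball 0 1) ?c (linepath 0 0)"
  proof (rule homotopic_loops_linear)
    fix t :: real assume t: "t \<in> {0..1}"
    have "cmod (?c t) = 1" by (simp add: circlepath norm_mult)
    then show "closed_segment (?c t) (linepath 0 0 t) \<subseteq> cball 0 1"
      by (intro closed_segment_subset) auto
  qed auto
  then have "homotopic_loops (- {0}) (h \<circ> ?c) (h \<circ> linepath 0 0)"
    by (rule homotopic_loops_continuous_image[OF _ h]) (use h0 in auto)
  then have "winding_number (h \<circ> ?c) 0 = winding_number (h \<circ> linepath 0 0) 0"
    by (rule winding_number_homotopic_loops)
  also have "h \<circ> linepath 0 0 = linepath (h 0) (h 0)" by (auto simp: linepath_def fun_eq_iff)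
  also have "winding_number (linepath (h 0) (h 0)) 0 = 0"
    using h0[of 0] by (intro winding_number_trivial) auto
  finally have "winding_number (h \<circ> ?c) 0 = 0" .
  moreover have "winding_number (f \<circ> ?c) 0 = winding_number (h \<circ> ?c) 0"
    by (rule winding_number_cong) (simp add: eq circlepath norm_mult)
  moreover have "winding_number (f \<circ> ?c) 0 =
      1 / (2 * pi * \<i>) * contour_integral (f \<circ> ?c) (\<lambda>w. 1 / (w - 0))"
  proof (rule winding_number_valid_path)
    show "valid_path (f \<circ> ?c)" by (rule valid_path_compose_holomorphic[OF _ f]) auto
    have "f w \<noteq> 0" if "w \<in> path_image ?c" for w using that f1 by simp
    then show "0 \<notin> path_image (f \<circ> ?c)" by (auto simp: path_image_compose simp del: path_image_circlepath)
  qed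
  \<comment> \<open>Substitution turns the integral for the winding number into that of the
    logarithmic derivative of \<open>f\<close>.\<close>
  moreover have "contour_integral (f \<circ> ?c) (\<lambda>w. 1 / (w - 0)) = contour_integral ?c (\<lambda>w. deriv f w * (1 / (f w - 0)))"
    by (rule contour_integral_comp_analyticW[of _ UNIV]) (use f in \<open>auto simp: analytic_on_open\<close>)
  ultimately have 0: "contour_integral ?c (\<lambda>w. deriv f w / f w) = 0" by simp
  \<comment> \<open>The empty set stands for the poles; this is the shape of the exceptional set in
    \<open>argument_principle\<close>.\<close>
  define Z' where "Z' = {w \<in> ball 0 2. f w = 0 \<or> w \<in> {}}"
  have fin: "finite Z'"
    by (rule finite_subset[OF _ \<open>finite Z\<close>]) (auto simp: Z_def Z'_def)
  have "contour_integral ?c (\<lambda>w. deriv f w * 1 / f w) =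
      2 * pi * \<i> * (\<Sum>p\<in>Z'. winding_number ?c p * 1 * zorder f p)"
    unfolding Z'_def
  proof (rule argument_principle)
    show "f holomorphic_on ball 0 2 - {}" by (rule holomorphic_on_subset[OF f]) auto
    show "path_image ?c \<subseteq> ball 0 2 - {w \<in> ball 0 2. f w = 0 \<or> w \<in> {}}"
      using f1 by (auto simp: img)
    show "\<forall>z. z \<notin> ball 0 2 \<longrightarrow> winding_number ?c z = 0"
      by (intro allI impI winding_number_zero_outside[of _ "cball 0 1"]) auto
    show "finite {w \<in> ball 0 2. f w = 0 \<or> w \<in> {}}" using fin by (simp add: Z'_def)
  qed auto
  \<comment> \<open>No zero lies on the circle, so each is counted with winding number 1 if inside
    and 0 if outside.\<close>
  also have "(\<Sum>p\<in>Z'. winding_number ?c p * 1 * zorder f p)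
      = (\<Sum>p\<in>Z'. of_int (if cmod p < 1 then zorder f p else 0))"
  proof (rule sum.cong)
    fix p assume "p \<in> Z'"
    then have "cmod p \<noteq> 1" using f1 by (auto simp: Z'_def)
    then consider "cmod p < 1" | "cmod p > 1" by linarith
    then show "winding_number ?c p * 1 * zorder f p = of_int (if cmod p < 1 then zorder f p else 0)"
    proof cases
      case 1
      then show ?thesis by (simp add: winding_number_circlepath)
    next
      case 2
      then have "winding_number ?c p = 0"
        by (intro winding_number_zero_outside[of _ "cball 0 1"]) auto
      then show ?thesis using 2 by simp
    qed
  qed simp
  finally have "(\<Sum>p\<in>Z'. if cmod p < 1 then zorder f p else 0) = 0"
    using 0 by (simp flip: of_int_sum)
  moreover have pos: "zorder f p > 0" if "f p = 0" for p
  proof -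
    have "\<exists>w\<in>UNIV. f w \<noteq> 0" using f1[of 1] by auto
    then show ?thesis
      using zorder_exist_zero[OF f, of p] that by auto
  qed
  \<comment> \<open>All summands are nonnegative and a zero at the centre contributes its positive
    order, so the sum cannot vanish.\<close>
  moreover have "(if cmod 0 < 1 then zorder f 0 else 0) \<le> (\<Sum>p\<in>Z'. if cmod p < 1 then zorder f p else 0)"
    by (rule member_le_sum) (use fin \<open>f 0 = 0\<close> pos in \<open>auto simp: Z'_def intro: less_imp_le\<close>)
  ultimately show False using pos[OF \<open>f 0 = 0\<close>] by simp
qed

section \<open>Submanifolds and diffeomorphisms\<close>

text \<open>The second conclusion makes the inverse explicit; it later computes the section of the
  retraction over the torus.\<close>

lemma diffeomorphismI:
  assumes "smooth_on S f" "smooth_on T g" "f ` S \<subseteq> T" "g ` T \<subseteq> S"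
    and gf: "\<And>x. x \<in> S \<Longrightarrow> g (f x) = x" and fg: "\<And>y. y \<in> T \<Longrightarrow> f (g y) = y"
  shows "diffeomorphism S T f" "\<And>y. y \<in> T \<Longrightarrow> the_inv_into S f y = g y"
proof -
  have bij: "bij_betw f S T"
    by (rule bij_betw_byWitness[of _ g]) (use assms(3,4) gf fg in blast)+
  show inv: "the_inv_into S f y = g y" if "y \<in> T" for y
    by (rule the_inv_into_f_eq[OF bij_betw_imp_inj_on[OF bij] fg[OF that]]) (use assms(4) that in blast)
  have "smooth_on T (the_inv_into S f)"
    by (rule smooth_on_cong[OF assms(2)]) (rule inv[symmetric])
  then show "diffeomorphism S T f"
    unfolding diffeomorphism_def using bij assms(1) by blast
qed

lemma diffeomorphism_inverse:
  assumes "diffeomorphism S T f"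
  shows "\<exists>g. smooth_on S f \<and> smooth_on T g \<and> f ` S = T \<and> g ` T = S \<and>
    (\<forall>x\<in>S. g (f x) = x) \<and> (\<forall>y\<in>T. f (g y) = y)"
proof (intro exI[of _ "the_inv_into S f"] conjI ballI)
  have bij: "bij_betw f S T" using assms by (simp add: diffeomorphism_def)
  show "smooth_on S f" "smooth_on T (the_inv_into S f)" using assms by (simp_all add: diffeomorphism_def)
  show "f ` S = T" using bij by (simp add: bij_betw_def)
  show "the_inv_into S f ` T = S" using bij_betw_the_inv_into[OF bij] by (simp add: bij_betw_def)
  show "the_inv_into S f (f x) = x" if "x \<in> S" for x
    using the_inv_into_f_f[OF bij_betw_imp_inj_on[OF bij] that] .
  show "f (the_inv_into S f y) = y" if "y \<in> T" for y
    using f_the_inv_into_f_bij_betw[OF bij] that by blast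
qed

text \<open>A slice chart of the image is obtained by first undoing \<open>f\<close> and then
  applying a slice chart of \<open>M\<close>.\<close>

lemma smooth_submanifold_diffeomorphic_image:
  fixes f :: "'a::euclidean_space \<Rightarrow> 'a"
  assumes M: "smooth_submanifold k M" "M \<subseteq> A" and AB: "open A" "open B" and f: "diffeomorphism A B f"
  shows "smooth_submanifold k (f ` M)"
  unfolding smooth_submanifold_def
proof
  fix q assume "q \<in> f ` M"
  then obtain p where p: "p \<in> M" "q = f p" by blast
  obtain g where g: "smooth_on A f" "smooth_on B g" "f ` A = B" "g ` B = A"
    "\<forall>x\<in>A. g (f x) = x" "\<forall>y\<in>B. f (g y) = y"
    using diffeomorphism_inverse[OF f] by (elim exE conjE) (rule that; assumption)
  show "\<exists>(U::'a set) (V::'a set) L \<phi>. open U \<and> q \<in> U \<and> open V \<and> diffeomorphism U V \<phi> \<and>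
        subspace L \<and> dim L = k \<and> \<phi> ` (U \<inter> f ` M) = V \<inter> L"
    using bspec[OF M(1)[unfolded smooth_submanifold_def] p(1)]
  proof (elim exE conjE)
    fix U V L :: "'a set" and \<phi> :: "'a \<Rightarrow> 'a"
    assume U: "open U" "p \<in> U" "open V" "diffeomorphism U V \<phi>" "subspace L" "dim L = k"
      and U\<phi>: "\<phi> ` (U \<inter> M) = V \<inter> L"
    obtain \<psi> where \<psi>: "smooth_on U \<phi>" "smooth_on V \<psi>" "\<phi> ` U = V" "\<psi> ` V = U"
      "\<forall>x\<in>U. \<psi> (\<phi> x) = x" "\<forall>y\<in>V. \<phi> (\<psi> y) = y"
      using diffeomorphism_inverse[OF U(4)] by (elim exE conjE) (rule that; assumption)
    \<comment> \<open>Both chart domains shrink so that the compositions are defined: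
      \<open>g\<close> must land in \<open>U\<close>, and \<open>\<psi>\<close> must land in
      \<open>A\<close>.\<close>
    define U' where "U' = B \<inter> g -` U"
    define V' where "V' = V \<inter> \<psi> -` A"
    show "\<exists>(U::'a set) (V::'a set) L \<phi>. open U \<and> q \<in> U \<and> open V \<and> diffeomorphism U V \<phi> \<and>
          subspace L \<and> dim L = k \<and> \<phi> ` (U \<inter> f ` M) = V \<inter> L"
    proof (intro exI conjI)
      show "open U'" unfolding U'_def
        by (rule continuous_open_preimage[OF smooth_on_imp_continuous_on[OF g(2)] AB(2) U(1)])
      show "open V'" unfolding V'_def
        by (rule continuous_open_preimage[OF smooth_on_imp_continuous_on[OF \<psi>(2)] U(3) AB(1)])
      have gfM: "g (f x) = x" "f x \<in> B" if "x \<in> M" for x using that M(2) g(3,5) by blast+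
      have gA: "g y \<in> A" if "y \<in> B" for y using that g(4) by blast
      have fB: "f x \<in> B" if "x \<in> A" for x using that g(3) by blast
      have \<phi>V: "\<phi> x \<in> V" if "x \<in> U" for x using that \<psi>(3) by blast
      have \<psi>U: "\<psi> y \<in> U" if "y \<in> V" for y using that \<psi>(4) by blast
      show "q \<in> U'" using gfM[OF p(1)] U(2) by (simp add: p(2) U'_def)
      show "diffeomorphism U' V' (\<lambda>x. \<phi> (g x))"
      proof (rule diffeomorphismI(1))
        show "smooth_on U' (\<lambda>x. \<phi> (g x))"
          by (rule smooth_on_compose[OF smooth_on_subset[OF g(2)] \<psi>(1)]) (auto simp: U'_def)
        show "smooth_on V' (\<lambda>y. f (\<psi> y))"
          by (rule smooth_on_compose[OF smooth_on_subset[OF \<psi>(2)] g(1)]) (auto simp: V'_def)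
        show "(\<lambda>x. \<phi> (g x)) ` U' \<subseteq> V'"
          by (rule image_subsetI) (simp add: U'_def V'_def \<phi>V gA \<psi>(5))
        show "(\<lambda>y. f (\<psi> y)) ` V' \<subseteq> U'"
          by (rule image_subsetI) (simp add: U'_def V'_def fB \<psi>U g(5))
        show "f (\<psi> (\<phi> (g x))) = x" if "x \<in> U'" for x
          using that by (simp add: U'_def g(6) \<psi>(5))
        show "\<phi> (g (f (\<psi> y))) = y" if "y \<in> V'" for y
          using that by (simp add: V'_def g(5) \<psi>(6))
      qed
      show "subspace L" "dim L = k" by fact+
      show "(\<lambda>x. \<phi> (g x)) ` (U' \<inter> f ` M) = V' \<inter> L"
      proof (intro equalityI subsetI)
        fix y assume "y \<in> (\<lambda>x. \<phi> (g x)) ` (U' \<inter> f ` M)"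
        then obtain x where x: "x \<in> M" "f x \<in> U'" "y = \<phi> (g (f x))" by blast
        then have "x \<in> U" "y = \<phi> x" using gfM by (simp_all add: U'_def)
        moreover have "\<phi> x \<in> V \<inter> L" using U\<phi> x(1) \<open>x \<in> U\<close> by blast
        ultimately show "y \<in> V' \<inter> L" using \<psi>(5) M(2) x(1) by (auto simp: V'_def)
      next
        fix y assume "y \<in> V' \<inter> L"
        then have "y \<in> \<phi> ` (U \<inter> M)" unfolding U\<phi> by (simp add: V'_def)
        then obtain x where x: "x \<in> U" "x \<in> M" "y = \<phi> x" by blast
        then have "f x \<in> U'" "y = \<phi> (g (f x))" using gfM by (simp_all add: U'_def)
        then show "y \<in> (\<lambda>x. \<phi> (g x)) ` (U' \<inter> f ` M)" using x(2) by blast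
      qed
    qed
  qed
qed

lemma has_vector_derivative_vector_3:
  fixes f g h :: "real \<Rightarrow> complex"
  assumes "(f has_vector_derivative a) F" "(g has_vector_derivative b) F" "(h has_vector_derivative c) F"
  shows "((\<lambda>x. vector [f x, g x, h x] :: complex ^ 3) has_vector_derivative vector [a, b, c]) F"
  unfolding vector_3_eq_axis
  by (intro has_vector_derivative_add bounded_linear.has_vector_derivative[OF bounded_linear_axis] assms)

lemma has_vector_derivative_vec_nth:
  "(\<gamma> has_vector_derivative v) F \<Longrightarrow> ((\<lambda>t. \<gamma> t $ i) has_vector_derivative v $ i) F"
  by (rule bounded_linear.has_vector_derivative[OF bounded_linear_vec_nth])

text \<open>Equations that hold along a curve near time 0 thereby pass to its velocity; the tangent
  vectors below are computed in this way.\<close>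

lemma has_vector_derivative_unique_open:
  assumes "(f has_vector_derivative a) (at 0)" "(g has_vector_derivative b) (at 0)"
    and "open S" "0 \<in> S" "\<And>t. t \<in> S \<Longrightarrow> f t = g t"
  shows "a = b"
  using vector_derivative_unique_at[OF assms(1)]
    has_vector_derivative_transform_within_open[OF assms(2) assms(3,4)] assms(5) by metis

lemma cmod_1_mult_cnj: "cmod z = 1 \<Longrightarrow> z * cnj z = 1" "cmod z = 1 \<Longrightarrow> cnj z * z = 1"
  by (simp_all add: complex_norm_square[symmetric] mult.commute[of "cnj z"])

text \<open>On the unit circle the inverse is the conjugate, so the torus is a graph over its first
  two coordinates.\<close>

lemma T_tilde_iff:
  "z \<in> T_tilde \<longleftrightarrow> cmod (z $ 1) = 1 \<and> cmod (z $ 2) = 1 \<and> z $ 3 = cnj (z $ 1 * z $ 2)"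
proof -
  have "z $ 1 * z $ 2 * z $ 3 = 1 \<longleftrightarrow> z $ 3 = cnj (z $ 1 * z $ 2)"
    if "cmod (z $ 1) = 1" "cmod (z $ 2) = 1"
  proof -
    have "cmod (z $ 1 * z $ 2) = 1" using that by (simp add: norm_mult)
    note * = cmod_1_mult_cnj[OF this]
    show ?thesis
    proof
      assume "z $ 1 * z $ 2 * z $ 3 = 1"
      then have "cnj (z $ 1 * z $ 2) * (z $ 1 * z $ 2 * z $ 3) = cnj (z $ 1 * z $ 2)" by simp
      then show "z $ 3 = cnj (z $ 1 * z $ 2)" using *(2) by (simp only: mult.assoc[symmetric]) simp
    qed (use * in simp)
  qed
  then show ?thesis unfolding T_tilde_def by auto
qed

section \<open>The torus and its tube\<close>

lemma sgn_unit: "cmod z = 1 \<Longrightarrow> sgn z = z"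
  by (simp add: sgn_eq)

lemma torus_diffeomorphic_T_tilde:
  "diffeomorphism (sphere (0::complex) 1 \<times> sphere (0::complex) 1) T_tilde
     (\<lambda>x. vector [fst x, snd x, cnj (fst x * snd x)])" (is "diffeomorphism ?S T_tilde ?h")
proof (rule diffeomorphismI(1))
  show "smooth_on ?S ?h" by (intro smooth_intros)
  show "smooth_on T_tilde (\<lambda>z. (z $ 1, z $ 2))" by (intro smooth_intros)
  show "?h ` ?S \<subseteq> T_tilde" by (rule image_subsetI) (auto simp: T_tilde_iff)
  show "(\<lambda>z. (z $ 1, z $ 2)) ` T_tilde \<subseteq> ?S" by (rule image_subsetI) (auto simp: T_tilde_iff)
  show "(?h x $ 1, ?h x $ 2) = x" for x :: "complex \<times> complex" by simp
  show "?h (z $ 1, z $ 2) = z" if "z \<in> T_tilde" for z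
    using that by (simp add: T_tilde_iff vec3_eq_iff)
qed

section \<open>Compactness and polynomial convexity of the torus\<close>

lemma compact_T_tilde: "compact T_tilde"
proof -
  let ?h = "\<lambda>x. vector [fst x, snd x, cnj (fst x * snd x)] :: complex ^ 3"
  have "compact (?h ` (sphere 0 1 \<times> sphere 0 1))"
    by (intro compact_continuous_image compact_Times compact_sphere smooth_on_imp_continuous_on smooth_intros)
  then show ?thesis using diffeomorphism_inverse[OF torus_diffeomorphic_T_tilde] by metis
qed

text \<open>Outside the closed unit polydisc a coordinate function separates. Inside it, coordinates
  with product 1 must have modulus 1, so off the torus the product minus 1 is nonzero, while it
  vanishes on the torus.\<close>

lemma polynomially_convex_T_tilde: "polynomially_convex T_tilde"
  unfolding polynomially_convex_def
proof (intro allI impI)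
  fix z :: "complex ^ 3" assume z: "z \<notin> T_tilde"
  have coord: "complex_polynomial (\<lambda>z::complex^3. z $ i)" for i
  proof -
    have "(\<Prod>j\<in>UNIV. z $ j ^ (if j = i then 1 else 0)) = z $ i" for z :: "complex ^ 3"
      using prod.delta[of UNIV i "\<lambda>j. z $ j"] by (simp add: if_distrib[of "\<lambda>n. _ ^ n"] cong: if_cong)
    then show ?thesis
      unfolding complex_polynomial_def
      by (intro exI[of _ "{\<lambda>j. if j = i then 1 else 0}"] exI[of _ "\<lambda>_. 1"]) simp
  qed
  have prod: "complex_polynomial (\<lambda>z::complex^3. z $ 1 * z $ 2 * z $ 3 - 1)"
  proof -
    \<comment> \<open>The exponents \<open>(1, 1, 1)\<close> and \<open>(0, 0, 0)\<close> must
      differ for the sum over this two-element index set to have both terms.\<close>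
    have ne: "(\<lambda>j::3. 1::nat) \<noteq> (\<lambda>j. 0)" by (simp add: fun_eq_iff)
    have "(\<Prod>j\<in>UNIV. z $ j ^ 1) = z $ 1 * z $ 2 * z $ 3" for z :: "complex ^ 3"
      unfolding UNIV_3 by (simp add: mult.assoc)
    with ne show ?thesis
      unfolding complex_polynomial_def
      by (intro exI[of _ "{\<lambda>j. 1, \<lambda>j. 0}"] exI[of _ "\<lambda>a. if a = (\<lambda>j. 0) then -1 else 1"]) simp
  qed
  have T: "cmod (w $ i) = 1" if "w \<in> T_tilde" for w i
    using that exhaust_3[of i] by (auto simp: T_tilde_iff norm_mult)
  show "\<exists>P. complex_polynomial P \<and> (\<forall>w\<in>T_tilde. cmod (P w) < cmod (P z))"
  proof (cases "\<exists>i. cmod (z $ i) > 1")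
    case True
    then obtain i where "cmod (z $ i) > 1" by blast
    then have "\<forall>w\<in>T_tilde. cmod (w $ i) < cmod (z $ i)" using T by simp
    then show ?thesis using coord[of i] by blast
  next
    case False
    then have le: "cmod (z $ i) \<le> 1" for i by (metis not_less)
    have "z $ 1 * z $ 2 * z $ 3 \<noteq> 1"
    proof
      assume 1: "z $ 1 * z $ 2 * z $ 3 = 1"
      then have m: "cmod (z $ 1) * cmod (z $ 2) * cmod (z $ 3) = 1" by (simp flip: norm_mult)
      \<comment> \<open>In the polydisc the remaining two moduli have product at most 1, so a total
        product 1 puts \<open>z $ 1\<close> and \<open>z $ 2\<close> on the unit circle.\<close>
      have "cmod (z $ 1) * (cmod (z $ 2) * cmod (z $ 3)) \<le> cmod (z $ 1) * 1"
        "cmod (z $ 2) * (cmod (z $ 1) * cmod (z $ 3)) \<le> cmod (z $ 2) * 1"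
        by (intro mult_left_mono mult_le_one le norm_ge_zero)+
      then have "cmod (z $ 1) \<ge> 1" "cmod (z $ 2) \<ge> 1" using m by (simp_all add: mult_ac)
      then show False using z 1 le[of 1] le[of 2] by (auto simp: T_tilde_def)
    qed
    then have "\<forall>w\<in>T_tilde. cmod (w $ 1 * w $ 2 * w $ 3 - 1) < cmod (z $ 1 * z $ 2 * z $ 3 - 1)"
      by (auto simp: T_tilde_def)
    then show ?thesis using prod by blast
  qed
qed

section \<open>Tangent vectors of the torus\<close>

lemma curve_in_circle_derivative:
  fixes \<gamma> :: "real \<Rightarrow> complex"
  assumes "(\<gamma> has_vector_derivative v) (at 0)" "e > 0" "\<And>t. t \<in> {-e<..<e} \<Longrightarrow> cmod (\<gamma> t) = 1"
  obtains s :: real where "v = \<i> * s * \<gamma> 0"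
proof -
  \<comment> \<open>Differentiating the constant \<open>\<gamma> t * cnj (\<gamma> t) = 1\<close>
    shows that \<open>v * cnj (\<gamma> 0)\<close> is purely imaginary.\<close>
  have "((\<lambda>t. \<gamma> t * cnj (\<gamma> t)) has_vector_derivative \<gamma> 0 * cnj v + v * cnj (\<gamma> 0)) (at 0)"
    by (intro has_vector_derivative_mult bounded_linear.has_vector_derivative[OF bounded_linear_cnj] assms(1))
  moreover have "((\<lambda>t::real. 1::complex) has_vector_derivative 0) (at 0)" by simp
  ultimately have 0: "\<gamma> 0 * cnj v + v * cnj (\<gamma> 0) = 0"
    by (rule has_vector_derivative_unique_open[of _ _ _ _ "{-e<..<e}"])
       (use assms cmod_1_mult_cnj in auto)
  define c where "c = v * cnj (\<gamma> 0)"
  have "c + cnj c = 0" using 0 by (simp add: c_def algebra_simps)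
  then have "Re c = 0" by (simp add: complex_eq_iff)
  then have "c = \<i> * of_real (Im c)" by (simp add: complex_eq_iff)
  moreover have "v = c * \<gamma> 0" using cmod_1_mult_cnj(2)[of "\<gamma> 0"] assms by (simp add: c_def mult.assoc)
  ultimately show thesis using that[of "Im c"] by simp
qed

lemma tangent_space_T_tilde:
  assumes "p \<in> T_tilde"
  shows "v \<in> tangent_space T_tilde p \<longleftrightarrow>
    (\<exists>(s::real) (t::real). v = vector [\<i> * s * p $ 1, \<i> * t * p $ 2, - (\<i> * complex_of_real (s + t) * p $ 3)])"
proof
  assume "v \<in> tangent_space T_tilde p"
  then obtain \<gamma> e where \<gamma>: "e > 0" "\<gamma> ` {-e<..<e} \<subseteq> T_tilde" "\<gamma> 0 = p" "(\<gamma> has_vector_derivative v) (at 0)"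
    unfolding tangent_space_def by blast
  note D = has_vector_derivative_vec_nth[OF \<gamma>(4)]
  have T: "cmod (\<gamma> t $ 1) = 1" "cmod (\<gamma> t $ 2) = 1" "\<gamma> t $ 3 = cnj (\<gamma> t $ 1 * \<gamma> t $ 2)"
    if "t \<in> {-e<..<e}" for t using that \<gamma>(2) T_tilde_iff by blast+
  obtain s where s: "v $ 1 = \<i> * of_real s * p $ 1"
    using curve_in_circle_derivative[OF D \<gamma>(1) T(1)] \<gamma>(3) by auto
  obtain t where t: "v $ 2 = \<i> * of_real t * p $ 2"
    using curve_in_circle_derivative[OF D \<gamma>(1) T(2)] \<gamma>(3) by auto
  have "((\<lambda>t. cnj (\<gamma> t $ 1 * \<gamma> t $ 2)) has_vector_derivative cnj (\<gamma> 0 $ 1 * v $ 2 + v $ 1 * \<gamma> 0 $ 2)) (at 0)"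
    by (intro bounded_linear.has_vector_derivative[OF bounded_linear_cnj] has_vector_derivative_mult D)
  then have "v $ 3 = cnj (\<gamma> 0 $ 1 * v $ 2 + v $ 1 * \<gamma> 0 $ 2)"
    by (rule has_vector_derivative_unique_open[OF D, of _ _ "{-e<..<e}"]) (use T \<gamma>(1) in auto)
  also have "\<dots> = - (\<i> * complex_of_real (s + t) * p $ 3)"
    using assms by (simp add: \<gamma>(3) s t T_tilde_iff algebra_simps)
  finally show "\<exists>(s::real) (t::real). v = vector [\<i> * s * p $ 1, \<i> * t * p $ 2, - (\<i> * complex_of_real (s + t) * p $ 3)]"
    using s t by (intro exI[of _ s] exI[of _ t]) (simp add: vec3_eq_iff)
next
  assume "\<exists>(s::real) (t::real). v = vector [\<i> * s * p $ 1, \<i> * t * p $ 2, - (\<i> * complex_of_real (s + t) * p $ 3)]"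
  then obtain s t :: real where v: "v = vector [\<i> * s * p $ 1, \<i> * t * p $ 2, - (\<i> * complex_of_real (s + t) * p $ 3)]"
    by blast
  \<comment> \<open>Rotating the coordinates of \<open>p\<close> at the angular speeds
    \<open>s\<close>, \<open>t\<close> and \<open>- (s + t)\<close> keeps their product equal to
    1.\<close>
  define \<gamma> :: "real \<Rightarrow> complex ^ 3" where
    "\<gamma> = (\<lambda>x. vector [exp (\<i> * s * x) * p $ 1, exp (\<i> * t * x) * p $ 2, exp (- (\<i> * (s + t) * x)) * p $ 3])"
  have d: "((\<lambda>x::real. exp (c * of_real x) * b) has_vector_derivative c * b) (at 0)" for c b :: complex
  proof (rule has_vector_derivative_real_field)
    show "((\<lambda>x. exp (c * x) * b) has_field_derivative c * b) (at (of_real 0))"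
      by (auto intro!: derivative_eq_intros)
  qed
  have "(\<gamma> has_vector_derivative v) (at 0)"
    unfolding \<gamma>_def v using d[of "\<i> * s" "p $ 1"] d[of "\<i> * t" "p $ 2"] d[of "- (\<i> * (s + t))" "p $ 3"]
    by (intro has_vector_derivative_vector_3) (simp_all add: mult.assoc)
  moreover have "\<gamma> x \<in> T_tilde" for x
    using assms by (simp add: \<gamma>_def T_tilde_iff norm_mult exp_cnj algebra_simps exp_diff exp_minus divide_inverse)
  moreover have "smooth_on {-1<..<1} \<gamma>" unfolding \<gamma>_def by (intro smooth_intros)
  moreover have "\<gamma> 0 = p" by (simp add: \<gamma>_def vec3_eq_iff)
  ultimately show "v \<in> tangent_space T_tilde p"
    unfolding tangent_space_def by (intro CollectI exI[of _ \<gamma>] exI[of _ 1]) auto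
qed

text \<open>A complex line contains some nonzero \<open>v\<close> together with
  \<open>\<i> *s v\<close>, so it suffices to exclude such pairs of tangent vectors.\<close>

lemma totally_realI:
  assumes "\<And>p v. p \<in> M \<Longrightarrow> v \<in> tangent_space M p \<Longrightarrow> \<i> *s v \<in> tangent_space M p \<Longrightarrow> v = 0"
  shows "totally_real M"
  unfolding totally_real_def
proof (intro ballI notI)
  fix p assume "p \<in> M" "\<exists>L. complex_line L \<and> L \<subseteq> tangent_space M p"
  then obtain L where L: "vec.subspace L" "vec.dim L = 1" "L \<subseteq> tangent_space M p"
    unfolding complex_line_def by blast
  have "v = 0" if "v \<in> L" for v
    using assms[OF \<open>p \<in> M\<close>, of v] that L(3) vec.subspace_scale[OF L(1) that, of \<i>] by blast
  then have "L = {0}" using vec.subspace_0[OF L(1)] by blast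
  then show False using L(2) vec.dim_span[of "{}"] by (simp add: vec.span_empty)
qed

section \<open>The tube and its radial retraction\<close>

definition axes_complement :: "(complex ^ 3) set" where
  "axes_complement = {z. z $ 1 \<noteq> 0 \<and> z $ 2 \<noteq> 0}"

text \<open>Its fibre over \<open>p\<close> consists of positive multiples of \<open>p $ 1\<close>
  and \<open>p $ 2\<close>, with an arbitrary third coordinate.\<close>

definition torus_retraction :: "complex ^ 3 \<Rightarrow> complex ^ 3" where
  "torus_retraction z = vector [sgn (z $ 1), sgn (z $ 2), cnj (sgn (z $ 1) * sgn (z $ 2))]"

lemma open_axes_complement: "open axes_complement"
  unfolding axes_complement_def
  by (intro open_Collect_conj open_Collect_neq continuous_intros)

lemma smooth_on_sgn [smooth_intros]:
  fixes f :: "'a::euclidean_space \<Rightarrow> complex"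
  assumes "smooth_on S f" "\<And>x. x \<in> S \<Longrightarrow> f x \<noteq> 0"
  shows "smooth_on S (\<lambda>x. sgn (f x))"
proof -
  have "smooth_on S (\<lambda>x. f x * inverse (of_real (cmod (f x))))"
    using assms by (intro smooth_intros) auto
  then show ?thesis by (simp add: sgn_eq divide_inverse)
qed

lemma smooth_on_torus_retraction: "smooth_on axes_complement torus_retraction"
  unfolding torus_retraction_def by (intro smooth_intros) (auto simp: axes_complement_def)

lemma T_tilde_subset: "T_tilde \<subseteq> axes_complement"
  by (auto simp: T_tilde_iff axes_complement_def)

lemma torus_retraction_in: "z \<in> axes_complement \<Longrightarrow> torus_retraction z \<in> T_tilde"
  by (simp add: T_tilde_iff torus_retraction_def axes_complement_def norm_sgn)

lemma torus_retraction_id: "z \<in> T_tilde \<Longrightarrow> torus_retraction z = z"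
  by (simp add: T_tilde_iff torus_retraction_def vec3_eq_iff sgn_eq)

lemma smooth_submersion_torus_retraction:
  "smooth_submersion axes_complement T_tilde torus_retraction"
  unfolding smooth_submersion_def
proof (intro conjI ballI)
  show "smooth_on axes_complement torus_retraction" by (rule smooth_on_torus_retraction)
  show "torus_retraction ` axes_complement = T_tilde"
    using torus_retraction_in torus_retraction_id T_tilde_subset by force
  fix x assume x: "x \<in> axes_complement"
  let ?d = "frechet_derivative torus_retraction (at x)"
  have D: "(torus_retraction has_derivative ?d) (at x)"
    by (rule smooth_on_differentiable[OF smooth_on_torus_retraction open_axes_complement x])
  have chain: "((\<lambda>t. torus_retraction (c t)) has_vector_derivative ?d w) (at 0)"
    if "(c has_vector_derivative w) (at 0)" "c 0 = x" for c :: "real \<Rightarrow> complex ^ 3" and w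
    using vector_derivative_diff_chain_within[of c w 0 UNIV torus_retraction ?d] that D
    by (simp add: o_def has_derivative_at_withinI)
  show "range ?d = tangent_space T_tilde (torus_retraction x)"
  proof safe
    fix w
    \<comment> \<open>Retracting a straight segment through \<open>x\<close> realises
      \<open>?d w\<close> as the velocity of a curve in the torus.\<close>
    let ?c = "\<lambda>t::real. x + t *\<^sub>R w"
    have "open (?c -` axes_complement)"
      by (intro open_vimage open_axes_complement continuous_intros)
    moreover have "0 \<in> ?c -` axes_complement" using x by simp
    ultimately obtain e where e: "e > 0" "ball 0 e \<subseteq> ?c -` axes_complement"
      by (meson open_contains_ball)
    then have c: "?c ` {-e<..<e} \<subseteq> axes_complement" by (auto simp: ball_eq_greaterThanLessThan)
    have "smooth_on {-e<..<e} (\<lambda>t. torus_retraction (?c t))"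
      by (rule smooth_on_compose[OF _ smooth_on_torus_retraction c])
        (intro smooth_intros smooth_on_bounded_linear bounded_linear_scaleR_left)
    moreover have "((\<lambda>t. torus_retraction (?c t)) has_vector_derivative ?d w) (at 0)"
      by (rule chain) (auto intro!: derivative_eq_intros)
    ultimately show "?d w \<in> tangent_space T_tilde (torus_retraction x)"
      unfolding tangent_space_def using e(1) c torus_retraction_in
      by (intro CollectI exI[of _ "\<lambda>t. torus_retraction (?c t)"] exI[of _ e]) auto
  next
    fix v assume "v \<in> tangent_space T_tilde (torus_retraction x)"
    then obtain \<gamma> e where \<gamma>: "e > 0" "\<gamma> ` {-e<..<e} \<subseteq> T_tilde" "\<gamma> 0 = torus_retraction x"
        "(\<gamma> has_vector_derivative v) (at 0)"
      unfolding tangent_space_def by blast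
    \<comment> \<open>A lift of \<open>\<gamma>\<close> through \<open>x\<close>: the moduli of the
      first two coordinates and the third coordinate stay those of \<open>x\<close>. The retraction
      takes the lift back to \<open>\<gamma>\<close>.\<close>
    let ?c = "\<lambda>t. vector [of_real (cmod (x $ 1)) * \<gamma> t $ 1, of_real (cmod (x $ 2)) * \<gamma> t $ 2, x $ 3] :: complex ^ 3"
    let ?w = "vector [of_real (cmod (x $ 1)) * v $ 1, of_real (cmod (x $ 2)) * v $ 2, 0] :: complex ^ 3"
    have "(?c has_vector_derivative ?w) (at 0)"
      by (intro has_vector_derivative_vector_3 has_vector_derivative_const
          bounded_linear.has_vector_derivative[OF bounded_linear_mult_right]
          has_vector_derivative_vec_nth \<gamma>(4))
    moreover have "?c 0 = x"
      using x by (simp add: \<gamma>(3) vec3_eq_iff torus_retraction_def sgn_eq axes_complement_def)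
    ultimately have "((\<lambda>t. torus_retraction (?c t)) has_vector_derivative ?d ?w) (at 0)"
      by (rule chain)
    moreover have "torus_retraction (?c t) = \<gamma> t" if "t \<in> {-e<..<e}" for t
    proof -
      have "\<gamma> t \<in> T_tilde" using that \<gamma>(2) by blast
      then show ?thesis using x
        by (simp add: torus_retraction_def vec3_eq_iff T_tilde_iff sgn_mult axes_complement_def sgn_unit sgn_of_real)
    qed
    moreover have "open {-e<..<e}" "0 \<in> {-e<..<e}" using \<gamma>(1) by auto
    ultimately have "?d ?w = v"
      using has_vector_derivative_unique_open[OF _ \<gamma>(4)] by blast
    then show "v \<in> range ?d" using rangeI[of ?d ?w] by simp
  qed
qed

section \<open>Normal bundle and tubular neighbourhood\<close>

lemma inner_complex_rotate: "v \<bullet> (\<i> * complex_of_real s * p) = s * Im (cnj p * v)"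
  by (simp add: inner_complex_def algebra_simps)

text \<open>Pairing \<open>v\<close> with the tangent vector of parameters \<open>s\<close>,
  \<open>t\<close> gives a linear form in them. Its coefficients are differences of the angular
  components \<open>Im (cnj (p $ i) * v $ i)\<close>, so normality means that all three components
  agree.\<close>

lemma normal_bundle_T_tilde:
  "(p, v) \<in> normal_bundle T_tilde \<longleftrightarrow> p \<in> T_tilde \<and>
    Im (cnj (p $ 1) * v $ 1) = Im (cnj (p $ 3) * v $ 3) \<and>
    Im (cnj (p $ 2) * v $ 2) = Im (cnj (p $ 3) * v $ 3)"
proof (cases "p \<in> T_tilde")
  case True
  define w where "w s t = (vector [\<i> * complex_of_real s * p $ 1, \<i> * complex_of_real t * p $ 2,
      - (\<i> * complex_of_real (s + t) * p $ 3)] :: complex ^ 3)" for s t :: real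
  have w: "v \<bullet> w s t = s * (Im (cnj (p $ 1) * v $ 1) - Im (cnj (p $ 3) * v $ 3)) +
      t * (Im (cnj (p $ 2) * v $ 2) - Im (cnj (p $ 3) * v $ 3))" for s t
    unfolding w_def inner_vec_def sum_3 vector_3 inner_minus_right inner_complex_rotate
    by (simp only: algebra_simps)
  have "(p, v) \<in> normal_bundle T_tilde \<longleftrightarrow> (\<forall>s t. v \<bullet> w s t = 0)"
    using True tangent_space_T_tilde[OF True] unfolding normal_bundle_def w_def by auto
  also have "\<dots> \<longleftrightarrow> Im (cnj (p $ 1) * v $ 1) = Im (cnj (p $ 3) * v $ 3) \<and>
      Im (cnj (p $ 2) * v $ 2) = Im (cnj (p $ 3) * v $ 3)" (is "_ \<longleftrightarrow> ?a \<and> ?b")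
  proof
    assume "\<forall>s t. v \<bullet> w s t = 0"
    then have "v \<bullet> w 1 0 = 0" "v \<bullet> w 0 1 = 0" by blast+
    then show "?a \<and> ?b" unfolding w by simp
  next
    assume ab: "?a \<and> ?b"
    then show "\<forall>s t. v \<bullet> w s t = 0" unfolding w by (simp only: ab) simp
  qed
  finally show ?thesis using True by simp
qed (simp add: normal_bundle_def)

text \<open>The radial bounds keep the scaling factors in \<open>tube_map\<close> positive, and they
  cut out half-spaces, hence convex fibres.\<close>

definition tube_domain :: "((complex ^ 3) \<times> (complex ^ 3)) set" where
  "tube_domain = normal_bundle T_tilde \<inter>
     {x. Re (cnj (fst x $ 1) * snd x $ 1) > - 1 \<and> Re (cnj (fst x $ 2) * snd x $ 2) > - 1}"

text \<open>In place of \<open>p + v\<close>, only the radial parts of the first two components are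
  used. With \<open>v $ 3\<close> they are coordinates on the normal space, because
  \<open>v $ 3\<close> already determines the common angular component. On
  \<open>tube_domain\<close> each normal space thus goes into a fibre of the retraction.\<close>

definition tube_map :: "(complex ^ 3) \<times> (complex ^ 3) \<Rightarrow> complex ^ 3" where
  "tube_map x = vector [fst x $ 1 * complex_of_real (1 + Re (cnj (fst x $ 1) * snd x $ 1)),
     fst x $ 2 * complex_of_real (1 + Re (cnj (fst x $ 2) * snd x $ 2)), fst x $ 3 + snd x $ 3]"

text \<open>The common angular component of the normal vector, recovered from the third
  coordinate.\<close>

definition tube_height :: "complex ^ 3 \<Rightarrow> real" where
  "tube_height z = Im (cnj (torus_retraction z $ 3) * (z $ 3 - torus_retraction z $ 3))"

definition tube_inverse :: "complex ^ 3 \<Rightarrow> (complex ^ 3) \<times> (complex ^ 3)" where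
  "tube_inverse z = (torus_retraction z,
     vector [torus_retraction z $ 1 * (complex_of_real (cmod (z $ 1) - 1) + \<i> * complex_of_real (tube_height z)),
       torus_retraction z $ 2 * (complex_of_real (cmod (z $ 2) - 1) + \<i> * complex_of_real (tube_height z)),
       z $ 3 - torus_retraction z $ 3])"

lemma smooth_on_tube_inverse: "smooth_on axes_complement tube_inverse"
  unfolding tube_inverse_def tube_height_def
  by (intro smooth_intros smooth_on_torus_retraction) (auto simp: axes_complement_def)

lemma tube_map_inverse:
  assumes "z \<in> axes_complement"
  shows "tube_inverse z \<in> tube_domain" "tube_map (tube_inverse z) = z"
proof -
  let ?p = "torus_retraction z"
  have T: "?p \<in> T_tilde" by (rule torus_retraction_in[OF assms])
  then have "cmod (?p $ 1) = 1" "cmod (?p $ 2) = 1" by (simp_all add: T_tilde_iff)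
  note u = cmod_1_mult_cnj(2)[OF this(1)] cmod_1_mult_cnj(2)[OF this(2)]
  have z: "?p $ 1 * complex_of_real (cmod (z $ 1)) = z $ 1" "?p $ 2 * complex_of_real (cmod (z $ 2)) = z $ 2"
    using assms by (simp_all add: torus_retraction_def sgn_eq axes_complement_def)
  have c: "cnj (?p $ 1) * (?p $ 1 * a) = a" "cnj (?p $ 2) * (?p $ 2 * a) = a" for a
    by (simp_all only: mult.assoc[symmetric] u) simp_all
  have pos: "cmod (z $ 1) > 0" "cmod (z $ 2) > 0"
    using assms by (simp_all add: axes_complement_def)
  show "tube_inverse z \<in> tube_domain"
    using T pos unfolding tube_domain_def tube_inverse_def Int_iff normal_bundle_T_tilde mem_Collect_eq
      fst_conv snd_conv vector_3 c by (simp add: tube_height_def)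
  show "tube_map (tube_inverse z) = z"
    unfolding tube_map_def tube_inverse_def by (simp add: c vec3_eq_iff z)
qed

lemma tube_inverse_map:
  assumes "x \<in> tube_domain"
  shows "tube_map x \<in> axes_complement" "tube_inverse (tube_map x) = x"
proof -
  obtain p v where x: "x = (p, v)" by (cases x)
  have T: "p \<in> T_tilde" and n: "Im (cnj (p $ 1) * v $ 1) = Im (cnj (p $ 3) * v $ 3)"
      "Im (cnj (p $ 2) * v $ 2) = Im (cnj (p $ 3) * v $ 3)"
    and pos: "1 + Re (cnj (p $ 1) * v $ 1) > 0" "1 + Re (cnj (p $ 2) * v $ 2) > 0"
    using assms unfolding x tube_domain_def Int_iff normal_bundle_T_tilde by auto
  define a where "a = 1 + Re (cnj (p $ 1) * v $ 1)"
  define b where "b = 1 + Re (cnj (p $ 2) * v $ 2)"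
  have ab: "a > 0" "b > 0" using pos by (simp_all add: a_def b_def)
  have p: "cmod (p $ 1) = 1" "cmod (p $ 2) = 1" "p $ 3 = cnj (p $ 1 * p $ 2)"
    using T by (simp_all add: T_tilde_iff)
  have m: "tube_map x = vector [p $ 1 * complex_of_real a, p $ 2 * complex_of_real b, p $ 3 + v $ 3]"
    unfolding x tube_map_def a_def b_def by simp
  have p0: "p $ 1 \<noteq> 0" "p $ 2 \<noteq> 0" using p by auto
  show "tube_map x \<in> axes_complement"
    unfolding m using p0 ab by (simp add: axes_complement_def)
  have r: "torus_retraction (tube_map x) = p"
    unfolding m torus_retraction_def using p ab by (simp add: vec3_eq_iff sgn_mult sgn_unit sgn_of_real)
  have h: "tube_height (tube_map x) = Im (cnj (p $ 3) * v $ 3)"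
    unfolding tube_height_def r by (simp add: m)
  have c: "p $ 1 * (cnj (p $ 1) * w) = w" "p $ 2 * (cnj (p $ 2) * w) = w" for w
    by (simp_all only: mult.assoc[symmetric] cmod_1_mult_cnj(1)[OF p(1)] cmod_1_mult_cnj(1)[OF p(2)]) simp_all
  have e: "complex_of_real (a - 1) + \<i> * complex_of_real (Im (cnj (p $ 3) * v $ 3)) = cnj (p $ 1) * v $ 1"
    unfolding n(1)[symmetric] a_def by (simp add: complex_eq_iff)
  have e': "complex_of_real (b - 1) + \<i> * complex_of_real (Im (cnj (p $ 3) * v $ 3)) = cnj (p $ 2) * v $ 2"
    unfolding n(2)[symmetric] b_def by (simp add: complex_eq_iff)
  have nm: "cmod (tube_map x $ 1) = a" "cmod (tube_map x $ 2) = b"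
    using p ab by (simp_all add: m norm_mult)
  show "tube_inverse (tube_map x) = x"
    unfolding tube_inverse_def r h nm e e' c unfolding m by (simp add: x vec3_eq_iff)
qed

lemma tubular_neighbourhood_T_tilde: "tubular_neighbourhood T_tilde axes_complement"
  unfolding tubular_neighbourhood_def
proof (intro conjI exI ballI)
  show "open axes_complement" by (rule open_axes_complement)
  have "continuous_on UNIV (\<lambda>x :: (complex ^ 3) \<times> (complex ^ 3). Re (cnj (fst x $ i) * snd x $ i))" for i
    by (intro smooth_on_imp_continuous_on smooth_intros)
  then have "open {x :: (complex ^ 3) \<times> (complex ^ 3). Re (cnj (fst x $ 1) * snd x $ 1) > - 1 \<and>
      Re (cnj (fst x $ 2) * snd x $ 2) > - 1}"
    by (intro open_Collect_conj open_Collect_less continuous_on_const)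
  then show "openin (top_of_set (normal_bundle T_tilde)) tube_domain"
    unfolding tube_domain_def by (rule openin_open_Int)
  show "diffeomorphism tube_domain axes_complement tube_map"
  proof (rule diffeomorphismI(1))
    show "smooth_on tube_domain tube_map" unfolding tube_map_def by (intro smooth_intros)
    show "smooth_on axes_complement tube_inverse" by (rule smooth_on_tube_inverse)
    show "tube_map ` tube_domain \<subseteq> axes_complement" by (rule image_subsetI) (rule tube_inverse_map)
    show "tube_inverse ` axes_complement \<subseteq> tube_domain" by (rule image_subsetI) (rule tube_map_inverse)
  qed (fact tube_inverse_map(2) tube_map_inverse(2))+
  fix p assume p: "p \<in> T_tilde"
  show "(p, 0) \<in> tube_domain" using p unfolding tube_domain_def Int_iff normal_bundle_T_tilde by simp
  show "tube_map (p, 0) = p" by (simp add: tube_map_def vec3_eq_iff)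
  have lin: "linear (\<lambda>v :: complex ^ 3. Re (cnj a * v $ i))" "linear (\<lambda>v :: complex ^ 3. Im (cnj a * v $ i))" for a i
    by (rule linearI; simp add: algebra_simps)+
  have "{v. (p, v) \<in> tube_domain} =
      (\<lambda>v. Im (cnj (p $ 1) * v $ 1) - Im (cnj (p $ 3) * v $ 3)) -` {0} \<inter>
      (\<lambda>v. Im (cnj (p $ 2) * v $ 2) - Im (cnj (p $ 3) * v $ 3)) -` {0} \<inter>
      (\<lambda>v. Re (cnj (p $ 1) * v $ 1)) -` {- 1<..} \<inter> (\<lambda>v. Re (cnj (p $ 2) * v $ 2)) -` {- 1<..}"
    using p unfolding tube_domain_def Int_iff normal_bundle_T_tilde by auto
  also have "convex \<dots>"
    by (intro convex_Int convex_linear_vimage linear_compose_sub lin convex_singleton convex_real_interval)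
  finally show "convex {v. (p, v) \<in> tube_domain}" .
qed

section \<open>Slice charts of the torus\<close>

definition chart_space :: "(complex ^ 3) set" where
  "chart_space = {w. Re (w $ 1) = 0 \<and> Re (w $ 2) = 0 \<and> w $ 3 = 0}"

lemma subspace_chart_space: "subspace chart_space"
  by (rule subspaceI) (simp_all add: chart_space_def)

lemma dim_chart_space: "dim chart_space = 2"
proof -
  let ?a = "axis 1 \<i> :: complex ^ 3" and ?b = "axis 2 \<i> :: complex ^ 3"
  have B: "{?a, ?b} \<subseteq> Basis" by (auto simp: Basis_vec_def Basis_complex_def)
  have ne: "?a \<noteq> ?b" by (simp add: axis_eq_axis)
  have "chart_space = span {?a, ?b}"
  proof
    show "chart_space \<subseteq> span {?a, ?b}"
    proof
      fix w assume "w \<in> chart_space"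
      then have "w = Im (w $ 1) *\<^sub>R ?a + Im (w $ 2) *\<^sub>R ?b"
        by (simp add: chart_space_def vec3_eq_iff axis_def complex_eq_iff)
      also have "\<dots> \<in> span {?a, ?b}"
        by (intro span_add span_scale span_base) simp_all
      finally show "w \<in> span {?a, ?b}" .
    qed
    show "span {?a, ?b} \<subseteq> chart_space"
      by (rule span_minimal[OF _ subspace_chart_space]) (simp add: chart_space_def axis_def)
  qed
  then have "dim chart_space = card {?a, ?b}"
    using dim_span_eq_card_independent[OF independent_mono[OF independent_Basis B]] by simp
  then show ?thesis using ne by simp
qed

lemma smooth_submanifold_T_tilde: "smooth_submanifold 2 T_tilde"
  unfolding smooth_submanifold_def
proof (intro ballI exI conjI)
  fix p assume p: "p \<in> T_tilde"
  then have p1: "cmod (p $ 1) = 1" "cmod (p $ 2) = 1" by (simp_all add: T_tilde_iff)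
  then have p0: "p $ 1 \<noteq> 0" "p $ 2 \<noteq> 0" by auto
  note pc = cmod_1_mult_cnj(1)[OF p1(1)] cmod_1_mult_cnj(1)[OF p1(2)]
    cmod_1_mult_cnj(2)[OF p1(1)] cmod_1_mult_cnj(2)[OF p1(2)]
  have c: "p $ 1 * (cnj (p $ 1) * w) = w" "p $ 2 * (cnj (p $ 2) * w) = w"
    "cnj (p $ 1) * (p $ 1 * w) = w" "cnj (p $ 2) * (p $ 2 * w) = w" for w
    by (simp_all only: mult.assoc[symmetric] pc) simp_all
  \<comment> \<open>Rotation by \<open>cnj (p $ i)\<close> puts \<open>p\<close> at argument 0, so
    the slit of \<open>Ln\<close> lies opposite to \<open>p\<close>.\<close>
  let ?U = "{z :: complex ^ 3. cnj (p $ 1) * z $ 1 \<notin> \<real>\<^sub>\<le>\<^sub>0 \<and> cnj (p $ 2) * z $ 2 \<notin> \<real>\<^sub>\<le>\<^sub>0}"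
  let ?V = "{w :: complex ^ 3. \<bar>Im (w $ 1)\<bar> < pi \<and> \<bar>Im (w $ 2)\<bar> < pi}"
  \<comment> \<open>The real parts of both logarithms and the third component vanish together
    exactly on the torus.\<close>
  let ?\<phi> = "\<lambda>z :: complex ^ 3. vector [Ln (cnj (p $ 1) * z $ 1), Ln (cnj (p $ 2) * z $ 2),
      z $ 3 - inverse (z $ 1 * z $ 2)] :: complex ^ 3"
  let ?\<psi> = "\<lambda>w :: complex ^ 3. vector [p $ 1 * exp (w $ 1), p $ 2 * exp (w $ 2),
      w $ 3 + inverse (p $ 1 * exp (w $ 1) * (p $ 2 * exp (w $ 2)))] :: complex ^ 3"
  have co: "continuous_on UNIV (\<lambda>z :: complex ^ 3. cnj a * z $ i)" for a i
    by (intro continuous_intros)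
  have "?U = (\<lambda>z. cnj (p $ 1) * z $ 1) -` (- \<real>\<^sub>\<le>\<^sub>0) \<inter> (\<lambda>z. cnj (p $ 2) * z $ 2) -` (- \<real>\<^sub>\<le>\<^sub>0)"
    by auto
  also have "open \<dots>"
    by (intro open_Int open_vimage co open_Compl closed_nonpos_Reals_complex)
  finally show "open ?U" .
  show "p \<in> ?U" by (simp add: pc)
  show "open ?V"
    by (intro open_Collect_conj open_Collect_less continuous_intros)
  have U0: "z $ 1 \<noteq> 0" "z $ 2 \<noteq> 0" if "z \<in> ?U" for z using that by auto
  have \<phi>V: "?\<phi> z \<in> ?V" if "z \<in> ?U" for z
  proof -
    have "\<bar>Im (Ln w)\<bar> < pi" if "w \<notin> \<real>\<^sub>\<le>\<^sub>0" for w
      using Im_Ln_less_pi[OF that] mpi_less_Im_Ln[of w] that by (cases "w = 0") auto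
    then show ?thesis using that by simp
  qed
  have \<psi>U: "?\<psi> w \<in> ?U" if "w \<in> ?V" for w
  proof -
    \<comment> \<open>A negative real value would have principal argument \<open>pi\<close>, but
      this argument is \<open>Im (w $ i)\<close>, which is smaller.\<close>
    have "exp (w $ i) \<notin> \<real>\<^sub>\<le>\<^sub>0" if "\<bar>Im (w $ i)\<bar> < pi" for i
    proof
      assume "exp (w $ i) \<in> \<real>\<^sub>\<le>\<^sub>0"
      then have "Im (Ln (exp (w $ i))) = pi"
        using exp_not_eq_zero[of "w $ i"]
        by (subst Im_Ln_eq_pi) (auto simp: complex_nonpos_Reals_iff less_le complex_eq_iff simp del: exp_not_eq_zero)
      then show False using that by (subst (asm) Ln_exp) auto
    qed
    then show ?thesis using that by (simp add: c)
  qed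
  have \<psi>\<phi>: "?\<psi> (?\<phi> z) = z" if "z \<in> ?U" for z
  proof -
    have "cnj (p $ 1) * z $ 1 \<noteq> 0" "cnj (p $ 2) * z $ 2 \<noteq> 0" using that by auto
    then show ?thesis by (simp add: vec3_eq_iff c)
  qed
  have \<phi>\<psi>: "?\<phi> (?\<psi> w) = w" if "w \<in> ?V" for w
    using that by (auto simp: vec3_eq_iff c abs_less_iff)
  show "diffeomorphism ?U ?V ?\<phi>"
  proof (rule diffeomorphismI(1))
    show "smooth_on ?U ?\<phi>" by (intro smooth_intros) auto
    show "smooth_on ?V ?\<psi>" by (intro smooth_intros) (use p0 in simp)
    show "?\<phi> ` ?U \<subseteq> ?V" by (rule image_subsetI) (rule \<phi>V)
    show "?\<psi> ` ?V \<subseteq> ?U" by (rule image_subsetI) (rule \<psi>U)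
    show "?\<psi> (?\<phi> z) = z" if "z \<in> ?U" for z by (rule \<psi>\<phi>[OF that])
    show "?\<phi> (?\<psi> w) = w" if "w \<in> ?V" for w by (rule \<phi>\<psi>[OF that])
  qed
  show "subspace chart_space" "dim chart_space = 2" by (rule subspace_chart_space dim_chart_space)+
  have iff: "?\<phi> z \<in> chart_space \<longleftrightarrow> z \<in> T_tilde" if "z \<in> ?U" for z
  proof -
    have "z $ 3 - inverse (z $ 1 * z $ 2) = 0 \<longleftrightarrow> z $ 1 * z $ 2 * z $ 3 = 1"
      using U0[OF that] by (simp add: field_simps)
    moreover have "Re (Ln (cnj (p $ i) * z $ i)) = 0 \<longleftrightarrow> cmod (z $ i) = 1"
      if "cnj (p $ i) * z $ i \<notin> \<real>\<^sub>\<le>\<^sub>0" "cmod (p $ i) = 1" for i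
    proof -
      have "cnj (p $ i) * z $ i \<noteq> 0" using that(1) by auto
      then show ?thesis using that(2) by (subst Re_Ln) (auto simp: norm_mult)
    qed
    ultimately show ?thesis using that p1 by (simp add: chart_space_def T_tilde_def)
  qed
  show "?\<phi> ` (?U \<inter> T_tilde) = ?V \<inter> chart_space"
  proof (intro equalityI subsetI)
    fix w assume "w \<in> ?\<phi> ` (?U \<inter> T_tilde)"
    then obtain z where z: "z \<in> ?U" "z \<in> T_tilde" and w: "w = ?\<phi> z" by blast
    show "w \<in> ?V \<inter> chart_space" unfolding w using \<phi>V[OF z(1)] iff[OF z(1)] z(2) by blast
  next
    fix w assume w: "w \<in> ?V \<inter> chart_space"
    then have V: "w \<in> ?V" by (rule IntD1)
    have "?\<psi> w \<in> T_tilde" using iff[OF \<psi>U[OF V]] w unfolding \<phi>\<psi>[OF V] by blast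
    then show "w \<in> ?\<phi> ` (?U \<inter> T_tilde)"
      using \<phi>\<psi>[OF V] \<psi>U[OF V] by (intro image_eqI[of _ _ "?\<psi> w"]) auto
  qed
qed

section \<open>The perturbed torus\<close>

lemma smooth_on_of_real_exp [smooth_intros]:
  fixes f :: "'a::euclidean_space \<Rightarrow> real"
  assumes "smooth_on S f"
  shows "smooth_on S (\<lambda>x. complex_of_real (exp (f x)))"
  unfolding exp_of_real[symmetric] by (intro smooth_intros assms)

text \<open>Principal arguments jump at the negative half-axis. This does no harm in
  \<open>warp\<close>, where they are multiplied by \<open>cutoff\<close>, which vanishes near the
  jump for small \<open>\<epsilon>\<close>.\<close>

definition arg1 :: "complex ^ 3 \<Rightarrow> real" where "arg1 z = Im (Ln (z $ 1))"
definition arg2 :: "complex ^ 3 \<Rightarrow> real" where "arg2 z = Im (Ln (z $ 2))"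

definition cutoff :: "real \<Rightarrow> complex ^ 3 \<Rightarrow> real" where
  "cutoff \<epsilon> z = bump (((arg1 z)\<^sup>2 + (arg2 z)\<^sup>2) / \<epsilon>\<^sup>2)"

text \<open>The exponents come from shifting the angles \<open>x\<close>, \<open>y\<close> by
  \<open>\<i> c y\<close> and \<open>- \<i> c x\<close>. The three real factors have product 1, so
  only the added \<open>\<epsilon> * cutoff \<epsilon> z\<close> moves points of the torus off the
  surface on which the coordinates have product 1.\<close>

definition warp :: "real \<Rightarrow> complex ^ 3 \<Rightarrow> complex ^ 3" where
  "warp \<epsilon> z = vector [z $ 1 * complex_of_real (exp (- (cutoff \<epsilon> z * arg2 z))),
     z $ 2 * complex_of_real (exp (cutoff \<epsilon> z * arg1 z)),
     z $ 3 * complex_of_real (exp (cutoff \<epsilon> z * arg2 z - cutoff \<epsilon> z * arg1 z)) + complex_of_real (\<epsilon> * cutoff \<epsilon> z)]"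

definition unwarp :: "real \<Rightarrow> complex ^ 3 \<Rightarrow> complex ^ 3" where
  "unwarp \<epsilon> z = vector [z $ 1 * complex_of_real (exp (cutoff \<epsilon> z * arg2 z)),
     z $ 2 * complex_of_real (exp (- (cutoff \<epsilon> z * arg1 z))),
     (z $ 3 - complex_of_real (\<epsilon> * cutoff \<epsilon> z)) * complex_of_real (exp (cutoff \<epsilon> z * arg1 z - cutoff \<epsilon> z * arg2 z))]"

definition slit_domain :: "(complex ^ 3) set" where
  "slit_domain = {z. z $ 1 \<notin> \<real>\<^sub>\<le>\<^sub>0 \<and> z $ 2 \<notin> \<real>\<^sub>\<le>\<^sub>0}"

definition far_domain :: "(complex ^ 3) set" where
  "far_domain = axes_complement \<inter> {z. Re (z $ 1) < 0 \<or> Re (z $ 2) < 0}"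

lemma open_slit_domain: "open slit_domain"
proof -
  have "slit_domain = (\<lambda>z. z $ 1) -` (- \<real>\<^sub>\<le>\<^sub>0) \<inter> (\<lambda>z. z $ 2) -` (- \<real>\<^sub>\<le>\<^sub>0)"
    by (auto simp: slit_domain_def)
  also have "open \<dots>"
    by (intro open_Int open_vimage open_Compl closed_nonpos_Reals_complex continuous_intros)
  finally show ?thesis .
qed

lemma open_far_domain: "open far_domain"
  unfolding far_domain_def
  by (intro open_Int open_axes_complement open_Collect_disj open_Collect_less continuous_intros)

lemma slit_or_far: "z \<in> axes_complement \<Longrightarrow> z \<in> slit_domain \<or> z \<in> far_domain"
  by (auto simp: axes_complement_def slit_domain_def far_domain_def complex_nonpos_Reals_iff complex_eq_iff)

lemma arg_gt_1:
  assumes "z \<noteq> 0" "Re z \<le> 0"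
  shows "\<bar>Im (Ln z)\<bar> > 1"
proof -
  show ?thesis using Re_Ln_pos_lt[OF assms(1)] assms(2) pi_gt3 by linarith
qed

lemma cutoff_radius_ge:
  assumes "0 < \<epsilon>" "2 * \<epsilon> \<le> \<bar>arg1 z\<bar> \<or> 2 * \<epsilon> \<le> \<bar>arg2 z\<bar>"
  shows "((arg1 z)\<^sup>2 + (arg2 z)\<^sup>2) / \<epsilon>\<^sup>2 \<ge> 4"
proof -
  have "(2 * \<epsilon>)\<^sup>2 \<le> (arg1 z)\<^sup>2 + (arg2 z)\<^sup>2"
    using assms(2)
  proof
    assume "2 * \<epsilon> \<le> \<bar>arg1 z\<bar>"
    then have "(2 * \<epsilon>)\<^sup>2 \<le> \<bar>arg1 z\<bar>\<^sup>2" using assms(1) by (intro power_mono) auto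
    then show ?thesis by (simp add: add_increasing2)
  next
    assume "2 * \<epsilon> \<le> \<bar>arg2 z\<bar>"
    then have "(2 * \<epsilon>)\<^sup>2 \<le> \<bar>arg2 z\<bar>\<^sup>2" using assms(1) by (intro power_mono) auto
    then show ?thesis by (simp add: add_increasing)
  qed
  then show ?thesis using assms(1) by (simp add: field_simps power_mult_distrib)
qed

text \<open>A negative real part forces an argument beyond 1, which exceeds
  \<open>2 * \<epsilon>\<close>; the rescaled point is then outside the support of
  \<open>bump\<close>.\<close>

lemma far_domain_radius:
  assumes "0 < \<epsilon>" "\<epsilon> \<le> 1 / 8" "z \<in> far_domain"
  shows "((arg1 z)\<^sup>2 + (arg2 z)\<^sup>2) / \<epsilon>\<^sup>2 \<ge> 4"
proof (rule cutoff_radius_ge[OF assms(1)])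
  have "\<bar>arg1 z\<bar> > 1 \<or> \<bar>arg2 z\<bar> > 1"
    using assms(3) arg_gt_1 by (auto simp: far_domain_def axes_complement_def arg1_def arg2_def)
  then show "2 * \<epsilon> \<le> \<bar>arg1 z\<bar> \<or> 2 * \<epsilon> \<le> \<bar>arg2 z\<bar>" using assms(2) by linarith
qed

text \<open>Two open sets cover the tube: on \<open>slit_domain\<close> the arguments are smooth, on
  \<open>far_domain\<close> the product is identically zero.\<close>

lemma smooth_on_cutoff_mult:
  fixes f :: "complex ^ 3 \<Rightarrow> real"
  assumes \<epsilon>: "0 < \<epsilon>" "\<epsilon> \<le> 1 / 8" and f: "smooth_on slit_domain f"
  shows "smooth_on axes_complement (\<lambda>z. cutoff \<epsilon> z * f z)"
proof (rule smooth_onI)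
  fix x assume "x \<in> axes_complement"
  then consider "x \<in> slit_domain" | "x \<in> far_domain" using slit_or_far by blast
  then show "\<exists>U. open U \<and> x \<in> U \<and> smooth_on U (\<lambda>z. cutoff \<epsilon> z * f z)"
  proof cases
    case 1
    have "smooth_on slit_domain (\<lambda>z. cutoff \<epsilon> z * f z)"
      unfolding cutoff_def arg1_def arg2_def divide_inverse power2_eq_square
      by (intro smooth_intros f) (auto simp: slit_domain_def)
    then show ?thesis using 1 open_slit_domain by blast
  next
    case 2
    have "smooth_on far_domain (\<lambda>z. cutoff \<epsilon> z * f z)"
      by (rule smooth_on_cong[OF smooth_on_const[of _ 0]])
         (simp add: cutoff_def bump_eq_0[OF far_domain_radius[OF \<epsilon>]])
    then show ?thesis using 2 open_far_domain by blast
  qed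
qed

lemma smooth_on_cutoff:
  assumes "0 < \<epsilon>" "\<epsilon> \<le> 1 / 8"
  shows "smooth_on axes_complement (cutoff \<epsilon>)"
    "smooth_on axes_complement (\<lambda>z. cutoff \<epsilon> z * arg1 z)"
    "smooth_on axes_complement (\<lambda>z. cutoff \<epsilon> z * arg2 z)"
proof -
  show "smooth_on axes_complement (cutoff \<epsilon>)"
    using smooth_on_cutoff_mult[OF assms smooth_on_const[of _ 1]] by simp
  show "smooth_on axes_complement (\<lambda>z. cutoff \<epsilon> z * arg1 z)" "smooth_on axes_complement (\<lambda>z. cutoff \<epsilon> z * arg2 z)"
    unfolding arg1_def arg2_def
    by (intro smooth_on_cutoff_mult assms smooth_intros; auto simp: slit_domain_def)+
qed

lemma Im_Ln_of_real_times: "r > 0 \<Longrightarrow> z \<noteq> 0 \<Longrightarrow> Im (Ln (z * complex_of_real r)) = Im (Ln z)"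
  using Ln_times_of_real[of r z] by (simp add: mult.commute)

lemma warp_args:
  assumes "z \<in> axes_complement"
  shows "arg1 (warp \<epsilon> z) = arg1 z" "arg2 (warp \<epsilon> z) = arg2 z" "cutoff \<epsilon> (warp \<epsilon> z) = cutoff \<epsilon> z"
    "arg1 (unwarp \<epsilon> z) = arg1 z" "arg2 (unwarp \<epsilon> z) = arg2 z" "cutoff \<epsilon> (unwarp \<epsilon> z) = cutoff \<epsilon> z"
proof -
  have z: "z $ 1 \<noteq> 0" "z $ 2 \<noteq> 0" using assms by (auto simp: axes_complement_def)
  show a: "arg1 (warp \<epsilon> z) = arg1 z" "arg1 (unwarp \<epsilon> z) = arg1 z"
    unfolding warp_def unwarp_def arg1_def vector_3 by (rule Im_Ln_of_real_times[OF exp_gt_zero z(1)])+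
  show b: "arg2 (warp \<epsilon> z) = arg2 z" "arg2 (unwarp \<epsilon> z) = arg2 z"
    unfolding warp_def unwarp_def arg2_def vector_3 by (rule Im_Ln_of_real_times[OF exp_gt_zero z(2)])+
  show "cutoff \<epsilon> (warp \<epsilon> z) = cutoff \<epsilon> z" "cutoff \<epsilon> (unwarp \<epsilon> z) = cutoff \<epsilon> z"
    unfolding cutoff_def by (simp_all only: a b)
qed

lemma warp_in: "z \<in> axes_complement \<Longrightarrow> warp \<epsilon> z \<in> axes_complement"
  and unwarp_in: "z \<in> axes_complement \<Longrightarrow> unwarp \<epsilon> z \<in> axes_complement"
  by (simp_all add: axes_complement_def warp_def unwarp_def)

lemma of_real_exp_cancel:
  "a + b = 0 \<Longrightarrow> z * complex_of_real (exp a) * complex_of_real (exp b) = z"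
  by (simp add: mult.assoc flip: of_real_mult exp_add)

text \<open>By \<open>warp_args\<close> both maps are governed by the same arguments and cutoff, so
  their exponents and translations cancel.\<close>

lemma unwarp_warp:
  assumes "z \<in> axes_complement"
  shows "unwarp \<epsilon> (warp \<epsilon> z) = z" "warp \<epsilon> (unwarp \<epsilon> z) = z"
  unfolding unwarp_def[of _ "warp \<epsilon> z"] warp_def[of _ "unwarp \<epsilon> z"] warp_args[OF assms]
  unfolding unwarp_def warp_def vector_3 vec3_eq_iff
  by (simp_all add: of_real_exp_cancel)

lemma diffeomorphism_warp:
  assumes "0 < \<epsilon>" "\<epsilon> \<le> 1 / 8"
  shows "diffeomorphism axes_complement axes_complement (warp \<epsilon>)"
proof (rule diffeomorphismI(1))
  note smooth = smooth_on_cutoff[OF assms]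
  show "smooth_on axes_complement (warp \<epsilon>)" "smooth_on axes_complement (unwarp \<epsilon>)"
    unfolding warp_def unwarp_def by (intro smooth_intros smooth)+
  show "warp \<epsilon> ` axes_complement \<subseteq> axes_complement" "unwarp \<epsilon> ` axes_complement \<subseteq> axes_complement"
    using warp_in unwarp_in by blast+
qed (fact unwarp_warp)+

lemma smooth_on_warp: "0 < \<epsilon> \<Longrightarrow> \<epsilon> \<le> 1 / 8 \<Longrightarrow> smooth_on axes_complement (warp \<epsilon>)"
  using diffeomorphism_warp by (simp add: diffeomorphism_def)

section \<open>The perturbed torus as a section of the retraction\<close>

definition warped_torus :: "real \<Rightarrow> (complex ^ 3) set" where
  "warped_torus \<epsilon> = warp \<epsilon> ` T_tilde"

lemma warped_torus_subset: "warped_torus \<epsilon> \<subseteq> axes_complement"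
  using T_tilde_subset warp_in by (auto simp: warped_torus_def)

lemma compact_warped_torus: "0 < \<epsilon> \<Longrightarrow> \<epsilon> \<le> 1 / 8 \<Longrightarrow> compact (warped_torus \<epsilon>)"
  unfolding warped_torus_def
  by (intro compact_continuous_image compact_T_tilde continuous_on_subset[OF _ T_tilde_subset]
      smooth_on_imp_continuous_on smooth_on_warp)

text \<open>Positive factors on the first two coordinates and any change of the third keep a point
  in its fibre.\<close>

lemma torus_retraction_warp:
  assumes "z \<in> T_tilde"
  shows "torus_retraction (warp \<epsilon> z) = z"
proof -
  have "torus_retraction (warp \<epsilon> z) = torus_retraction z"
    by (simp add: torus_retraction_def warp_def sgn_mult sgn_of_real)
  then show ?thesis using torus_retraction_id[OF assms] by simp
qed

lemma diffeomorphism_torus_retraction: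
  assumes "0 < \<epsilon>" "\<epsilon> \<le> 1 / 8"
  shows "diffeomorphism (warped_torus \<epsilon>) T_tilde torus_retraction"
    "\<And>p. p \<in> T_tilde \<Longrightarrow> the_inv_into (warped_torus \<epsilon>) torus_retraction p = warp \<epsilon> p"
proof -
  have 1: "smooth_on (warped_torus \<epsilon>) torus_retraction"
    by (rule smooth_on_subset[OF smooth_on_torus_retraction warped_torus_subset])
  have 2: "smooth_on T_tilde (warp \<epsilon>)"
    by (rule smooth_on_subset[OF smooth_on_warp[OF assms] T_tilde_subset])
  have 3: "torus_retraction ` warped_torus \<epsilon> \<subseteq> T_tilde"
    using torus_retraction_in warped_torus_subset by blast
  have 4: "warp \<epsilon> ` T_tilde \<subseteq> warped_torus \<epsilon>" by (simp add: warped_torus_def)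
  have 5: "warp \<epsilon> (torus_retraction x) = x" if "x \<in> warped_torus \<epsilon>" for x
    using that torus_retraction_warp by (auto simp: warped_torus_def)
  note D = diffeomorphismI[OF 1 2 3 4 5 torus_retraction_warp]
  show "diffeomorphism (warped_torus \<epsilon>) T_tilde torus_retraction" by (rule D(1))
  show "the_inv_into (warped_torus \<epsilon>) torus_retraction p = warp \<epsilon> p" if "p \<in> T_tilde" for p
    by (rule D(2)[OF _ _ that])
qed

text \<open>Invariance of arguments and cutoff under \<open>warp\<close> allows equations at
  \<open>z\<close> itself, without its preimage; they can be differentiated along curves.\<close>

lemma warped_torus_equations:
  assumes "z \<in> warped_torus \<epsilon>"
  shows "ln (cmod (z $ 1)) = - (cutoff \<epsilon> z * arg2 z)" "ln (cmod (z $ 2)) = cutoff \<epsilon> z * arg1 z"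
    "z $ 3 = inverse (z $ 1 * z $ 2) + complex_of_real (\<epsilon> * cutoff \<epsilon> z)"
proof -
  obtain p where p: "p \<in> T_tilde" and z: "z = warp \<epsilon> p" using assms by (auto simp: warped_torus_def)
  then have P: "p \<in> axes_complement" using T_tilde_subset by blast
  note e = warp_args(1-3)[OF P, of \<epsilon>, folded z]
  have p1: "cmod (p $ 1) = 1" "cmod (p $ 2) = 1" using p by (simp_all add: T_tilde_def)
  have p3: "p $ 3 = inverse (p $ 1 * p $ 2)"
    by (rule inverse_unique[symmetric]) (use p in \<open>simp add: T_tilde_def\<close>)
  show "ln (cmod (z $ 1)) = - (cutoff \<epsilon> z * arg2 z)" "ln (cmod (z $ 2)) = cutoff \<epsilon> z * arg1 z"
    unfolding e unfolding z warp_def by (simp_all add: norm_mult p1)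
  have "exp (cutoff \<epsilon> p * arg2 p - cutoff \<epsilon> p * arg1 p) =
      inverse (exp (- (cutoff \<epsilon> p * arg2 p)) * exp (cutoff \<epsilon> p * arg1 p))"
    by (simp add: exp_minus[symmetric] flip: exp_add)
  then show "z $ 3 = inverse (z $ 1 * z $ 2) + complex_of_real (\<epsilon> * cutoff \<epsilon> z)"
    unfolding e unfolding z warp_def by (simp add: p3 mult_ac)
qed

section \<open>Tangent vectors of the perturbed torus\<close>

lemma cutoff_curve_derivative:
  fixes \<gamma> :: "real \<Rightarrow> complex ^ 3"
  assumes \<epsilon>: "0 < \<epsilon>" "\<epsilon> \<le> 1 / 8" and \<gamma>: "(\<gamma> has_vector_derivative v) (at 0)" "\<gamma> 0 = q"
    and q: "q \<in> axes_complement"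
  defines "s \<equiv> Im (v $ 1 / q $ 1)" and "t \<equiv> Im (v $ 2 / q $ 2)"
  defines "c \<equiv> bump' (((arg1 q)\<^sup>2 + (arg2 q)\<^sup>2) / \<epsilon>\<^sup>2) * ((2 * arg1 q * s + 2 * arg2 q * t) / \<epsilon>\<^sup>2)"
  shows "((\<lambda>x. cutoff \<epsilon> (\<gamma> x)) has_real_derivative c) (at 0)"
    "((\<lambda>x. cutoff \<epsilon> (\<gamma> x) * arg1 (\<gamma> x)) has_real_derivative c * arg1 q + cutoff \<epsilon> q * s) (at 0)"
    "((\<lambda>x. cutoff \<epsilon> (\<gamma> x) * arg2 (\<gamma> x)) has_real_derivative c * arg2 q + cutoff \<epsilon> q * t) (at 0)"
proof -
  consider "q \<in> slit_domain" | "q \<in> far_domain" using slit_or_far[OF q] by blast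
  then have D: "((\<lambda>x. cutoff \<epsilon> (\<gamma> x)) has_real_derivative c) (at 0) \<and>
    ((\<lambda>x. cutoff \<epsilon> (\<gamma> x) * arg1 (\<gamma> x)) has_real_derivative c * arg1 q + cutoff \<epsilon> q * s) (at 0) \<and>
    ((\<lambda>x. cutoff \<epsilon> (\<gamma> x) * arg2 (\<gamma> x)) has_real_derivative c * arg2 q + cutoff \<epsilon> q * t) (at 0)"
  proof cases
    case 1
    have L: "((\<lambda>x. Im (Ln (\<gamma> x $ i))) has_real_derivative Im (v $ i / q $ i)) (at 0)"
      if "q $ i \<notin> \<real>\<^sub>\<le>\<^sub>0" for i
    proof -
      have "(Ln has_field_derivative inverse (q $ i)) (at (\<gamma> 0 $ i))"
        using has_field_derivative_Ln[of "q $ i"] that \<gamma>(2) by simp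
      from field_vector_diff_chain_at[OF has_vector_derivative_vec_nth[OF \<gamma>(1)] this]
      have "((\<lambda>x. Ln (\<gamma> x $ i)) has_vector_derivative v $ i / q $ i) (at 0)"
        by (simp add: o_def divide_inverse)
      then show ?thesis
        unfolding has_real_derivative_iff_has_vector_derivative
        by (rule bounded_linear.has_vector_derivative[OF bounded_linear_Im])
    qed
    have X: "((\<lambda>x. arg1 (\<gamma> x)) has_real_derivative s) (at 0)"
      unfolding arg1_def s_def by (rule L) (use 1 in \<open>simp add: slit_domain_def\<close>)
    have Y: "((\<lambda>x. arg2 (\<gamma> x)) has_real_derivative t) (at 0)"
      unfolding arg2_def t_def by (rule L) (use 1 in \<open>simp add: slit_domain_def\<close>)
    have "((\<lambda>x. ((arg1 (\<gamma> x))\<^sup>2 + (arg2 (\<gamma> x))\<^sup>2) / \<epsilon>\<^sup>2) has_real_derivative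
        (2 * arg1 q * s + 2 * arg2 q * t) / \<epsilon>\<^sup>2) (at 0)"
      by (rule DERIV_cong[OF DERIV_cdivide[OF DERIV_add[OF DERIV_power[OF X, of 2] DERIV_power[OF Y, of 2]]]])
        (simp add: \<gamma>(2) mult_ac)
    from DERIV_chain2[OF bump_has_derivative this]
    have C: "((\<lambda>x. cutoff \<epsilon> (\<gamma> x)) has_real_derivative c) (at 0)"
      unfolding cutoff_def c_def \<gamma>(2) .
    from C DERIV_mult[OF C X] DERIV_mult[OF C Y] show ?thesis
      by (simp add: \<gamma>(2) algebra_simps)
  next
    case 2
    have "isCont \<gamma> 0"
      using \<gamma>(1) has_vector_derivative_continuous by blast
    then have "(\<gamma> \<longlongrightarrow> q) (at 0)" by (simp only: isCont_def \<gamma>(2))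
    \<comment> \<open>For small times the curve stays where \<open>cutoff\<close> is 0. All three
      functions are then locally zero, and so are the claimed values, since \<open>bump\<close> and
      \<open>bump'\<close> vanish at the radius of \<open>q\<close>.\<close>
    then have "\<forall>\<^sub>F x in at 0. \<gamma> x \<in> far_domain"
      using open_far_domain 2 by (rule topological_tendstoD)
    then have "\<forall>\<^sub>F x in nhds 0. \<gamma> x \<in> far_domain"
      unfolding eventually_nhds_conv_at using 2 \<gamma>(2) by (simp only: simp_thms)
    then have ev: "\<forall>\<^sub>F x in nhds 0. cutoff \<epsilon> (\<gamma> x) = 0"
      by eventually_elim (simp add: cutoff_def bump_eq_0[OF far_domain_radius[OF \<epsilon>]])
    have D: "(f has_real_derivative 0) (at 0)" if "\<And>x. cutoff \<epsilon> (\<gamma> x) = 0 \<Longrightarrow> f x = 0" for f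
    proof -
      have "\<forall>\<^sub>F x in nhds 0. f x = 0" using ev by eventually_elim (rule that)
      then show ?thesis by (subst DERIV_cong_ev[OF refl _ refl, of _ "\<lambda>_. 0"]) auto
    qed
    have "c = 0" "cutoff \<epsilon> q = 0"
      unfolding c_def cutoff_def using bump_eq_0[OF far_domain_radius[OF \<epsilon> 2]] bump'_eq_0[OF far_domain_radius[OF \<epsilon> 2]]
      by simp_all
    then show ?thesis by (simp add: D)
  qed
  show "((\<lambda>x. cutoff \<epsilon> (\<gamma> x)) has_real_derivative c) (at 0)"
    by (rule conjunct1[OF D])
  show "((\<lambda>x. cutoff \<epsilon> (\<gamma> x) * arg1 (\<gamma> x)) has_real_derivative c * arg1 q + cutoff \<epsilon> q * s) (at 0)"
    by (rule conjunct1[OF conjunct2[OF D]])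
  show "((\<lambda>x. cutoff \<epsilon> (\<gamma> x) * arg2 (\<gamma> x)) has_real_derivative c * arg2 q + cutoff \<epsilon> q * t) (at 0)"
    by (rule conjunct2[OF conjunct2[OF D]])
qed

lemma ln_cmod_curve_derivative:
  fixes \<gamma> :: "real \<Rightarrow> complex"
  assumes "(\<gamma> has_vector_derivative v) (at 0)" "\<gamma> 0 \<noteq> 0"
  shows "((\<lambda>x. ln (cmod (\<gamma> x))) has_real_derivative Re (v / \<gamma> 0)) (at 0)"
proof -
  \<comment> \<open>Division by \<open>\<gamma> 0\<close> moves the base point to 1, inside the
    domain of the principal branch wherever \<open>\<gamma> 0\<close> lies.\<close>
  have "(Ln has_field_derivative 1) (at (\<gamma> 0 / \<gamma> 0))"
    using has_field_derivative_Ln[of 1] assms(2) by simp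
  moreover have "((\<lambda>x. \<gamma> x / \<gamma> 0) has_vector_derivative v / \<gamma> 0) (at 0)"
    unfolding divide_inverse
    by (rule bounded_linear.has_vector_derivative[OF bounded_linear_mult_left assms(1)])
  ultimately have "((\<lambda>x. Ln (\<gamma> x / \<gamma> 0)) has_vector_derivative v / \<gamma> 0) (at 0)"
    using field_vector_diff_chain_at[of "\<lambda>x. \<gamma> x / \<gamma> 0" "v / \<gamma> 0" 0 Ln 1] by (simp add: o_def)
  then have D: "((\<lambda>x. Re (Ln (\<gamma> x / \<gamma> 0))) has_real_derivative Re (v / \<gamma> 0)) (at 0)"
    unfolding has_real_derivative_iff_has_vector_derivative
    by (rule bounded_linear.has_vector_derivative[OF bounded_linear_Re])
  then have D: "((\<lambda>x. Re (Ln (\<gamma> x / \<gamma> 0)) + ln (cmod (\<gamma> 0))) has_real_derivative Re (v / \<gamma> 0)) (at 0)"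
    by (rule DERIV_cong[OF DERIV_add[OF _ DERIV_const]]) simp
  have "isCont \<gamma> 0" using assms(1) has_vector_derivative_continuous by blast
  then have "\<forall>\<^sub>F x in at 0. \<gamma> x \<noteq> 0"
    using assms(2) by (auto simp: isCont_def dest: tendsto_imp_eventually_ne)
  then have "\<forall>\<^sub>F x in nhds 0. \<gamma> x \<noteq> 0"
    using assms(2) by (simp add: eventually_nhds_conv_at)
  then have "\<forall>\<^sub>F x in nhds 0. ln (cmod (\<gamma> x)) = Re (Ln (\<gamma> x / \<gamma> 0)) + ln (cmod (\<gamma> 0))"
    by eventually_elim (use assms(2) in \<open>simp add: norm_divide ln_div\<close>)
  then show ?thesis
    using D by (subst DERIV_cong_ev[OF refl _ refl]) auto
qed

text \<open>The equations of \<open>warped_torus_equations\<close> are differentiated along a curve.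
  The quotients \<open>v $ i / q $ i\<close> are logarithmic derivatives, with real part the rate of
  \<open>ln (cmod _)\<close> and imaginary part that of the argument; \<open>c\<close> is the rate
  of the cutoff.\<close>

lemma tangent_space_warped_torus:
  assumes \<epsilon>: "0 < \<epsilon>" "\<epsilon> \<le> 1 / 8" and q: "q \<in> warped_torus \<epsilon>" and v: "v \<in> tangent_space (warped_torus \<epsilon>) q"
  defines "s \<equiv> Im (v $ 1 / q $ 1)" and "t \<equiv> Im (v $ 2 / q $ 2)"
  defines "c \<equiv> bump' (((arg1 q)\<^sup>2 + (arg2 q)\<^sup>2) / \<epsilon>\<^sup>2) * ((2 * arg1 q * s + 2 * arg2 q * t) / \<epsilon>\<^sup>2)"
  shows "Re (v $ 1 / q $ 1) = - (c * arg2 q + cutoff \<epsilon> q * t)"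
    "Re (v $ 2 / q $ 2) = c * arg1 q + cutoff \<epsilon> q * s"
    "v $ 3 + inverse (q $ 1 * q $ 2) * (v $ 1 / q $ 1 + v $ 2 / q $ 2) = complex_of_real (\<epsilon> * c)"
proof -
  obtain \<gamma> e where \<gamma>: "e > 0" "\<gamma> ` {-e<..<e} \<subseteq> warped_torus \<epsilon>" "\<gamma> 0 = q" "(\<gamma> has_vector_derivative v) (at 0)"
    using v unfolding tangent_space_def by blast
  have Q: "q \<in> axes_complement" using q warped_torus_subset by blast
  then have q0: "q $ 1 \<noteq> 0" "q $ 2 \<noteq> 0" by (auto simp: axes_complement_def)
  note D = cutoff_curve_derivative[OF \<epsilon> \<gamma>(4,3) Q, folded s_def t_def, folded c_def]
  note N = has_vector_derivative_vec_nth[OF \<gamma>(4)]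
  have S: "open {-e<..<e}" "0 \<in> {-e<..<e}" using \<gamma>(1) by auto
  have eqs: "ln (cmod (\<gamma> x $ 1)) = - (cutoff \<epsilon> (\<gamma> x) * arg2 (\<gamma> x))"
      "ln (cmod (\<gamma> x $ 2)) = cutoff \<epsilon> (\<gamma> x) * arg1 (\<gamma> x)"
      "\<gamma> x $ 3 = inverse (\<gamma> x $ 1 * \<gamma> x $ 2) + complex_of_real (\<epsilon> * cutoff \<epsilon> (\<gamma> x))"
    if "x \<in> {-e<..<e}" for x
    using that \<gamma>(2) warped_torus_equations by blast+
  have "((\<lambda>x. ln (cmod (\<gamma> x $ 1))) has_real_derivative Re (v $ 1 / q $ 1)) (at 0)"
    using ln_cmod_curve_derivative[OF N, of 1] q0 \<gamma>(3) by simp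
  from has_vector_derivative_unique_open[OF this[unfolded has_real_derivative_iff_has_vector_derivative]
      DERIV_minus[OF D(3), unfolded has_real_derivative_iff_has_vector_derivative] S eqs(1)]
  show "Re (v $ 1 / q $ 1) = - (c * arg2 q + cutoff \<epsilon> q * t)" .
  have "((\<lambda>x. ln (cmod (\<gamma> x $ 2))) has_real_derivative Re (v $ 2 / q $ 2)) (at 0)"
    using ln_cmod_curve_derivative[OF N, of 2] q0 \<gamma>(3) by simp
  from has_vector_derivative_unique_open[OF this[unfolded has_real_derivative_iff_has_vector_derivative]
      D(2)[unfolded has_real_derivative_iff_has_vector_derivative] S eqs(2)]
  show "Re (v $ 2 / q $ 2) = c * arg1 q + cutoff \<epsilon> q * s" .
  have "((\<lambda>x. \<gamma> x $ 1 * \<gamma> x $ 2) has_vector_derivative q $ 1 * v $ 2 + v $ 1 * q $ 2) (at 0)"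
    using has_vector_derivative_mult[OF N[of 1] N[of 2]] by (simp add: \<gamma>(3))
  moreover have "(inverse has_field_derivative - (inverse (q $ 1 * q $ 2) * inverse (q $ 1 * q $ 2))) (at (\<gamma> 0 $ 1 * \<gamma> 0 $ 2))"
    using DERIV_inverse[of "q $ 1 * q $ 2" UNIV] q0 by (simp add: \<gamma>(3))
  ultimately have I: "((\<lambda>x. inverse (\<gamma> x $ 1 * \<gamma> x $ 2)) has_vector_derivative
      (q $ 1 * v $ 2 + v $ 1 * q $ 2) * - (inverse (q $ 1 * q $ 2) * inverse (q $ 1 * q $ 2))) (at 0)"
    using field_vector_diff_chain_at by (fastforce simp: o_def)
  have "((\<lambda>x. \<epsilon> * cutoff \<epsilon> (\<gamma> x)) has_vector_derivative \<epsilon> * c) (at 0)"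
    using DERIV_cmult[OF D(1)] by (simp only: has_real_derivative_iff_has_vector_derivative)
  then have J: "((\<lambda>x. complex_of_real (\<epsilon> * cutoff \<epsilon> (\<gamma> x))) has_vector_derivative complex_of_real (\<epsilon> * c)) (at 0)"
    by (rule bounded_linear.has_vector_derivative[OF bounded_linear_of_real])
  have "v $ 3 = (q $ 1 * v $ 2 + v $ 1 * q $ 2) * - (inverse (q $ 1 * q $ 2) * inverse (q $ 1 * q $ 2)) +
      complex_of_real (\<epsilon> * c)"
    by (rule has_vector_derivative_unique_open[OF N has_vector_derivative_add[OF I J] S eqs(3)])
  moreover have "(q $ 1 * v $ 2 + v $ 1 * q $ 2) * (inverse (q $ 1 * q $ 2) * inverse (q $ 1 * q $ 2)) =
      inverse (q $ 1 * q $ 2) * (v $ 1 / q $ 1 + v $ 2 / q $ 2)"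
    using q0 by (simp add: field_simps)
  ultimately show "v $ 3 + inverse (q $ 1 * q $ 2) * (v $ 1 / q $ 1 + v $ 2 / q $ 2) = complex_of_real (\<epsilon> * c)"
    by (simp add: algebra_simps)
qed

lemma totally_real_warped_torus:
  assumes \<epsilon>: "0 < \<epsilon>" "\<epsilon> \<le> 1 / 8"
  shows "totally_real (warped_torus \<epsilon>)"
proof (rule totally_realI)
  fix q v assume q: "q \<in> warped_torus \<epsilon>" and v: "v \<in> tangent_space (warped_torus \<epsilon>) q"
    and iv: "\<i> *s v \<in> tangent_space (warped_torus \<epsilon>) q"
  have Q: "q \<in> axes_complement" using q warped_torus_subset by blast
  then have q0: "q $ 1 \<noteq> 0" "q $ 2 \<noteq> 0" by (auto simp: axes_complement_def)
  define l1 where "l1 = v $ 1 / q $ 1"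
  define l2 where "l2 = v $ 2 / q $ 2"
  define l3 where "l3 = v $ 3 + inverse (q $ 1 * q $ 2) * (l1 + l2)"
  define X where "X = arg1 q"
  define Y where "Y = arg2 q"
  define k where "k = cutoff \<epsilon> q"
  define b where "b = bump' ((X\<^sup>2 + Y\<^sup>2) / \<epsilon>\<^sup>2)"
  define c where "c = b * ((2 * X * Im l1 + 2 * Y * Im l2) / \<epsilon>\<^sup>2)"
  \<comment> \<open>The rate of the cutoff along \<open>\<i> *s v\<close>, whose angular velocities
    are \<open>Re l1\<close> and \<open>Re l2\<close>.\<close>
  define c' where "c' = b * ((2 * X * Re l1 + 2 * Y * Re l2) / \<epsilon>\<^sup>2)"
  have i: "(\<i> *s v) $ 1 / q $ 1 = \<i> * l1" "(\<i> *s v) $ 2 / q $ 2 = \<i> * l2" "(\<i> *s v) $ 3 = \<i> * v $ 3"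
    by (simp_all add: l1_def l2_def)
  have 1: "Re l1 = - (c * Y + k * Im l2)" "Re l2 = c * X + k * Im l1" "l3 = complex_of_real (\<epsilon> * c)"
    using tangent_space_warped_torus[OF \<epsilon> q v] unfolding l1_def[symmetric] l2_def[symmetric] l3_def[symmetric]
      X_def[symmetric] Y_def[symmetric] k_def[symmetric] b_def[symmetric] c_def[symmetric] by blast+
  have I: "Im (\<i> * l) = Re l" "Re (\<i> * l) = - Im l" for l by simp_all
  have 2: "- Im l1 = - (c' * Y + k * Re l2)" "- Im l2 = c' * X + k * Re l1"
    "\<i> * v $ 3 + inverse (q $ 1 * q $ 2) * (\<i> * l1 + \<i> * l2) = complex_of_real (\<epsilon> * c')"
    using tangent_space_warped_torus[OF \<epsilon> q iv] unfolding i I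
      X_def[symmetric] Y_def[symmetric] k_def[symmetric] b_def[symmetric] c'_def[symmetric] by blast+
  \<comment> \<open>As \<open>l3\<close> is complex linear in \<open>v\<close>, both
    \<open>l3\<close> and \<open>\<i> * l3\<close> are real; so the cutoff is stationary in both
    directions.\<close>
  have "\<i> * l3 = complex_of_real (\<epsilon> * c')"
    unfolding 2(3)[symmetric] l3_def by (simp add: algebra_simps)
  then have "\<epsilon> * c' = 0" "\<epsilon> * c = 0"
    unfolding 1(3) by (simp_all add: complex_eq_iff)
  then have c: "c = 0" "c' = 0" using \<epsilon> by auto
  have r: "Re l1 = - k * Im l2" "Re l2 = k * Im l1" using 1 c by simp_all
  have m: "Im l1 = k * Re l2" "Im l2 = - k * Re l1" using 2 c by simp_all
  have "Im l1 = 0 \<and> Im l2 = 0"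
  proof (cases "k = 1")
    case True
    then have R: "(X\<^sup>2 + Y\<^sup>2) / \<epsilon>\<^sup>2 = 1"
      unfolding k_def cutoff_def X_def Y_def bump_eq_1_iff .
    have "b \<noteq> 0" unfolding b_def R by (rule bump'_1)
    then have "2 * X * Im l1 + 2 * Y * Im l2 = 0" "2 * X * Re l1 + 2 * Y * Re l2 = 0"
      using c \<epsilon>(1) unfolding c_def c'_def by simp_all
    \<comment> \<open>For \<open>k = 1\<close> the relations \<open>r\<close> eliminate the real
      parts. The remaining system for \<open>Im l1\<close>, \<open>Im l2\<close> has determinant
      \<open>- (X\<^sup>2 + Y\<^sup>2)\<close>, nonzero on the circle of radius
      \<open>\<epsilon>\<close>.\<close>
    then have *: "X * Im l1 + Y * Im l2 = 0" "Y * Im l1 - X * Im l2 = 0"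
      unfolding r True by (simp_all add: algebra_simps)
    have XY: "X\<^sup>2 + Y\<^sup>2 \<noteq> 0" using R by (metis div_0 zero_neq_one)
    have "(X\<^sup>2 + Y\<^sup>2) * Im l1 = X * (X * Im l1 + Y * Im l2) + Y * (Y * Im l1 - X * Im l2)"
      "(X\<^sup>2 + Y\<^sup>2) * Im l2 = Y * (X * Im l1 + Y * Im l2) - X * (Y * Im l1 - X * Im l2)"
      by (simp_all add: algebra_simps power2_eq_square)
    then show ?thesis unfolding * using XY by auto
  next
    case False
    have "k \<ge> 0" by (simp add: k_def cutoff_def bump_nonneg)
    then have "k * k \<noteq> 1" using False by (metis abs_of_nonneg abs_one power2_eq_iff_nonneg power2_eq_square zero_le_one one_power2)
    \<comment> \<open>Inserting \<open>r\<close> into \<open>m\<close> multiplies each imaginary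
      part by \<open>k * k\<close>.\<close>
    moreover have "Im l1 * (1 - k * k) = 0" "Im l2 * (1 - k * k) = 0"
      using r m by (simp_all add: algebra_simps)
    ultimately show ?thesis by simp
  qed
  then have l: "l1 = 0" "l2 = 0" using r by (simp_all add: complex_eq_iff)
  then have "v $ 1 = 0" "v $ 2 = 0" using q0 by (simp_all add: l1_def l2_def)
  moreover have "v $ 3 = 0" using 1(3) c l by (simp add: l3_def)
  ultimately show "v = 0" by (simp add: vec3_eq_iff)
qed

lemma totally_real_T_tilde: "totally_real T_tilde"
proof (rule totally_realI)
  fix p v assume p: "p \<in> T_tilde" and v: "v \<in> tangent_space T_tilde p" "\<i> *s v \<in> tangent_space T_tilde p"
  have n: "p $ i \<noteq> 0" for i
    using p exhaust_3[of i] by (auto simp: T_tilde_iff)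
  obtain s t where st: "v = vector [\<i> * complex_of_real s * p $ 1, \<i> * complex_of_real t * p $ 2,
      - (\<i> * complex_of_real (s + t) * p $ 3)]"
    using v(1) tangent_space_T_tilde[OF p] by blast
  obtain s' t' where st': "\<i> *s v = vector [\<i> * complex_of_real s' * p $ 1, \<i> * complex_of_real t' * p $ 2,
      - (\<i> * complex_of_real (s' + t') * p $ 3)]"
    using v(2) tangent_space_T_tilde[OF p] by blast
  \<comment> \<open>After division by nonzero coordinates, the real numbers \<open>- s\<close> and
    \<open>- t\<close> equal purely imaginary ones.\<close>
  have "s = 0" "t = 0" using st' n unfolding st vec3_eq_iff by simp_all
  then show "v = 0" unfolding st by (simp add: vec3_eq_iff)
qed

section \<open>Failure of rational convexity\<close>

lemma complex_polynomial_continuous: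
  assumes "complex_polynomial P"
  shows "continuous_on S P"
proof -
  obtain A c where "P = (\<lambda>z. \<Sum>a\<in>A. c a * (\<Prod>i\<in>UNIV. (z $ i) ^ a i))"
    using assms unfolding complex_polynomial_def by blast
  then show ?thesis by (simp only:) (intro continuous_intros)
qed

lemma complex_polynomial_holomorphic:
  assumes "complex_polynomial P" "\<And>i. (\<lambda>x. d x $ i) holomorphic_on S"
  shows "(\<lambda>x. P (d x)) holomorphic_on S"
proof -
  obtain A c where "P = (\<lambda>z. \<Sum>a\<in>A. c a * (\<Prod>i\<in>UNIV. (z $ i) ^ a i))"
    using assms(1) unfolding complex_polynomial_def by blast
  then show ?thesis by (simp only:) (intro holomorphic_intros assms(2))
qed

lemma polynomially_convex_imp_rationally_convex:
  assumes "polynomially_convex K"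
  shows "rationally_convex K"
  unfolding rationally_convex_def
proof (intro allI impI)
  fix z assume "z \<notin> K"
  then obtain P where P: "complex_polynomial P" "\<forall>w\<in>K. cmod (P w) < cmod (P z)"
    using assms unfolding polynomially_convex_def by blast
  then have "P z \<notin> P ` K" by force
  with P(1) show "\<exists>P. complex_polynomial P \<and> P z \<notin> P ` K" by blast
qed

lemma Im_Ln_exp_ii: "\<bar>x\<bar> < pi \<Longrightarrow> Im (Ln (exp (\<i> * complex_of_real x))) = x"
  by (subst Ln_exp) (auto simp: abs_less_iff)

text \<open>The polynomial \<open>P - P (1, 1, 1 + \<epsilon>)\<close> would not vanish on the torus, in particular not on the
  image of a disc in the torus that has the same boundary as a holomorphic disc centred at
  \<open>(1, 1, 1 + \<epsilon>)\<close>.\<close>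

lemma not_rationally_convex_warped_torus:
  assumes \<epsilon>: "0 < \<epsilon>" "\<epsilon> \<le> 1 / 8"
  shows "\<not> rationally_convex (warped_torus \<epsilon>)"
proof
  assume conv: "rationally_convex (warped_torus \<epsilon>)"
  define e where "e = complex_of_real \<epsilon>"
  \<comment> \<open>The holomorphic disc with \<open>\<omega> = \<epsilon> \<zeta>\<close>,
    parametrised by the unit disc; its centre is \<open>(1, 1, 1 + \<epsilon>)\<close>.\<close>
  define d where "d \<zeta> = (vector [exp (\<i> * e * \<zeta>), exp (e * \<zeta>), exp (- (\<i> * e * \<zeta> + e * \<zeta>)) + e] :: complex ^ 3)" for \<zeta>
  \<comment> \<open>A disc in the unperturbed torus with arguments
    \<open>\<epsilon> * Re \<zeta>\<close> and \<open>\<epsilon> * Im \<zeta>\<close>; its image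
    under \<open>warp\<close> has the same boundary as \<open>d\<close>.\<close>
  define m where "m \<zeta> = (vector [exp (\<i> * complex_of_real (\<epsilon> * Re \<zeta>)), exp (\<i> * complex_of_real (\<epsilon> * Im \<zeta>)),
      exp (- (\<i> * complex_of_real (\<epsilon> * Re \<zeta>) + \<i> * complex_of_real (\<epsilon> * Im \<zeta>)))] :: complex ^ 3)" for \<zeta>
  have mT: "m \<zeta> \<in> T_tilde" for \<zeta>
    unfolding T_tilde_def m_def by (simp add: exp_add[symmetric])
  have args: "arg1 (m \<zeta>) = \<epsilon> * Re \<zeta>" "arg2 (m \<zeta>) = \<epsilon> * Im \<zeta>" if "\<zeta> \<in> cball 0 1" for \<zeta>
  proof -
    have le: "\<bar>\<epsilon> * a\<bar> < pi" if "\<bar>a\<bar> \<le> 1" for a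
    proof -
      have "\<bar>\<epsilon> * a\<bar> \<le> 1 / 8 * 1" unfolding abs_mult using \<epsilon> that by (intro mult_mono) auto
      then show ?thesis using pi_gt3 by linarith
    qed
    have r: "\<bar>Re \<zeta>\<bar> \<le> 1" "\<bar>Im \<zeta>\<bar> \<le> 1"
      using that abs_Re_le_cmod[of \<zeta>] abs_Im_le_cmod[of \<zeta>] by auto
    show "arg1 (m \<zeta>) = \<epsilon> * Re \<zeta>" "arg2 (m \<zeta>) = \<epsilon> * Im \<zeta>"
      unfolding arg1_def arg2_def m_def vector_3 by (rule Im_Ln_exp_ii[OF le[OF r(1)]] Im_Ln_exp_ii[OF le[OF r(2)]])+
  qed
  \<comment> \<open>On the unit circle the rescaled squared radius is 1, so the cutoff is 1 and the
    exponents combine to \<open>\<i> * e * \<zeta>\<close> and \<open>e * \<zeta>\<close>.\<close>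
  have boundary: "d \<zeta> = warp \<epsilon> (m \<zeta>)" if z: "\<zeta> \<in> sphere 0 1" for \<zeta>
  proof -
    have a: "arg1 (m \<zeta>) = \<epsilon> * Re \<zeta>" "arg2 (m \<zeta>) = \<epsilon> * Im \<zeta>" by (rule args; use z in simp)+
    have "(Re \<zeta>)\<^sup>2 + (Im \<zeta>)\<^sup>2 = 1" using z cmod_power2[of \<zeta>] by simp
    then have "(\<epsilon> * Re \<zeta>)\<^sup>2 + (\<epsilon> * Im \<zeta>)\<^sup>2 = \<epsilon>\<^sup>2"
      by (simp add: power_mult_distrib flip: distrib_left)
    then have c: "cutoff \<epsilon> (m \<zeta>) = 1" unfolding cutoff_def a bump_eq_1_iff using \<epsilon> by simp
    show ?thesis
      unfolding d_def warp_def a c unfolding m_def vector_3 vec3_eq_iff exp_of_real[symmetric] mult_1_left exp_add[symmetric] e_def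
      by (intro conjI arg_cong2[of _ _ _ _ "(+)"] arg_cong[of _ _ exp] refl)
        (simp_all add: complex_eq_iff algebra_simps)
  qed
  \<comment> \<open>The third equation would require cutoff 1 at \<open>d 0\<close>, but both
    arguments vanish there and \<open>bump\<close> takes the value 1 only at 1.\<close>
  have centre: "d 0 \<notin> warped_torus \<epsilon>"
  proof
    assume "d 0 \<in> warped_torus \<epsilon>"
    from warped_torus_equations(3)[OF this] have "e = complex_of_real (\<epsilon> * cutoff \<epsilon> (d 0))"
      by (simp add: d_def)
    then have "\<epsilon> = \<epsilon> * cutoff \<epsilon> (d 0)" unfolding e_def of_real_eq_iff .
    then have "cutoff \<epsilon> (d 0) = 1" using \<epsilon> by simp
    then have "((arg1 (d 0))\<^sup>2 + (arg2 (d 0))\<^sup>2) / \<epsilon>\<^sup>2 = 1" unfolding cutoff_def bump_eq_1_iff .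
    then show False by (simp add: arg1_def arg2_def d_def)
  qed
  obtain P where P: "complex_polynomial P" "P (d 0) \<notin> P ` warped_torus \<epsilon>"
    using conv centre unfolding rationally_convex_def by blast
  have comp: "(\<lambda>\<zeta>. d \<zeta> $ i) holomorphic_on UNIV" for i
  proof -
    have "(\<lambda>\<zeta>. d \<zeta> $ 1) holomorphic_on UNIV" "(\<lambda>\<zeta>. d \<zeta> $ 2) holomorphic_on UNIV" "(\<lambda>\<zeta>. d \<zeta> $ 3) holomorphic_on UNIV"
      unfolding d_def vector_3 by (intro holomorphic_intros)+
    then show ?thesis using exhaust_3[of i] by metis
  qed
  have "P (d 0) - P (d 0) \<noteq> 0"
  proof (rule holomorphic_nonzero_if_boundary_extends[where f = "\<lambda>\<zeta>. P (d \<zeta>) - P (d 0)"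
        and h = "\<lambda>\<zeta>. P (warp \<epsilon> (m \<zeta>)) - P (d 0)"])
    show "(\<lambda>\<zeta>. P (d \<zeta>) - P (d 0)) holomorphic_on UNIV"
      by (intro holomorphic_intros complex_polynomial_holomorphic[OF P(1)] comp)
    have "continuous_on (cball 0 1) m"
      unfolding m_def
      by (intro smooth_on_imp_continuous_on smooth_intros smooth_on_linear_compose[OF bounded_linear_mult_right])
    moreover have "continuous_on (m ` cball 0 1) (warp \<epsilon>)"
      using mT T_tilde_subset
      by (intro continuous_on_subset[OF smooth_on_imp_continuous_on[OF smooth_on_warp[OF \<epsilon>]]]) blast
    ultimately have "continuous_on (cball 0 1) (\<lambda>\<zeta>. warp \<epsilon> (m \<zeta>))"
      using continuous_on_compose2 by blast
    then show "continuous_on (cball 0 1) (\<lambda>\<zeta>. P (warp \<epsilon> (m \<zeta>)) - P (d 0))"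
      by (intro continuous_intros continuous_on_compose2[OF complex_polynomial_continuous[OF P(1), of UNIV]]) auto
    fix \<zeta> :: complex
    have "warp \<epsilon> (m \<zeta>) \<in> warped_torus \<epsilon>" using mT by (simp add: warped_torus_def)
    then show "P (warp \<epsilon> (m \<zeta>)) - P (d 0) \<noteq> 0" using P(2) by (metis eq_iff_diff_eq_0 image_eqI)
    assume "\<zeta> \<in> sphere 0 1"
    then show "P (d \<zeta>) - P (d 0) = P (warp \<epsilon> (m \<zeta>)) - P (d 0)" using boundary by simp
  qed
  then show False by simp
qed

section \<open>Convergence in Hoelder norm\<close>

text \<open>Truncating the modulus at 2 changes nothing, as \<open>bump\<close> vanishes from 4 on.
  On moduli up to 2 squaring has Lipschitz constant 4, hence \<open>4 * 4\<close>.\<close>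

lemma bump_radial_lipschitz:
  fixes u w :: complex
  shows "\<bar>bump ((cmod u)\<^sup>2) - bump ((cmod w)\<^sup>2)\<bar> \<le> 16 * cmod (u - w)"
proof -
  define m where "m u = min (cmod u) 2" for u
  have m: "bump ((cmod u)\<^sup>2) = bump ((m u)\<^sup>2)" for u
  proof (cases "cmod u \<ge> 2")
    case True
    then have "(cmod u)\<^sup>2 \<ge> 2\<^sup>2" by (intro power_mono) auto
    then show ?thesis using True by (simp add: m_def bump_eq_0)
  qed (simp add: m_def)
  have "\<bar>bump ((m u)\<^sup>2) - bump ((m w)\<^sup>2)\<bar> \<le> 4 * \<bar>(m u)\<^sup>2 - (m w)\<^sup>2\<bar>" by (rule bump_lipschitz)
  also have "\<dots> = 4 * ((m u + m w) * \<bar>m u - m w\<bar>)"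
    by (simp add: power2_eq_square square_diff_square_factored abs_mult m_def)
  also have "\<dots> \<le> 4 * (4 * cmod (u - w))"
  proof (intro mult_left_mono mult_mono)
    show "m u + m w \<le> 4" by (simp add: m_def)
    show "\<bar>m u - m w\<bar> \<le> cmod (u - w)"
      using norm_triangle_ineq3[of u w] by (auto simp: m_def min_def)
  qed auto
  finally show ?thesis unfolding m by simp
qed

lemma bump_radial_mult_lipschitz:
  fixes u w :: complex
  shows "cmod (bump ((cmod u)\<^sup>2) * u - bump ((cmod w)\<^sup>2) * w) \<le> 34 * cmod (u - w)"
proof -
  \<comment> \<open>By symmetry one point may be taken in the disc of radius 2, since otherwise both
    terms vanish. The constant is \<open>2 + 16 * 2\<close>.\<close>
  have *: "cmod (bump ((cmod u)\<^sup>2) * u - bump ((cmod w)\<^sup>2) * w) \<le> 34 * cmod (u - w)" if "cmod w \<le> 2" for u w :: complex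
  proof -
    have "bump ((cmod u)\<^sup>2) * u - bump ((cmod w)\<^sup>2) * w =
        bump ((cmod u)\<^sup>2) * (u - w) + complex_of_real (bump ((cmod u)\<^sup>2) - bump ((cmod w)\<^sup>2)) * w"
      by (simp add: algebra_simps)
    also have "cmod \<dots> \<le> bump ((cmod u)\<^sup>2) * cmod (u - w) + \<bar>bump ((cmod u)\<^sup>2) - bump ((cmod w)\<^sup>2)\<bar> * cmod w"
      by (rule order_trans[OF norm_triangle_ineq]) (simp add: norm_mult bump_nonneg del: of_real_diff)
    also have "\<dots> \<le> 2 * cmod (u - w) + 16 * cmod (u - w) * 2"
      by (intro add_mono mult_mono bump_le bump_radial_lipschitz that) auto
    finally show ?thesis by simp
  qed
  consider "cmod w \<le> 2" | "cmod u \<le> 2" | "cmod u \<ge> 2" "cmod w \<ge> 2" by linarith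
  then show ?thesis
  proof cases
    case 1
    then show ?thesis by (rule *)
  next
    case 2
    then show ?thesis using *[of u w] by (simp add: norm_minus_commute)
  next
    case 3
    then have "(cmod u)\<^sup>2 \<ge> 4" "(cmod w)\<^sup>2 \<ge> 4"
      using power_mono[of 2 "cmod u" 2] power_mono[of 2 "cmod w" 2] by simp_all
    then show ?thesis by (simp add: bump_eq_0)
  qed
qed

lemma bump_radial_mult_le: "cmod (bump ((cmod u)\<^sup>2) * u) \<le> 4" for u :: complex
proof (cases "cmod u \<ge> 2")
  case True
  then have "(cmod u)\<^sup>2 \<ge> 2\<^sup>2" by (intro power_mono) auto
  then show ?thesis by (simp add: bump_eq_0)
next
  case False
  then have "bump ((cmod u)\<^sup>2) * cmod u \<le> 2 * 2"
    by (intro mult_mono bump_le) auto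
  then show ?thesis by (simp add: norm_mult bump_nonneg)
qed

section \<open>Lipschitz control of arguments and cutoff on the torus\<close>

lemma cos_ge_quadratic: "cos x \<ge> 1 - x\<^sup>2 / 2" for x :: real
proof -
  have "\<bar>sin (x / 2)\<bar> \<le> \<bar>x / 2\<bar>" by (rule abs_sin_x_le_abs_x)
  then have "(sin (x / 2))\<^sup>2 \<le> (x / 2)\<^sup>2" by (simp only: abs_le_square_iff)
  then show ?thesis using cos_double_sin[of "x / 2"] by (simp add: power_divide)
qed

lemma Re_unit_eq_cos:
  assumes "cmod z = 1"
  shows "Re z = cos (Im (Ln z))"
proof -
  have "z \<noteq> 0" using assms by auto
  then have "Re z = exp (Re (Ln z)) * cos (Im (Ln z))" using Re_exp[of "Ln z"] by simp
  then show ?thesis using \<open>z \<noteq> 0\<close> assms by simp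
qed

lemma Ln_lipschitz:
  assumes "Re z \<ge> 1 / 2" "Re w \<ge> 1 / 2"
  shows "cmod (Ln z - Ln w) \<le> 2 * cmod (z - w)"
proof (rule field_differentiable_bound[of "{z. Re z \<ge> 1 / 2}" Ln inverse])
  show "convex {z. 1 / 2 \<le> Re z}" by (rule convex_halfspace_Re_ge)
  fix x assume x: "x \<in> {z. 1 / 2 \<le> Re z}"
  then show "(Ln has_field_derivative inverse x) (at x within {z. 1 / 2 \<le> Re z})"
    by (intro has_field_derivative_at_within[OF has_field_derivative_Ln]) (auto simp: complex_nonpos_Reals_iff)
  have "cmod x \<ge> 1 / 2" using x complex_Re_le_cmod[of x] by simp
  then show "cmod (inverse x) \<le> 2" using le_imp_inverse_le[of "1 / 2" "cmod x"] by (simp add: norm_inverse del: inverse_eq_divide)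
qed (use assms in auto)

definition arg_pair :: "complex ^ 3 \<Rightarrow> complex" where
  "arg_pair z = Complex (arg1 z) (arg2 z)"

text \<open>Scaling by \<open>\<epsilon>\<close> inside and outside preserves the Lipschitz constant
  of \<open>G\<close>. The arguments are Lipschitz where both real parts are at least 1/2; otherwise
  either both values vanish or the points are at least 1/4 apart.\<close>

lemma scaled_lipschitz:
  fixes G :: "complex \<Rightarrow> complex" and \<epsilon> C :: real
  assumes lip: "\<And>u w. cmod (G u - G w) \<le> C * cmod (u - w)"
    and vanish: "\<And>u. cmod u \<ge> 2 \<Longrightarrow> G u = 0" and bound: "\<And>u. cmod (G u) \<le> C"
    and \<epsilon>: "0 < \<epsilon>" "\<epsilon> \<le> 1 / 8" and pq: "p \<in> T_tilde" "q \<in> T_tilde"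
  shows "cmod (\<epsilon> * G (arg_pair p / \<epsilon>) - \<epsilon> * G (arg_pair q / \<epsilon>)) \<le> 4 * C * norm (p - q)"
proof -
  have C: "C \<ge> 0" using bound[of 0] norm_ge_zero[of "G 0"] by linarith
  let ?f = "\<lambda>p. complex_of_real \<epsilon> * G (arg_pair p / \<epsilon>)"
  let ?H = "{z :: complex ^ 3. Re (z $ 1) \<ge> 1 / 2 \<and> Re (z $ 2) \<ge> 1 / 2}"
  have nth: "cmod (p $ i - q $ i) \<le> norm (p - q)" for i and p q :: "complex ^ 3"
    using Finite_Cartesian_Product.norm_nth_le[of "p - q" i] by simp
  have zero: "?f p = 0" if "2 * \<epsilon> \<le> cmod (arg_pair p)" for p
  proof -
    have "cmod (arg_pair p / \<epsilon>) \<ge> 2" using that \<epsilon> by (simp add: norm_divide field_simps)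
    then show ?thesis by (simp add: vanish)
  qed
  have outside: "cmod (?f p - ?f q) \<le> 4 * C * norm (p - q)"
    if p: "p \<in> T_tilde" "p \<notin> ?H" and q: "q \<in> T_tilde" for p q
  proof -
    obtain i where i: "i = 1 \<or> i = 2" and Re: "Re (p $ i) < 1 / 2" using p(2) by force
    have arg: "\<bar>Im (Ln (z $ i))\<bar> \<le> cmod (arg_pair z)" for z :: "complex ^ 3"
      using i abs_Re_le_cmod[of "arg_pair z"] abs_Im_le_cmod[of "arg_pair z"]
      by (auto simp: arg_pair_def arg1_def arg2_def)
    have cos: "Re (z $ i) \<ge> 1 - (cmod (arg_pair z))\<^sup>2 / 2" if "z \<in> T_tilde" for z
    proof -
      have "Re (z $ i) = cos (Im (Ln (z $ i)))"
        by (rule Re_unit_eq_cos) (use that i in \<open>auto simp: T_tilde_iff\<close>)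
      moreover have "(Im (Ln (z $ i)))\<^sup>2 \<le> (cmod (arg_pair z))\<^sup>2"
        using arg[of z] by (simp add: abs_le_square_iff[symmetric])
      ultimately show ?thesis using cos_ge_quadratic[of "Im (Ln (z $ i))"] by linarith
    qed
    \<comment> \<open>Otherwise the cosine bound would give real part at least 1/2.\<close>
    have "cmod (arg_pair p) > 1"
    proof (rule ccontr)
      assume "\<not> cmod (arg_pair p) > 1"
      then have "(cmod (arg_pair p))\<^sup>2 \<le> 1" by (simp add: power_le_one)
      then show False using cos[OF p(1)] Re by linarith
    qed
    then have fp: "?f p = 0" using \<epsilon> by (intro zero) linarith
    show ?thesis
    proof (cases "2 * \<epsilon> \<le> cmod (arg_pair q)")
      case True
      then have fq: "?f q = 0" by (rule zero)
      show ?thesis unfolding fp fq using C by simp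
    next
      case False
      \<comment> \<open>The arguments of \<open>q\<close> are below
        \<open>2 * \<epsilon> \<le> 1 / 4\<close>, so its real part is at least 3/4 while that of
        \<open>p\<close> is below 1/2. With this gap the uniform bound \<open>C\<close>
        suffices.\<close>
      then have "(cmod (arg_pair q))\<^sup>2 \<le> (1 / 4)\<^sup>2" using \<epsilon> by (intro power_mono) auto
      then have "Re (q $ i) \<ge> 3 / 4" using cos[OF q] by (simp add: power2_eq_square)
      then have "1 / 4 \<le> \<bar>Re (p $ i - q $ i)\<bar>" using Re by simp
      also have "\<dots> \<le> norm (p - q)" using abs_Re_le_cmod nth order_trans by blast
      finally have d: "1 / 4 \<le> norm (p - q)" .
      have "cmod (?f p - ?f q) = \<epsilon> * cmod (G (arg_pair q / \<epsilon>))" using \<epsilon> by (simp add: fp norm_mult)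
      also have "\<dots> \<le> 1 * C" using \<epsilon> bound by (intro mult_mono) auto
      also have "\<dots> \<le> 4 * C * norm (p - q)" using d C mult_left_mono[OF d, of "4 * C"] by simp
      finally show ?thesis .
    qed
  qed
  consider "p \<notin> ?H" | "q \<notin> ?H" | "p \<in> ?H" "q \<in> ?H" by blast
  then show ?thesis
  proof cases
    case 1
    then show ?thesis by (intro outside pq)
  next
    case 2
    then show ?thesis using outside[OF pq(2) _ pq(1)] by (simp add: norm_minus_commute)
  next
    case 3
    have arg: "\<bar>Im (Ln (p $ i)) - Im (Ln (q $ i))\<bar> \<le> 2 * norm (p - q)"
      if "Re (p $ i) \<ge> 1 / 2" "Re (q $ i) \<ge> 1 / 2" for i
    proof -
      have "\<bar>Im (Ln (p $ i) - Ln (q $ i))\<bar> \<le> cmod (Ln (p $ i) - Ln (q $ i))" by (rule abs_Im_le_cmod)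
      also have "\<dots> \<le> 2 * cmod (p $ i - q $ i)" using that by (rule Ln_lipschitz)
      also have "\<dots> \<le> 2 * norm (p - q)" using nth by simp
      finally show ?thesis by simp
    qed
    have "cmod (arg_pair p - arg_pair q) \<le> \<bar>arg1 p - arg1 q\<bar> + \<bar>arg2 p - arg2 q\<bar>"
      using cmod_le[of "arg_pair p - arg_pair q"] by (simp add: arg_pair_def)
    also have "\<dots> \<le> 2 * norm (p - q) + 2 * norm (p - q)"
      unfolding arg1_def arg2_def using 3 by (intro add_mono arg) auto
    finally have a: "cmod (arg_pair p - arg_pair q) \<le> 4 * norm (p - q)" by simp
    have "cmod (?f p - ?f q) = \<epsilon> * cmod (G (arg_pair p / \<epsilon>) - G (arg_pair q / \<epsilon>))"
      using \<epsilon> by (simp add: norm_mult flip: right_diff_distrib)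
    also have "\<dots> \<le> \<epsilon> * (C * cmod (arg_pair p / \<epsilon> - arg_pair q / \<epsilon>))"
      using \<epsilon> lip by (intro mult_left_mono) auto
    also have "\<dots> = C * cmod (arg_pair p - arg_pair q)"
      using \<epsilon> by (simp add: norm_divide flip: diff_divide_distrib)
    also have "\<dots> \<le> C * (4 * norm (p - q))" using a C by (intro mult_left_mono)
    finally show ?thesis by simp
  qed
qed

text \<open>Both products become the real and imaginary part of one map in the form of
  \<open>scaled_lipschitz\<close>.\<close>

lemma cutoff_arg_pair:
  assumes "\<epsilon> > 0"
  shows "cutoff \<epsilon> z = bump ((cmod (arg_pair z / \<epsilon>))\<^sup>2)"
    "cutoff \<epsilon> z * arg1 z = Re (\<epsilon> * (bump ((cmod (arg_pair z / \<epsilon>))\<^sup>2) * (arg_pair z / \<epsilon>)))"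
    "cutoff \<epsilon> z * arg2 z = Im (\<epsilon> * (bump ((cmod (arg_pair z / \<epsilon>))\<^sup>2) * (arg_pair z / \<epsilon>)))"
proof -
  show c: "cutoff \<epsilon> z = bump ((cmod (arg_pair z / \<epsilon>))\<^sup>2)"
    by (simp add: cutoff_def arg_pair_def norm_divide power_divide cmod_power2)
  have "\<epsilon> * (bump ((cmod (arg_pair z / \<epsilon>))\<^sup>2) * (arg_pair z / \<epsilon>)) = cutoff \<epsilon> z * arg_pair z"
    unfolding c using assms by simp
  then show "cutoff \<epsilon> z * arg1 z = Re (\<epsilon> * (bump ((cmod (arg_pair z / \<epsilon>))\<^sup>2) * (arg_pair z / \<epsilon>)))"
    "cutoff \<epsilon> z * arg2 z = Im (\<epsilon> * (bump ((cmod (arg_pair z / \<epsilon>))\<^sup>2) * (arg_pair z / \<epsilon>)))"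
    by (simp_all only: Re_complex_of_real Im_complex_of_real) (simp_all add: arg_pair_def)
qed

lemma cutoff_bounds:
  assumes \<epsilon>: "0 < \<epsilon>" "\<epsilon> \<le> 1 / 8"
  shows "\<bar>cutoff \<epsilon> z * arg1 z\<bar> \<le> 4 * \<epsilon>" "\<bar>cutoff \<epsilon> z * arg2 z\<bar> \<le> 4 * \<epsilon>" "\<bar>\<epsilon> * cutoff \<epsilon> z\<bar> \<le> 2 * \<epsilon>"
proof -
  have "cmod (\<epsilon> * (bump ((cmod (arg_pair z / \<epsilon>))\<^sup>2) * (arg_pair z / \<epsilon>))) \<le> \<epsilon> * 4"
    unfolding norm_mult[of "complex_of_real \<epsilon>"] norm_of_real abs_of_pos[OF \<epsilon>(1)]
    using \<epsilon>(1) by (intro mult_left_mono bump_radial_mult_le) simp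
  then show "\<bar>cutoff \<epsilon> z * arg1 z\<bar> \<le> 4 * \<epsilon>" "\<bar>cutoff \<epsilon> z * arg2 z\<bar> \<le> 4 * \<epsilon>"
    unfolding cutoff_arg_pair(2,3)[OF \<epsilon>(1)]
    using abs_Re_le_cmod abs_Im_le_cmod order_trans by (metis mult.commute)+
  show "\<bar>\<epsilon> * cutoff \<epsilon> z\<bar> \<le> 2 * \<epsilon>"
    using \<epsilon> bump_le bump_nonneg by (simp add: cutoff_def abs_mult)
qed

text \<open>The constant is \<open>4 * 34\<close>: 34 from \<open>bump_radial_mult_lipschitz\<close>
  and 4 from \<open>scaled_lipschitz\<close>.\<close>

lemma cutoff_lipschitz:
  assumes \<epsilon>: "0 < \<epsilon>" "\<epsilon> \<le> 1 / 8" and pq: "p \<in> T_tilde" "q \<in> T_tilde"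
  shows "\<bar>cutoff \<epsilon> p * arg1 p - cutoff \<epsilon> q * arg1 q\<bar> \<le> 136 * norm (p - q)"
    "\<bar>cutoff \<epsilon> p * arg2 p - cutoff \<epsilon> q * arg2 q\<bar> \<le> 136 * norm (p - q)"
    "\<bar>\<epsilon> * cutoff \<epsilon> p - \<epsilon> * cutoff \<epsilon> q\<bar> \<le> 136 * norm (p - q)"
proof -
  have proj: "\<bar>Re x - Re y\<bar> \<le> 136 * norm (p - q)" "\<bar>Im x - Im y\<bar> \<le> 136 * norm (p - q)"
    if "cmod (x - y) \<le> 4 * 34 * norm (p - q)" for x y
    using that abs_Re_le_cmod[of "x - y"] abs_Im_le_cmod[of "x - y"] by simp_all
  have sq: "(cmod u)\<^sup>2 \<ge> 4" if "cmod u \<ge> 2" for u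
    using power_mono[OF that, of 2] by simp
  have "cmod (\<epsilon> * (bump ((cmod (arg_pair p / \<epsilon>))\<^sup>2) * (arg_pair p / \<epsilon>)) -
      \<epsilon> * (bump ((cmod (arg_pair q / \<epsilon>))\<^sup>2) * (arg_pair q / \<epsilon>))) \<le> 4 * 34 * norm (p - q)"
  proof (rule scaled_lipschitz[where G = "\<lambda>u. bump ((cmod u)\<^sup>2) * u", OF bump_radial_mult_lipschitz _ _ \<epsilon> pq])
    show "bump ((cmod u)\<^sup>2) * u = 0" if "cmod u \<ge> 2" for u :: complex
      using bump_eq_0[OF sq[OF that]] by simp
    show "cmod (bump ((cmod u)\<^sup>2) * u) \<le> 34" for u :: complex
      using bump_radial_mult_le[of u] by linarith
  qed
  then show "\<bar>cutoff \<epsilon> p * arg1 p - cutoff \<epsilon> q * arg1 q\<bar> \<le> 136 * norm (p - q)"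
    "\<bar>cutoff \<epsilon> p * arg2 p - cutoff \<epsilon> q * arg2 q\<bar> \<le> 136 * norm (p - q)"
    unfolding cutoff_arg_pair(2,3)[OF \<epsilon>(1)] by (rule proj)+
  have "cmod (\<epsilon> * complex_of_real (bump ((cmod (arg_pair p / \<epsilon>))\<^sup>2)) -
      \<epsilon> * complex_of_real (bump ((cmod (arg_pair q / \<epsilon>))\<^sup>2))) \<le> 4 * 34 * norm (p - q)"
  proof (rule scaled_lipschitz[where G = "\<lambda>u. complex_of_real (bump ((cmod u)\<^sup>2))", OF _ _ _ \<epsilon> pq])
    show "complex_of_real (bump ((cmod u)\<^sup>2)) = 0" if "cmod u \<ge> 2" for u
      using bump_eq_0[OF sq[OF that]] by simp
    show "cmod (complex_of_real (bump ((cmod u)\<^sup>2))) \<le> 34" for u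
      using bump_le[of "(cmod u)\<^sup>2"] bump_nonneg[of "(cmod u)\<^sup>2"] by simp
    fix u w :: complex
    show "cmod (complex_of_real (bump ((cmod u)\<^sup>2)) - complex_of_real (bump ((cmod w)\<^sup>2))) \<le> 34 * cmod (u - w)"
      using bump_radial_lipschitz[of u w] norm_ge_zero[of "u - w"]
      unfolding of_real_diff[symmetric] norm_of_real by linarith
  qed
  then show "\<bar>\<epsilon> * cutoff \<epsilon> p - \<epsilon> * cutoff \<epsilon> q\<bar> \<le> 136 * norm (p - q)"
    unfolding cutoff_arg_pair(1)[OF \<epsilon>(1)] of_real_mult[symmetric] of_real_diff[symmetric] norm_of_real by simp
qed

lemma exp_lipschitz:
  fixes a b :: real
  assumes "\<bar>a\<bar> \<le> 1" "\<bar>b\<bar> \<le> 1"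
  shows "\<bar>exp a - exp b\<bar> \<le> 3 * \<bar>a - b\<bar>"
proof -
  have "norm (exp a - exp b) \<le> 3 * norm (a - b)"
  proof (rule field_differentiable_bound[of "{-1..1}" exp exp])
    fix x :: real assume "x \<in> {-1..1}"
    then have "exp x \<le> exp 1" by simp
    from order_trans[OF this exp_le] show "norm (exp x) \<le> 3" by simp
  qed (use assms in \<open>auto intro!: derivative_eq_intros\<close>)
  then show ?thesis by simp
qed

section \<open>Size and Lipschitz constant of the displacement\<close>

lemma norm_vector_3_le: "norm (vector [a, b, c] :: complex ^ 3) \<le> cmod a + cmod b + cmod c"
  unfolding norm_vec_def by (rule order_trans[OF L2_set_le_sum]) (simp_all add: sum_3)

lemma warp_minus_id:
  "warp \<epsilon> p - p = vector [p $ 1 * complex_of_real (exp (- (cutoff \<epsilon> p * arg2 p)) - 1),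
     p $ 2 * complex_of_real (exp (cutoff \<epsilon> p * arg1 p) - 1),
     p $ 3 * complex_of_real (exp (cutoff \<epsilon> p * arg2 p - cutoff \<epsilon> p * arg1 p) - 1) + complex_of_real (\<epsilon> * cutoff \<epsilon> p)]"
  by (simp add: warp_def vec3_eq_iff algebra_simps)

lemma cmod_T_tilde:
  assumes "p \<in> T_tilde"
  shows "cmod (p $ i) = 1"
  using assms exhaust_3[of i] by (auto simp: T_tilde_iff norm_mult)

text \<open>The terms add up to \<open>50 * \<epsilon>\<close>. The constant 2000 is shared with
  \<open>warp_lipschitz\<close>, where the sum is 1777 times the distance.\<close>

lemma warp_close:
  assumes \<epsilon>: "0 < \<epsilon>" "\<epsilon> \<le> 1 / 8" and p: "p \<in> T_tilde"
  shows "norm (warp \<epsilon> p - p) \<le> 2000 * \<epsilon>"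
proof -
  note b = cutoff_bounds[OF \<epsilon>, of p]
  have e: "cmod (p $ i * complex_of_real (exp a - 1)) \<le> 3 * \<bar>a\<bar>" if "\<bar>a\<bar> \<le> 1" for a i
    using exp_lipschitz[OF that, of 0] by (simp add: norm_mult cmod_T_tilde[OF p] del: of_real_diff)
  have "norm (warp \<epsilon> p - p) \<le> 3 * \<bar>- (cutoff \<epsilon> p * arg2 p)\<bar> + 3 * \<bar>cutoff \<epsilon> p * arg1 p\<bar> +
      (3 * \<bar>cutoff \<epsilon> p * arg2 p - cutoff \<epsilon> p * arg1 p\<bar> + \<bar>\<epsilon> * cutoff \<epsilon> p\<bar>)"
    unfolding warp_minus_id
    by (intro order_trans[OF norm_vector_3_le] add_mono order_trans[OF norm_triangle_ineq] e)
      (use b \<epsilon> in \<open>simp_all add: norm_mult\<close>)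
  also have "\<dots> \<le> 2000 * \<epsilon>"
  proof -
    have "3 * \<bar>- B\<bar> + 3 * \<bar>A\<bar> + (3 * \<bar>B - A\<bar> + \<bar>D\<bar>) \<le> 2000 * \<epsilon>"
      if "\<bar>A\<bar> \<le> 4 * \<epsilon>" "\<bar>B\<bar> \<le> 4 * \<epsilon>" "\<bar>D\<bar> \<le> 2 * \<epsilon>" for A B D
    proof -
      have "\<bar>- B\<bar> \<le> 4 * \<epsilon>" "\<bar>B - A\<bar> \<le> 8 * \<epsilon>" using that by linarith+
      then have "3 * \<bar>- B\<bar> + 3 * \<bar>A\<bar> + (3 * \<bar>B - A\<bar> + \<bar>D\<bar>) \<le>
          3 * (4 * \<epsilon>) + 3 * (4 * \<epsilon>) + (3 * (8 * \<epsilon>) + 2 * \<epsilon>)"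
        using that by (intro add_mono mult_left_mono) auto
      then show ?thesis using \<epsilon>(1) by simp
    qed
    then show ?thesis using b .
  qed
  finally show ?thesis .
qed

lemma warp_lipschitz:
  assumes \<epsilon>: "0 < \<epsilon>" "\<epsilon> \<le> 1 / 8" and p: "p \<in> T_tilde" and q: "q \<in> T_tilde"
  shows "norm ((warp \<epsilon> p - p) - (warp \<epsilon> q - q)) \<le> 2000 * dist p q"
proof -
  note b = cutoff_bounds[OF \<epsilon>, of p] cutoff_bounds[OF \<epsilon>, of q]
  note l = cutoff_lipschitz[OF \<epsilon> p q]
  let ?n = "norm (p - q)"
  have e: "cmod (p $ i * complex_of_real (exp a - 1) - q $ i * complex_of_real (exp a' - 1)) \<le> 3 * ?n + 3 * \<bar>a - a'\<bar>"
    if "\<bar>a\<bar> \<le> 1" "\<bar>a'\<bar> \<le> 1" for a a' i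
  proof -
    \<comment> \<open>The product difference is split so that each term pairs a small difference
      with a bounded factor: \<open>exp a - 1\<close>, or a coordinate of \<open>q\<close> of
      modulus 1.\<close>
    have "p $ i * complex_of_real (exp a - 1) - q $ i * complex_of_real (exp a' - 1) =
        (p - q) $ i * complex_of_real (exp a - 1) + q $ i * complex_of_real (exp a - exp a')"
      by (simp add: algebra_simps)
    also have "cmod \<dots> \<le> cmod ((p - q) $ i) * \<bar>exp a - 1\<bar> + \<bar>exp a - exp a'\<bar>"
      by (rule order_trans[OF norm_triangle_ineq]) (simp add: norm_mult cmod_T_tilde[OF q] del: of_real_diff vector_minus_component)
    also have "\<dots> \<le> ?n * 3 + 3 * \<bar>a - a'\<bar>"
    proof (intro add_mono mult_mono)
      show "cmod ((p - q) $ i) \<le> ?n" by (rule Finite_Cartesian_Product.norm_nth_le)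
      show "\<bar>exp a - 1\<bar> \<le> 3" using exp_lipschitz[OF that(1), of 0] that(1) by simp
      show "\<bar>exp a - exp a'\<bar> \<le> 3 * \<bar>a - a'\<bar>" by (rule exp_lipschitz[OF that])
    qed auto
    finally show ?thesis by simp
  qed
  have diff: "(vector [x, y, z] :: complex ^ 3) - vector [x', y', z'] = vector [x - x', y - y', z - z']" for x y z x' y' z'
    by (simp add: vec3_eq_iff)
  have split: "x + complex_of_real r - (y + complex_of_real r') = (x - y) + complex_of_real (r - r')" for x y r r'
    by simp
  have "norm ((warp \<epsilon> p - p) - (warp \<epsilon> q - q)) \<le>
      (3 * ?n + 3 * \<bar>- (cutoff \<epsilon> p * arg2 p) - - (cutoff \<epsilon> q * arg2 q)\<bar>) +
      (3 * ?n + 3 * \<bar>cutoff \<epsilon> p * arg1 p - cutoff \<epsilon> q * arg1 q\<bar>) +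
      ((3 * ?n + 3 * \<bar>(cutoff \<epsilon> p * arg2 p - cutoff \<epsilon> p * arg1 p) - (cutoff \<epsilon> q * arg2 q - cutoff \<epsilon> q * arg1 q)\<bar>) +
       \<bar>\<epsilon> * cutoff \<epsilon> p - \<epsilon> * cutoff \<epsilon> q\<bar>)"
    unfolding warp_minus_id diff split
    by (intro order_trans[OF norm_vector_3_le] add_mono order_trans[OF norm_triangle_ineq] e)
      (use b \<epsilon> in \<open>simp_all del: of_real_diff of_real_mult\<close>)
  also have "\<dots> \<le> 2000 * ?n"
  proof -
    have "(3 * ?n + 3 * \<bar>- B - - B'\<bar>) + (3 * ?n + 3 * \<bar>A - A'\<bar>) +
        ((3 * ?n + 3 * \<bar>(B - A) - (B' - A')\<bar>) + \<bar>D - D'\<bar>) \<le> 2000 * ?n"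
      if "\<bar>A - A'\<bar> \<le> 136 * ?n" "\<bar>B - B'\<bar> \<le> 136 * ?n" "\<bar>D - D'\<bar> \<le> 136 * ?n" for A A' B B' D D'
    proof -
      have "\<bar>- B - - B'\<bar> \<le> 136 * ?n" "\<bar>(B - A) - (B' - A')\<bar> \<le> 272 * ?n" using that by linarith+
      then have "(3 * ?n + 3 * \<bar>- B - - B'\<bar>) + (3 * ?n + 3 * \<bar>A - A'\<bar>) +
          ((3 * ?n + 3 * \<bar>(B - A) - (B' - A')\<bar>) + \<bar>D - D'\<bar>) \<le>
          (3 * ?n + 3 * (136 * ?n)) + (3 * ?n + 3 * (136 * ?n)) + ((3 * ?n + 3 * (272 * ?n)) + 136 * ?n)"
        using that by (intro add_mono mult_left_mono order_refl) auto
      then show ?thesis by (rule order_trans) (use norm_ge_zero[of "p - q"] in linarith)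
    qed
    then show ?thesis using l .
  qed
  finally show ?thesis by (simp add: dist_norm)
qed

text \<open>Interpolation: at distance \<open>d \<le> \<epsilon>\<close> use the Lipschitz bound, at \<open>d \<ge> \<epsilon>\<close> the uniform one.\<close>

lemma hoelder_norm_le:
  assumes \<alpha>: "0 \<le> \<alpha>" "\<alpha> < 1" and "0 < \<epsilon>" "0 \<le> C"
    and close: "\<And>p. p \<in> M \<Longrightarrow> norm (f p) \<le> C * \<epsilon>"
    and lip: "\<And>p q. p \<in> M \<Longrightarrow> q \<in> M \<Longrightarrow> norm (f p - f q) \<le> C * dist p q"
  shows "hoelder_norm \<alpha> M f \<le> ennreal (C * \<epsilon> + 2 * C * \<epsilon> powr (1 - \<alpha>))"
proof -
  have quotient: "norm (f p - f q) / dist p q powr \<alpha> \<le> 2 * C * \<epsilon> powr (1 - \<alpha>)"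
    if "p \<in> M" "q \<in> M" "q \<noteq> p" for p q
  proof -
    define d where "d = dist p q"
    have d: "d > 0" using that(3) by (simp add: d_def)
    have "norm (f p - f q) \<le> 2 * C * \<epsilon> powr (1 - \<alpha>) * d powr \<alpha>"
    proof (cases "d \<le> \<epsilon>")
      case True
      have "norm (f p - f q) \<le> C * d" using lip that by (simp add: d_def)
      \<comment> \<open>The factor \<open>d powr \<alpha>\<close> is set aside; since
        \<open>1 - \<alpha> > 0\<close>, the other one grows with \<open>d\<close> and is at most
        \<open>\<epsilon> powr (1 - \<alpha>)\<close>.\<close>
      also have "d = d powr (1 - \<alpha>) * d powr \<alpha>" using d by (simp flip: powr_add)
      also have "C * (d powr (1 - \<alpha>) * d powr \<alpha>) \<le> C * (\<epsilon> powr (1 - \<alpha>) * d powr \<alpha>)"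
        using True d \<alpha> \<open>0 \<le> C\<close> by (intro mult_left_mono mult_right_mono powr_mono2) auto
      also have "\<dots> \<le> 2 * (C * (\<epsilon> powr (1 - \<alpha>) * d powr \<alpha>))" using \<open>0 \<le> C\<close> by simp
      finally show ?thesis by (simp add: mult.assoc)
    next
      case False
      have "norm (f p - f q) \<le> C * \<epsilon> + C * \<epsilon>"
        using norm_triangle_ineq4[of "f p" "f q"] close that(1,2) by (meson add_mono order_trans)
      \<comment> \<open>Now \<open>\<epsilon>\<close> is split in the same way, and
        \<open>\<epsilon> powr \<alpha>\<close> is at most \<open>d powr \<alpha>\<close>.\<close>
      also have "\<dots> = 2 * C * (\<epsilon> powr (1 - \<alpha>) * \<epsilon> powr \<alpha>)" using \<open>0 < \<epsilon>\<close> by (simp flip: powr_add)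
      also have "\<dots> \<le> 2 * C * (\<epsilon> powr (1 - \<alpha>) * d powr \<alpha>)"
        using False \<alpha> \<open>0 \<le> C\<close> \<open>0 < \<epsilon>\<close> by (intro mult_left_mono powr_mono2) auto
      finally show ?thesis by (simp add: mult.assoc)
    qed
    then show ?thesis using d by (simp add: d_def pos_divide_le_eq)
  qed
  have "hoelder_norm \<alpha> M f \<le> ennreal (C * \<epsilon>) + ennreal (2 * C * \<epsilon> powr (1 - \<alpha>))"
    unfolding hoelder_norm_def
  proof (rule add_mono)
    show "(SUP p\<in>M. ennreal (norm (f p))) \<le> ennreal (C * \<epsilon>)"
      by (intro SUP_least ennreal_leI close)
    have "(SUP p\<in>M. SUP q\<in>M - {p}. ennreal (norm (f p - f q) / dist p q powr \<alpha>)) \<le> ennreal (2 * C * \<epsilon> powr (1 - \<alpha>))"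
      by (intro SUP_least ennreal_leI quotient) auto
    then show "(if \<alpha> = 0 then 0 else SUP p\<in>M. SUP q\<in>M - {p}. ennreal (norm (f p - f q) / dist p q powr \<alpha>))
        \<le> ennreal (2 * C * \<epsilon> powr (1 - \<alpha>))" by simp
  qed
  also have "\<dots> = ennreal (C * \<epsilon> + 2 * C * \<epsilon> powr (1 - \<alpha>))"
    using assms by (intro ennreal_plus[symmetric]) auto
  finally show ?thesis .
qed

lemma hoelder_norm_cong: "(\<And>p. p \<in> M \<Longrightarrow> f p = g p) \<Longrightarrow> hoelder_norm \<alpha> M f = hoelder_norm \<alpha> M g"
  unfolding hoelder_norm_def by (intro arg_cong2[of _ _ _ _ "(+)"] if_cong SUP_cong refl) auto

lemma warp_hoelder_convergence:
  assumes \<alpha>: "0 \<le> \<alpha>" "\<alpha> < 1" and \<epsilon>: "\<And>j :: nat. 0 < \<epsilon> j" "\<And>j. \<epsilon> j \<le> 1 / 8" "\<epsilon> \<longlonglongrightarrow> 0"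
  shows "(\<lambda>j. hoelder_norm \<alpha> T_tilde (\<lambda>p. warp (\<epsilon> j) p - p)) \<longlonglongrightarrow> 0"
proof (rule tendsto_sandwich[where f = "\<lambda>_. 0"])
  show "\<forall>\<^sub>F j in sequentially. hoelder_norm \<alpha> T_tilde (\<lambda>p. warp (\<epsilon> j) p - p)
      \<le> ennreal (2000 * \<epsilon> j + 2 * 2000 * \<epsilon> j powr (1 - \<alpha>))"
    by (intro always_eventually allI hoelder_norm_le \<alpha> warp_close warp_lipschitz \<epsilon>(1,2)) auto
  \<comment> \<open>Here \<open>\<alpha> < 1\<close> enters: only a positive exponent makes the
    power tend to 0 with its base.\<close>
  have "(\<lambda>j. \<epsilon> j powr (1 - \<alpha>)) \<longlonglongrightarrow> 0 powr (1 - \<alpha>)"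
    by (rule tendsto_powr'[OF \<epsilon>(3) tendsto_const]) (use \<epsilon>(1) \<alpha> in \<open>auto intro!: always_eventually less_imp_le\<close>)
  then have "(\<lambda>j. 2000 * \<epsilon> j + 2 * 2000 * \<epsilon> j powr (1 - \<alpha>)) \<longlonglongrightarrow> 2000 * 0 + 2 * 2000 * 0 powr (1 - \<alpha>)"
    by (rule tendsto_add[OF tendsto_mult[OF tendsto_const \<epsilon>(3)] tendsto_mult[OF tendsto_const]])
  from tendsto_ennrealI[OF this]
  show "(\<lambda>j. ennreal (2000 * \<epsilon> j + 2 * 2000 * \<epsilon> j powr (1 - \<alpha>))) \<longlonglongrightarrow> 0" by simp
  show "(\<lambda>j. 0 :: ennreal) \<longlonglongrightarrow> 0" by simp
qed auto

section \<open>Perturbations along a sequence of scales tending to zero\<close>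

theorem corollary1p4:
  shows "smooth_submanifold 2 T_tilde \<and>
    (\<exists>h. diffeomorphism (sphere (0::complex) 1 \<times> sphere (0::complex) 1) T_tilde h) \<and>
    totally_real T_tilde \<and>
    compact T_tilde \<and> polynomially_convex T_tilde \<and>
    (\<forall>\<alpha>::real. 0 \<le> \<alpha> \<and> \<alpha> < 1 \<longrightarrow>
       admits_small_perturbation \<alpha> T_tilde
         (\<lambda>N. totally_real N \<and> compact N \<and>
              \<not> polynomially_convex N \<and> \<not> rationally_convex N))"
proof (intro conjI allI impI)
  show "smooth_submanifold 2 T_tilde" by (rule smooth_submanifold_T_tilde)
  show "\<exists>h. diffeomorphism (sphere (0::complex) 1 \<times> sphere (0::complex) 1) T_tilde h"
    using torus_diffeomorphic_T_tilde by blast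
  show "totally_real T_tilde" "compact T_tilde" "polynomially_convex T_tilde"
    by (rule totally_real_T_tilde compact_T_tilde polynomially_convex_T_tilde)+
  fix \<alpha> :: real
  assume \<alpha>: "0 \<le> \<alpha> \<and> \<alpha> < 1"
  \<comment> \<open>The scales start at 1/8, the largest admissible value, and decrease to
    0.\<close>
  define \<epsilon> :: "nat \<Rightarrow> real" where "\<epsilon> j = inverse (real (Suc j)) / 8" for j
  have \<epsilon>0: "0 < \<epsilon> j" and \<epsilon>1: "\<epsilon> j \<le> 1 / 8" for j
    by (simp_all add: \<epsilon>_def inverse_le_1_iff)
  have lim: "\<epsilon> \<longlonglongrightarrow> 0"
    using tendsto_divide[OF LIMSEQ_inverse_real_of_nat tendsto_const[of "8::real"]]
    by (simp add: \<epsilon>_def[abs_def])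
  show "admits_small_perturbation \<alpha> T_tilde
      (\<lambda>N. totally_real N \<and> compact N \<and> \<not> polynomially_convex N \<and> \<not> rationally_convex N)"
    unfolding admits_small_perturbation_def
  proof (intro exI conjI ballI allI)
    show "tubular_neighbourhood T_tilde axes_complement" by (rule tubular_neighbourhood_T_tilde)
    show "smooth_submersion axes_complement T_tilde torus_retraction"
      by (rule smooth_submersion_torus_retraction)
    show "torus_retraction p = p" if "p \<in> T_tilde" for p by (rule torus_retraction_id[OF that])
    fix j
    show "smooth_submanifold 2 (warped_torus (\<epsilon> j))"
      unfolding warped_torus_def
      by (rule smooth_submanifold_diffeomorphic_image[OF smooth_submanifold_T_tilde T_tilde_subset
            open_axes_complement open_axes_complement diffeomorphism_warp[OF \<epsilon>0 \<epsilon>1]])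
    show "warped_torus (\<epsilon> j) \<subseteq> axes_complement" by (rule warped_torus_subset)
    show "totally_real (warped_torus (\<epsilon> j))" by (rule totally_real_warped_torus[OF \<epsilon>0 \<epsilon>1])
    show "compact (warped_torus (\<epsilon> j))" by (rule compact_warped_torus[OF \<epsilon>0 \<epsilon>1])
    show not_rational: "\<not> rationally_convex (warped_torus (\<epsilon> j))"
      by (rule not_rationally_convex_warped_torus[OF \<epsilon>0 \<epsilon>1])
    show "\<not> polynomially_convex (warped_torus (\<epsilon> j))"
      using not_rational polynomially_convex_imp_rationally_convex by blast
    show "diffeomorphism (warped_torus (\<epsilon> j)) T_tilde torus_retraction"
      by (rule diffeomorphism_torus_retraction[OF \<epsilon>0 \<epsilon>1])
  next
    \<comment> \<open>The section of the retraction is \<open>warp (\<epsilon> j)\<close> on the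
      torus, the only place where the norm evaluates it.\<close>
    have "hoelder_norm \<alpha> T_tilde (\<lambda>p. the_inv_into (warped_torus (\<epsilon> j)) torus_retraction p - p) =
        hoelder_norm \<alpha> T_tilde (\<lambda>p. warp (\<epsilon> j) p - p)" for j
      by (rule hoelder_norm_cong) (simp add: diffeomorphism_torus_retraction(2)[OF \<epsilon>0 \<epsilon>1])
    then show "(\<lambda>j. hoelder_norm \<alpha> T_tilde
        (\<lambda>p. the_inv_into (warped_torus (\<epsilon> j)) torus_retraction p - p)) \<longlonglongrightarrow> 0"
      using warp_hoelder_convergence[of \<alpha> \<epsilon>] \<alpha> \<epsilon>0 \<epsilon>1 lim by simp
  qed
qed

end
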